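(* Let $I=\operatorname{Ann}(G)$, where $G\in S$ is a generic form of degree $e\ge 1$, and let $d=\lfloor e/2\rfloor$. Then $\operatorname{in}(I)$ is a reverse lexicographic, hence strongly stable, ideal that is generated in degrees $q$ with $d+1\le q\le e+1$ and contains all monomials of degree $d+1$ not divisible by $x_n$, and $$\beta_p(R/\operatorname{in}(I))=\beta_p(R/\mathfrak m^{d+1})\quad\text{for all }p\ge 0.$$ Moreover, let $a_{i,q}$ denote the number of minimal generators of $\operatorname{in}(I)$ that have degree $q$ and that are divisible by $x_i$ but not by any $x_j$ with $j>i$. Then $$\beta_{p,p+q}(R/\operatorname{in}(I))=\sum_{i=1}^{n}a_{i,q}\binom{i-1}{p-1}\quad\text{for all }p\ge 1\text{ and }q\ge 0,$$ where $a_{i,d+1}=\dim_k k[x_1,\ldots,x_i]_d=\binom{d+i-1}{d}$ for all $i<n$; $a_{i,q}=0$ for all $i<n$ and $q>d+1$; $a_{n,q}=\dim_k k[x_1,\ldots,x_{n-1}]_{e+1-q}=\binom{e-q+n-1}{n-2}$ for all $q>d+1$; $a_{n,d+1}=0$ if $e=2d+1$ is odd; and $a_{n,d+1}=\dim_k k[x_1,\ldots,x_{n-1}]_d=\binom{d+n-2}{d}$ if $e=2d$ is even. Consequently, $$\beta_{p,p+q}(R/\operatorname{in}(I))=\binom{e-q+n-1}{n-2}\binom{n-1}{p-1}$$ for all $p\ge 1$ and $q>d+1$, whereas $$\beta_{p,p+d+1}(R/\operatorname{in}(I))=\begin{cases}\displaystyle\sum_{i=1}^{n-1}\binom{d+i-1}{d}\binom{i-1}{p-1}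 & \text{if } e=2d+1\text{ is odd},\\[2ex] \displaystyle\binom{d+n-2}{d}+\sum_{i=1}^{n-1}\binom{d+i-1}{d}\binom{i-1}{p-1} & \text{if } e=2d\text{ is even}\end{cases}$$ for all $p\ge 1$.
   Context: $k$ is a field, $R=k[x_1,\ldots,x_n]$ is the standard graded polynomial ring with the degree reverse lexicographic order induced by $x_1\succ\cdots\succ x_n$, $\mathfrak m=(x_1,\ldots,x_n)$, and $S=k[X_1,\ldots,X_n]$. $S$ is an $R$-module via differentiation, $x_i\circ g=\frac{\partial}{\partial X_i}g$; in positive characteristic differentiation is replaced by contraction, i.e. $x_i\circ X_1^{a_1}\cdots X_n^{a_n}=X_1^{a_1}\cdots X_i^{a_i-1}\cdots X_n^{a_n}$ if $a_i\ge 1$ and $0$ otherwise. $\operatorname{Ann}(G)=\{f\in R: f\circ G=0\}$, and $\operatorname{in}(I)$ is the initial ideal of $I$, generated by the leading monomials of the elements of $I$. A monomial ideal $J$ is reverse lexicographic if, for every degree $t\ge 0$, $J_t$ is generated by the largest possible monomials of degree $t$ with respect to the reverse lexicographic order; it is strongly stable if for every monomial $m\in J$, every variable $x_i$ dividing $m$ and every $j<i$, the monomial $(x_j/x_i)m$ also belongs to $J$. $\beta_{p,j}$ denotes the graded Betti numbers over $R$ (homological degree $p$, internal degree $j$) and $\beta_p=\sum_j\beta_{p,j}$ the total Betti numbers.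
   Formalization: The Betti numbers β_{p,p+q} and β_{p,p+d+1} of R/in(I) are corrected to β_{p,p+q-1} and β_{p,p+d}, and in the last display, for e=2d even, the first summand binom(d+n-2,d) receives the missing factor binom(n-1,p-1). *)

theory Defs
  imports
    "HOL-Library.Poly_Mapping"
    "HOL-Computational_Algebra.Computational_Algebra"
    "HOL-Algebra.Ideal_Product"
    "Jordan_Normal_Form.Matrix"
begin

section \<open>Polynomial rings\<close>

text \<open>
  A monomial is its exponent vector, indexed by the numbers of the variables, and a polynomial
  is a finitely supported function from monomials to coefficients; the library equips this type
  with the convolution product. The ring in the variables numbered \<open>1, \<dots>, n\<close> is a subset
  of the type. It serves both as \<open>R\<close> and as \<open>S\<close>.
\<close>

type_synonym mon = "nat \<Rightarrow>\<^sub>0 nat"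
type_synonym 'a mpoly = "mon \<Rightarrow>\<^sub>0 'a"

abbreviation keys :: "('v \<Rightarrow>\<^sub>0 'c::zero) \<Rightarrow> 'v set" where
  "keys \<equiv> Poly_Mapping.keys"

abbreviation lookup :: "('v \<Rightarrow>\<^sub>0 'c::zero) \<Rightarrow> 'v \<Rightarrow> 'c" where
  "lookup \<equiv> Poly_Mapping.lookup"

definition X :: "mon \<Rightarrow> 'a::field mpoly" where
  "X m = Poly_Mapping.single m 1"

definition const :: "'a::field \<Rightarrow> 'a mpoly" where
  "const c = Poly_Mapping.single 0 c"

definition mdeg :: "mon \<Rightarrow> nat" where
  "mdeg m = (\<Sum>i\<in>keys m. lookup m i)"

definition monomials :: "nat \<Rightarrow> mon set" where
  "monomials n = {m. keys m \<subseteq> {1..n}}"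

definition polys :: "nat \<Rightarrow> 'a::field mpoly set" where
  "polys n = {f. keys f \<subseteq> monomials n}"

text \<open>The degree is an integer so that the components of negative degree are \<open>0\<close>.\<close>

definition forms :: "nat \<Rightarrow> int \<Rightarrow> 'a::field mpoly set" where
  "forms n t = {f \<in> polys n. \<forall>m\<in>keys f. int (mdeg m) = t}"

definition poly_ring :: "nat \<Rightarrow> 'a::field mpoly ring" where
  "poly_ring n = \<lparr>carrier = polys n, mult = (*), one = 1, zero = 0, add = (+)\<rparr>"

definition max_ideal :: "nat \<Rightarrow> 'a::field mpoly set" where
  "max_ideal n = Idl\<^bsub>poly_ring n\<^esub> ((\<lambda>i. X (Poly_Mapping.single i 1)) ` {1..n})"

definition ideal_power :: "nat \<Rightarrow> 'a::field mpoly set \<Rightarrow> nat \<Rightarrow> 'a mpoly set" where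
  "ideal_power n I t = I [^]\<^bsub>ideals_set (poly_ring n)\<^esub> t"

definition dim_k :: "'a::field mpoly set \<Rightarrow> nat" where
  "dim_k = vector_space.dim (\<lambda>c f. const c * f)"


section \<open>Annihilator of a form\<close>

text \<open>Differentiation in characteristic zero, contraction in positive characteristic.\<close>

definition var_act :: "nat \<Rightarrow> 'a::field mpoly \<Rightarrow> 'a mpoly" where
  "var_act i g = (\<Sum>m\<in>keys g.
     if lookup m i = 0 then 0
     else Poly_Mapping.single (m - Poly_Mapping.single i 1)
            ((if CHAR('a) = 0 then of_nat (lookup m i) else 1) * lookup g m))"

definition mon_act :: "nat \<Rightarrow> mon \<Rightarrow> 'a::field mpoly \<Rightarrow> 'a mpoly" where
  "mon_act n m g = foldr (\<lambda>i. var_act i ^^ lookup m i) [1..<Suc n] g"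

definition act :: "nat \<Rightarrow> 'a::field mpoly \<Rightarrow> 'a mpoly \<Rightarrow> 'a mpoly" where
  "act n f g = (\<Sum>m\<in>keys f. const (lookup f m) * mon_act n m g)"

definition Ann :: "nat \<Rightarrow> 'a::field mpoly \<Rightarrow> 'a mpoly set" where
  "Ann n G = {f \<in> polys n. act n f G = 0}"


section \<open>Generic forms\<close>

definition poly_value :: "('v \<Rightarrow> 'a) \<Rightarrow> (('v \<Rightarrow>\<^sub>0 nat) \<Rightarrow>\<^sub>0 'a::field) \<Rightarrow> 'a" where
  "poly_value c P = (\<Sum>m\<in>keys P. lookup P m * (\<Prod>v\<in>keys m. c v ^ lookup m v))"

text \<open>
  A property holds for a generic form of degree \<open>e\<close> if it holds on a nonempty Zariski open
  subset of the affine space of these forms, that is, wherever some nonzero polynomial \<open>P\<close> in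
  the coefficients does not vanish. Here \<open>P\<close> is a formal polynomial over \<open>k\<close>, whose variables
  are numbered by the monomials of degree \<open>e\<close>; over a finite field it may be nonzero
  and still vanish at every point.
\<close>

definition generic_form :: "nat \<Rightarrow> nat \<Rightarrow> ('a::field mpoly \<Rightarrow> bool) \<Rightarrow> bool" where
  "generic_form n e Q \<longleftrightarrow>
     (\<exists>P :: (mon \<Rightarrow>\<^sub>0 nat) \<Rightarrow>\<^sub>0 'a. P \<noteq> 0 \<and>
        (\<forall>m\<in>keys P. keys m \<subseteq> {u \<in> monomials n. mdeg u = e}) \<and>
        (\<forall>G\<in>forms n (int e). poly_value (lookup G) P \<noteq> 0 \<longrightarrow> Q G))"


section \<open>Initial ideals and monomial ideals\<close>

text \<open>Degree reverse lexicographic order induced by \<open>x\<^sub>1 \<succ> \<dots> \<succ> x\<^sub>n\<close>.\<close>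

definition drl_less :: "mon \<Rightarrow> mon \<Rightarrow> bool" where
  "drl_less u v \<longleftrightarrow> mdeg u < mdeg v \<or>
     (mdeg u = mdeg v \<and> (\<exists>i. lookup v i < lookup u i \<and> (\<forall>j>i. lookup u j = lookup v j)))"

definition lead_mon :: "'a::field mpoly \<Rightarrow> mon" where
  "lead_mon f = (THE m. m \<in> keys f \<and> (\<forall>u\<in>keys f. u \<noteq> m \<longrightarrow> drl_less u m))"

definition initial_ideal :: "nat \<Rightarrow> 'a::field mpoly set \<Rightarrow> 'a mpoly set" where
  "initial_ideal n I = Idl\<^bsub>poly_ring n\<^esub> {X (lead_mon f) | f. f \<in> I \<and> f \<noteq> 0}"

definition monomial_ideal :: "nat \<Rightarrow> 'a::field mpoly set \<Rightarrow> bool" where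
  "monomial_ideal n J \<longleftrightarrow> (\<exists>M \<subseteq> monomials n. J = Idl\<^bsub>poly_ring n\<^esub> (X ` M))"

text \<open>The polynomials supported on a set \<open>M\<close> of monomials form the \<open>k\<close>-span of \<open>M\<close>.\<close>

definition reverse_lexicographic :: "nat \<Rightarrow> 'a::field mpoly set \<Rightarrow> bool" where
  "reverse_lexicographic n J \<longleftrightarrow> monomial_ideal n J \<and>
     (\<forall>t. \<exists>M \<subseteq> {m \<in> monomials n. mdeg m = t}.
        (\<forall>v\<in>M. \<forall>u\<in>monomials n. mdeg u = t \<and> drl_less v u \<longrightarrow> u \<in> M) \<and>
        J \<inter> forms n (int t) = {f. keys f \<subseteq> M})"

definition strongly_stable :: "nat \<Rightarrow> 'a::field mpoly set \<Rightarrow> bool" where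
  "strongly_stable n J \<longleftrightarrow> monomial_ideal n J \<and>
     (\<forall>m\<in>monomials n. X m \<in> J \<longrightarrow>
        (\<forall>i\<in>keys m. \<forall>j\<in>{1..<i}.
           X (m - Poly_Mapping.single i 1 + Poly_Mapping.single j 1) \<in> J))"

definition generated_in_degrees :: "nat \<Rightarrow> 'a::field mpoly set \<Rightarrow> nat set \<Rightarrow> bool" where
  "generated_in_degrees n J D \<longleftrightarrow>
     J = Idl\<^bsub>poly_ring n\<^esub> (\<Union>q\<in>D. J \<inter> forms n (int q))"

text \<open>Minimal generators of a monomial ideal: its monomials minimal under divisibility.\<close>

definition min_gens :: "nat \<Rightarrow> 'a::field mpoly set \<Rightarrow> mon set" where
  "min_gens n J = {m \<in> monomials n. X m \<in> J \<and>
     (\<forall>u\<in>monomials n. X u \<in> J \<and> lookup u \<le> lookup m \<longrightarrow> u = m)}"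

definition num_gens :: "nat \<Rightarrow> 'a::field mpoly set \<Rightarrow> nat \<Rightarrow> nat \<Rightarrow> nat" where
  "num_gens n J i q =
     card {m \<in> min_gens n J. mdeg m = q \<and> i \<in> keys m \<and> (\<forall>j>i. j \<notin> keys m)}"


section \<open>Graded Betti numbers\<close>

text \<open>
  A complex \<open>\<dots> \<rightarrow> F\<^sub>1 \<rightarrow> F\<^sub>0 \<rightarrow> R/J\<close> with \<open>F\<^sub>p\<close> the direct sum of the \<open>R(-s)\<close> for \<open>s\<close> in the list
  \<open>shifts p\<close>. The matrix \<open>diff p\<close> is the map from \<open>F\<^bsub>p+1\<^esub>\<close> to \<open>F\<^sub>p\<close>, and the vector
  \<open>aug\<close> lists representatives in \<open>R\<close> of the images in \<open>R/J\<close> of the basis of \<open>F\<^sub>0\<close>.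
  Minimal resolutions of \<open>R/J\<close> have no negative shifts.
\<close>

record (overloaded) 'a free_complex =
  shifts :: "nat \<Rightarrow> nat list"
  aug :: "'a mpoly vec"
  diff :: "nat \<Rightarrow> 'a mpoly mat"

abbreviation rk :: "'a free_complex \<Rightarrow> nat \<Rightarrow> nat" where
  "rk F p \<equiv> length (shifts F p)"

definition free_mod :: "nat \<Rightarrow> nat \<Rightarrow> 'a::field mpoly vec set" where
  "free_mod n r = {v \<in> carrier_vec r. \<forall>a<r. v $ a \<in> polys n}"

definition graded_complex :: "nat \<Rightarrow> 'a::field free_complex \<Rightarrow> bool" where
  "graded_complex n F \<longleftrightarrow>
     aug F \<in> carrier_vec (rk F 0) \<and>
     (\<forall>a<rk F 0. aug F $ a \<in> forms n (int (shifts F 0 ! a))) \<and>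
     (\<forall>p. diff F p \<in> carrier_mat (rk F p) (rk F (Suc p)) \<and>
        (\<forall>a<rk F p. \<forall>b<rk F (Suc p).
           diff F p $$ (a, b) \<in> forms n (int (shifts F (Suc p) ! b) - int (shifts F p ! a))))"

definition free_resolution :: "nat \<Rightarrow> 'a::field mpoly set \<Rightarrow> 'a free_complex \<Rightarrow> bool" where
  "free_resolution n J F \<longleftrightarrow> graded_complex n F \<and>
     (\<forall>f\<in>polys n. \<exists>v\<in>free_mod n (rk F 0). f - aug F \<bullet> v \<in> J) \<and>
     {v \<in> free_mod n (rk F 0). aug F \<bullet> v \<in> J} =
        (\<lambda>w. diff F 0 *\<^sub>v w) ` free_mod n (rk F 1) \<and>
     (\<forall>p. {v \<in> free_mod n (rk F (Suc p)). diff F p *\<^sub>v v = 0\<^sub>v (rk F p)} =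
        (\<lambda>w. diff F (Suc p) *\<^sub>v w) ` free_mod n (rk F (Suc (Suc p))))"

definition minimal_free_resolution ::
    "nat \<Rightarrow> 'a::field mpoly set \<Rightarrow> 'a free_complex \<Rightarrow> bool" where
  "minimal_free_resolution n J F \<longleftrightarrow> free_resolution n J F \<and>
     (\<forall>p. \<forall>a<rk F p. \<forall>b<rk F (Suc p). diff F p $$ (a, b) \<in> max_ideal n)"

text \<open>
  \<open>betti n J p j\<close> is \<open>\<beta>\<^bsub>p,j\<^esub>(R/J)\<close>. The index \<open>j\<close> is the internal degree, hence
  \<open>\<beta>\<^bsub>1,q\<^esub>(R/J)\<close> is the number of minimal generators of \<open>J\<close> of degree \<open>q\<close>.
\<close>

definition betti :: "nat \<Rightarrow> 'a::field mpoly set \<Rightarrow> nat \<Rightarrow> nat \<Rightarrow> nat" where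
  "betti n J p j = count_list (shifts (SOME F. minimal_free_resolution n J F) p) j"

definition total_betti :: "nat \<Rightarrow> 'a::field mpoly set \<Rightarrow> nat \<Rightarrow> nat" where
  "total_betti n J p = (\<Sum>j | betti n J p j \<noteq> 0. betti n J p j)"


section \<open>Binomial coefficients\<close>

text \<open>
  The convention that makes \<open>binom (t + r - 1) (r - 1)\<close> the dimension of \<open>k[x\<^sub>1, \<dots>, x\<^sub>r]\<^sub>t\<close> for all
  \<open>r \<ge> 0\<close> and all integers \<open>t\<close>: it is \<open>0\<close> for \<open>t < 0\<close>, and for \<open>r = 0\<close> it is \<open>1\<close> if \<open>t = 0\<close>
  and \<open>0\<close> otherwise, so that \<open>binom (-1) (-1) = 1\<close>.
\<close>

definition binom :: "int \<Rightarrow> int \<Rightarrow> nat" where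
  "binom a b = (if a = b then 1 else if 0 \<le> b \<and> b \<le> a then nat a choose nat b else 0)"

end

(*
Pair two forms f and g of complementary degrees t and e - t by letting f g act on G; then f lies in
Ann(G) iff it pairs to zero with every g. For generic G and every s <= e/2, the pairing
(f, g) -> x_n^(e - 2s) f g on forms of degree s is nondegenerate, because the diagonal product of
coefficients of G occurs only once in the Leibniz expansion of its determinant. In degree t > e/2
the multiples of x_n^(2t - e) are the smallest monomials, so they are exactly the standard ones, and
in(Ann(G)) is spanned by the monomials m with 2 deg m > e + deg_{x_n} m.

For the weights 2, ..., 2, 1 of the variables these are the monomials of weight at least e + 1, while
the (d + 1)-st power of the maximal ideal belongs to the weights 1, ..., 1. If the weights are
nonincreasing, the minimal generators of the ideal of all monomials of weight at least N, ordered by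
degree and then lexicographically, have linear quotients: the colon ideal at a generator with last
variable x_r is (x_1, ..., x_{r-1}). Iterated mapping cones of Koszul complexes (which are iterated
mapping cones themselves) resolve such an ideal minimally and yield the Eliahou-Kervaire formula. The
choice of the minimal resolution does not matter: the composition of two graded comparison maps is
homotopic to the identity, hence the identity on constant terms.
*)
theory Submission
  imports Defs "Jordan_Normal_Form.Determinant"
begin

text \<open>Nondegeneracy enters twice. Injectivity bars a multiple of x_n^(2t - e) from being a
  leading monomial of degree t >= e/2: the degree-t part of f would be divisible by that power, and
  the quotient would pair to zero with everything. Surjectivity provides, for any other monomial m
  of degree t with e/2 < t <= e, a form x_n^(2t - e) g that pairs like -m, so that m + x_n^(2t - e)
  g lies in Ann(G) and leads with m. Differentiation and contraction are treated at once: in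
  characteristic zero the coefficient of X^u is multiplied by the factorials of the exponents, after
  which both actions just shift exponents. The weights come from rewriting 2 deg m > e + deg_{x_n} m
  as 2 (deg m - deg_{x_n} m) + deg_{x_n} m >= e + 1. By the Eliahou-Kervaire formula, total Betti
  numbers depend only on how many generators have each last variable; generators of in(Ann(G)) and
  of the power of the maximal ideal correspond when they agree after x_n is set to 1, and this
  preserves the last variable.\<close>

section \<open>Monomials and homogeneous components\<close>

lemma lookup_X_mult: "lookup (X m * f) (m + u) = lookup (f::'a::field mpoly) u"
proof -
  have "lookup (X m * f) (m + u) = (\<Sum>l. (lookup f u when l = m))"
    unfolding lookup_mult X_def lookup_single
    by (intro Sum_any.cong) (auto simp: when_def)
  then show ?thesis by simp
qed

lemma keys_X_mult: "keys (X m * f) = (+) m ` keys (f::'a::field mpoly)"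
proof
  show "keys (X m * f) \<subseteq> (+) m ` keys f"
    using keys_mult[of "X m" f] by (auto simp: X_def)
  show "(+) m ` keys f \<subseteq> keys (X m * f)"
    by (auto simp: in_keys_iff lookup_X_mult)
qed

lemma lookup_const_mult [simp]: "lookup (const c * f) u = c * lookup (f::'a::field mpoly) u"
  unfolding const_def mult_map_scale_conv_mult[symmetric] by (simp add: Poly_Mapping.map.rep_eq when_def)

lemma lookup_X: "lookup (X m :: 'a::field mpoly) u = (if u = m then 1 else 0)"
  by (auto simp: X_def lookup_single when_def)

lemma keys_X [simp]: "keys (X m :: 'a::field mpoly) = {m}"
  by (simp add: X_def)

lemma X_add: "X (m + u) = X m * (X u :: 'a::field mpoly)"
  by (simp add: X_def mult_single)

lemma X_zero [simp]: "X 0 = (1 :: 'a::field mpoly)"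
  by (simp add: X_def)

lemma const_mult_X: "const c * X m = (Poly_Mapping.single m c :: 'a::field mpoly)"
  by (simp add: X_def const_def mult_single)

lemma poly_mapping_sum_single: "finite A \<Longrightarrow> keys f \<subseteq> A \<Longrightarrow> (\<Sum>m\<in>A. Poly_Mapping.single m (lookup f m)) = f"
  by (rule poly_mapping_eqI) (auto simp: lookup_sum lookup_single when_def in_keys_iff)

lemma poly_expansion: "(f::'a::field mpoly) = (\<Sum>m\<in>keys f. const (lookup f m) * X m)"
  unfolding const_mult_X by (simp add: poly_mapping_sum_single)

lemma keys_add_nat: "keys (u + v :: mon) = keys u \<union> keys v"
  by (auto simp: in_keys_iff lookup_add)

lemma monomials_add [simp]: "u + v \<in> monomials n \<longleftrightarrow> u \<in> monomials n \<and> v \<in> monomials n"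
  by (auto simp: monomials_def keys_add_nat)

lemma monomials_zero [simp]: "0 \<in> monomials n"
  by (simp add: monomials_def)

lemma monomials_single: "i \<in> {1..n} \<Longrightarrow> Poly_Mapping.single i k \<in> monomials n"
  by (simp add: monomials_def)

lemma mon_le_add_diff: "lookup u \<le> lookup v \<Longrightarrow> u + (v - u) = (v::mon)"
  by (rule poly_mapping_eqI) (simp add: lookup_add lookup_minus le_fun_def)

lemma mon_le_iff: "lookup u \<le> lookup v \<longleftrightarrow> (\<exists>w. v = u + (w::mon))"
  using mon_le_add_diff[of u v] by (auto simp: le_fun_def lookup_add) metis

lemma mdeg_sum: "finite A \<Longrightarrow> keys m \<subseteq> A \<Longrightarrow> mdeg m = (\<Sum>i\<in>A. lookup m i)"
  unfolding mdeg_def by (rule sum.mono_neutral_left) (auto simp: in_keys_iff)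

lemma mdeg_add [simp]: "mdeg (u + v) = mdeg u + mdeg v"
  using mdeg_sum[of "keys u \<union> keys v" u] mdeg_sum[of "keys u \<union> keys v" v]
    mdeg_sum[of "keys u \<union> keys v" "u + v"]
  by (simp add: keys_add_nat lookup_add sum.distrib)

lemma mdeg_zero [simp]: "mdeg 0 = 0"
  by (simp add: mdeg_def)

lemma mdeg_single [simp]: "mdeg (Poly_Mapping.single i k) = k"
  by (simp add: mdeg_def)

lemma mdeg_eq_0_iff [simp]: "mdeg m = 0 \<longleftrightarrow> m = 0"
  by (auto simp: mdeg_def in_keys_iff intro!: poly_mapping_eqI)

lemma lookup_le_mdeg: "lookup m i \<le> mdeg m"
proof (cases "i \<in> keys m")
  case True then show ?thesis unfolding mdeg_def by (intro member_le_sum) auto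
qed (simp add: in_keys_iff)

lemma mon_add_eq_0_iff [simp]: "u + v = 0 \<longleftrightarrow> u = 0 \<and> v = (0::mon)"
  by (metis add_is_0 mdeg_add mdeg_eq_0_iff)

text \<open>Exponents add up to 0 only if both vanish. The constant term is thus reduction modulo
  the maximal ideal, and the uniqueness of Betti numbers is checked after it.\<close>

lemma lookup_mult_zero: "lookup (f * g) 0 = lookup f 0 * lookup (g::'a::field mpoly) 0"
proof -
  have "(\<Sum>q. lookup g q when 0 = l + q) = (lookup g 0 when l = 0)" for l :: mon
    by (cases "l = 0") (simp_all add: when_def eq_commute[of 0])
  then have "lookup (f * g) 0 = (\<Sum>l. (lookup f l * lookup g 0 when l = 0))"
    unfolding lookup_mult by (intro Sum_any.cong) (auto simp: when_def)
  then show ?thesis by simp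
qed

lemma mon_split: "i \<in> keys m \<Longrightarrow> m = (m - Poly_Mapping.single i 1) + Poly_Mapping.single i (1::nat)"
  by (rule poly_mapping_eqI) (auto simp: lookup_add lookup_minus lookup_single when_def in_keys_iff)

lemma polys_add [intro]: "f \<in> polys n \<Longrightarrow> g \<in> polys n \<Longrightarrow> f + g \<in> polys n"
  using keys_add[of f g] by (auto simp: polys_def)

lemma keys_uminus_field: "keys (- f) = keys (f :: 'v \<Rightarrow>\<^sub>0 'a::field)"
  by (auto simp: in_keys_iff)

lemma polys_uminus [intro]: "f \<in> polys n \<Longrightarrow> - f \<in> polys n"
  by (simp add: polys_def keys_uminus_field)

lemma polys_diff [intro]: "f \<in> polys n \<Longrightarrow> g \<in> polys n \<Longrightarrow> f - g \<in> polys n"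
  using polys_add[of f n "-g"] polys_uminus[of g n] by simp

lemma polys_mult [intro]: "f \<in> polys n \<Longrightarrow> g \<in> polys n \<Longrightarrow> f * g \<in> polys n"
  using keys_mult[of f g] by (force simp: polys_def)

lemma polys_0 [simp]: "0 \<in> polys n" and polys_1 [simp]: "1 \<in> polys n"
  by (auto simp: polys_def)

lemma polys_X [simp]: "X m \<in> polys n \<longleftrightarrow> m \<in> monomials n"
  by (simp add: polys_def)

lemma polys_const [simp]: "const c \<in> polys n"
  by (simp add: polys_def const_def)

lemma polys_sum [intro]: "(\<And>x. x \<in> A \<Longrightarrow> f x \<in> polys n) \<Longrightarrow> sum f A \<in> polys n"
  by (induction A rule: infinite_finite_induct) auto

lemma formsI: "f \<in> polys n \<Longrightarrow> (\<And>m. m \<in> keys f \<Longrightarrow> int (mdeg m) = t) \<Longrightarrow> f \<in> forms n t"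
  by (simp add: forms_def)

lemma forms_polys: "f \<in> forms n t \<Longrightarrow> f \<in> polys n"
  by (simp add: forms_def)

lemma forms_0 [simp]: "0 \<in> forms n t"
  by (simp add: forms_def)

lemma forms_uminus: "f \<in> forms n t \<Longrightarrow> - f \<in> forms n t"
  by (auto simp: forms_def keys_uminus_field)

lemma forms_add: "f \<in> forms n t \<Longrightarrow> g \<in> forms n t \<Longrightarrow> f + g \<in> forms n t"
  using keys_add[of f g] by (auto simp: forms_def)

lemma forms_mult: "f \<in> forms n s \<Longrightarrow> g \<in> forms n t \<Longrightarrow> f * g \<in> forms n (s + t)"
  using keys_mult[of f g] polys_mult[of f n g] by (force simp: forms_def)

lemma forms_sum: "(\<And>x. x \<in> A \<Longrightarrow> f x \<in> forms n t) \<Longrightarrow> sum f A \<in> forms n t"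
  by (induction A rule: infinite_finite_induct) (auto intro: forms_add)

lemma forms_X: "m \<in> monomials n \<Longrightarrow> X m \<in> forms n (int (mdeg m))"
  by (auto intro: formsI)

lemma forms_1: "1 \<in> forms n 0"
  by (auto intro: formsI)

definition hcomp :: "int \<Rightarrow> 'a::field mpoly \<Rightarrow> 'a mpoly" where
  "hcomp t f = (\<Sum>m | m \<in> keys f \<and> int (mdeg m) = t. Poly_Mapping.single m (lookup f m))"

lemma lookup_hcomp: "lookup (hcomp t f) m = (if int (mdeg m) = t then lookup f m else 0)"
proof (cases "m \<in> keys f \<and> int (mdeg m) = t")
  case True
  then show ?thesis
    by (simp add: hcomp_def lookup_sum lookup_single when_def)
next
  case False
  then show ?thesis
    by (auto simp: hcomp_def lookup_sum lookup_single when_def in_keys_iff intro!: sum.neutral)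
qed

lemma keys_hcomp: "keys (hcomp t f) = {m \<in> keys f. int (mdeg m) = t}"
  by (auto simp: in_keys_iff lookup_hcomp split: if_splits)

lemma hcomp_forms: "f \<in> polys n \<Longrightarrow> hcomp t f \<in> forms n t"
  by (auto simp: forms_def polys_def keys_hcomp)

lemma hcomp_add: "hcomp t (f + g) = hcomp t f + hcomp t g"
  by (rule poly_mapping_eqI) (simp add: lookup_hcomp lookup_add)

lemma hcomp_sum: "hcomp t (sum f A) = (\<Sum>x\<in>A. hcomp t (f x))"
  by (rule poly_mapping_eqI) (simp add: lookup_hcomp lookup_sum)

lemma hcomp_form: "f \<in> forms n t \<Longrightarrow> hcomp t f = f"
  by (rule poly_mapping_eqI) (auto simp: lookup_hcomp forms_def in_keys_iff)

text \<open>Split \<open>g\<close> into its part of degree \<open>t\<close> and the rest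
  \<open>r\<close>; no term of \<open>f * r\<close> has degree \<open>s + t\<close>. This is what
  allows an arbitrary lift to be replaced by a graded one.\<close>

lemma hcomp_mult:
  assumes "f \<in> forms n s"
  shows "hcomp (s + t) (f * g) = f * hcomp t g"
proof -
  define r where "r = g - hcomp t g"
  have r: "int (mdeg m) \<noteq> t" if "m \<in> keys r" for m
    using that by (auto simp: r_def in_keys_iff lookup_minus lookup_hcomp)
  have "hcomp (s + t) (f * hcomp t g) = f * hcomp t g"
  proof (rule poly_mapping_eqI)
    fix m
    show "lookup (hcomp (s + t) (f * hcomp t g)) m = lookup (f * hcomp t g) m"
      using assms keys_mult[of f "hcomp t g"]
      by (force simp: lookup_hcomp keys_hcomp forms_def in_keys_iff)
  qed
  moreover have "hcomp (s + t) (f * r) = 0"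
  proof (rule poly_mapping_eqI)
    fix m
    have "m \<notin> keys (f * r)" if "int (mdeg m) = s + t"
    proof
      assume "m \<in> keys (f * r)"
      then obtain a b where "m = a + b" "a \<in> keys f" "b \<in> keys r"
        using keys_mult[of f r] by auto
      then show False using r[of b] that assms by (auto simp: forms_def)
    qed
    then show "lookup (hcomp (s + t) (f * r)) m = lookup 0 m"
      by (auto simp: lookup_hcomp in_keys_iff)
  qed
  moreover have "g = hcomp t g + r" by (simp add: r_def)
  then have "f * g = f * hcomp t g + f * r" by (metis distrib_left)
  ultimately show ?thesis by (simp add: hcomp_add)
qed

section \<open>Monomial ideals\<close>

lemma poly_ring_simps [simp]:
  "carrier (poly_ring n) = polys n" "mult (poly_ring n) = (*)" "one (poly_ring n) = 1"
  "zero (poly_ring n) = 0" "add (poly_ring n) = (+)"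
  by (simp_all add: poly_ring_def)

lemma poly_ring_cring: "cring (poly_ring n :: 'a::field mpoly ring)"
proof (rule cringI)
  show "abelian_group (poly_ring n :: 'a mpoly ring)"
  proof (rule abelian_groupI)
    fix x :: "'a mpoly" assume "x \<in> carrier (poly_ring n)"
    then show "\<exists>y\<in>carrier (poly_ring n). y \<oplus>\<^bsub>poly_ring n\<^esub> x = \<zero>\<^bsub>poly_ring n\<^esub>"
      by (intro bexI[of _ "-x"]) auto
  qed (auto simp: algebra_simps)
  show "comm_monoid (poly_ring n :: 'a mpoly ring)"
    by (rule comm_monoidI) (auto simp: algebra_simps)
qed (auto simp: algebra_simps)

text \<open>Monomial ideals are handled as spans of sets of monomials closed under multiplication
  (\<open>mon_closed\<close>), so that membership is a condition on supports;
  \<open>genideal_X\<close> translates from generated ideals.\<close>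

definition mspan :: "mon set \<Rightarrow> 'a::field mpoly set" where
  "mspan U = {f. keys f \<subseteq> U}"

definition mon_closed :: "nat \<Rightarrow> mon set \<Rightarrow> bool" where
  "mon_closed n U \<longleftrightarrow> U \<subseteq> monomials n \<and> (\<forall>u\<in>U. \<forall>v\<in>monomials n. u + v \<in> U)"

definition upset :: "nat \<Rightarrow> mon set \<Rightarrow> mon set" where
  "upset n M = {u + v | u v. u \<in> M \<and> v \<in> monomials n}"

lemma mspan_0 [simp]: "0 \<in> mspan U"
  by (simp add: mspan_def)

lemma mspan_add: "f \<in> mspan U \<Longrightarrow> g \<in> mspan U \<Longrightarrow> f + g \<in> mspan U"
  using keys_add[of f g] by (auto simp: mspan_def)

lemma mspan_uminus: "f \<in> mspan U \<Longrightarrow> - f \<in> mspan U"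
  by (simp add: mspan_def keys_uminus_field)

lemma mspan_sum: "(\<And>x. x \<in> A \<Longrightarrow> f x \<in> mspan U) \<Longrightarrow> sum f A \<in> mspan U"
  by (induction A rule: infinite_finite_induct) (auto intro: mspan_add)

lemma mspan_X [simp]: "X m \<in> mspan U \<longleftrightarrow> m \<in> U"
  by (simp add: mspan_def)

lemma mspan_mult: "mon_closed n U \<Longrightarrow> f \<in> mspan U \<Longrightarrow> g \<in> polys n \<Longrightarrow> f * g \<in> mspan U"
  using keys_mult[of f g] unfolding mspan_def mon_closed_def polys_def by blast

lemma mspan_hcomp: "f \<in> mspan U \<Longrightarrow> hcomp t f \<in> mspan U"
  by (auto simp: mspan_def keys_hcomp)

lemma mspan_polys: "mon_closed n U \<Longrightarrow> mspan U \<subseteq> polys n"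
  by (auto simp: mspan_def mon_closed_def polys_def)

lemma mspan_ideal:
  assumes "mon_closed n U"
  shows "ideal (mspan U :: 'a::field mpoly set) (poly_ring n)"
proof (rule idealI)
  interpret cring "poly_ring n :: 'a mpoly ring" by (rule poly_ring_cring)
  show "ring (poly_ring n :: 'a mpoly ring)" ..
  have inv: "a_inv (poly_ring n) f = - f" if "f \<in> polys n" for f :: "'a mpoly"
    using that by (intro minus_equality) auto
  show "subgroup (mspan U) (add_monoid (poly_ring n :: 'a mpoly ring))"
  proof (rule subgroup.intro)
    fix x :: "'a mpoly" assume "x \<in> mspan U"
    moreover then have "x \<in> polys n" using mspan_polys[OF assms] by blast
    ultimately show "inv\<^bsub>add_monoid (poly_ring n)\<^esub> x \<in> mspan U"
      using inv[of x] mspan_uminus[of x U] unfolding a_inv_def by metis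
  qed (use mspan_polys[OF assms] in \<open>auto intro: mspan_add\<close>)
next
  fix a x :: "'a mpoly" assume "a \<in> mspan U" "x \<in> carrier (poly_ring n)"
  then show "x \<otimes>\<^bsub>poly_ring n\<^esub> a \<in> mspan U" "a \<otimes>\<^bsub>poly_ring n\<^esub> x \<in> mspan U"
    using mspan_mult[OF assms, of a x] by (auto simp: mult.commute)
qed

lemma upset_closed: "M \<subseteq> monomials n \<Longrightarrow> mon_closed n (upset n M)"
  by (auto simp: mon_closed_def upset_def) (metis add.assoc monomials_add)

lemma upset_self: "M \<subseteq> upset n M"
  by (auto simp: upset_def) (metis add_0_right monomials_zero)

lemma upset_of_closed: "mon_closed n U \<Longrightarrow> upset n U = U"
  using upset_self[of U n] by (auto simp: mon_closed_def upset_def)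

lemma genideal_X:
  assumes "M \<subseteq> monomials n"
  shows "Idl\<^bsub>poly_ring n\<^esub> (X ` M) = (mspan (upset n M) :: 'a::field mpoly set)"
proof
  interpret cring "poly_ring n :: 'a mpoly ring" by (rule poly_ring_cring)
  show "Idl\<^bsub>poly_ring n\<^esub> (X ` M) \<subseteq> (mspan (upset n M) :: 'a mpoly set)"
    using upset_self[of M n]
    by (intro genideal_minimal mspan_ideal upset_closed assms) auto
  have sub: "X ` M \<subseteq> carrier (poly_ring n :: 'a mpoly ring)" using assms by auto
  define I where "I = Idl\<^bsub>poly_ring n\<^esub> (X ` M :: 'a mpoly set)"
  interpret I: ideal I "poly_ring n :: 'a mpoly ring" unfolding I_def by (rule genideal_ideal[OF sub])
  have XI: "X ` M \<subseteq> I" unfolding I_def by (rule genideal_self[OF sub])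
  have sumI: "sum h A \<in> I" if "finite A" "\<And>x. x \<in> A \<Longrightarrow> h x \<in> I" for h and A :: "mon set"
    using that by (induction A rule: finite_induct) (use I.zero_closed I.a_closed in auto)
  show "(mspan (upset n M) :: 'a mpoly set) \<subseteq> Idl\<^bsub>poly_ring n\<^esub> (X ` M)"
  proof
    fix f :: "'a mpoly" assume f: "f \<in> mspan (upset n M)"
    have "const (lookup f m) * X m \<in> I" if m: "m \<in> keys f" for m
    proof -
      obtain u v where uv: "m = u + v" "u \<in> M" "v \<in> monomials n"
        using m f unfolding mspan_def upset_def by blast
      have "(const (lookup f m) * X v) * X u \<in> I"
        using I.I_l_closed[of "X u" "const (lookup f m) * X v"] XI uv
        by (simp add: subset_iff image_subset_iff polys_mult)
      then show ?thesis using uv by (simp add: X_add mult_ac)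
    qed
    then have "(\<Sum>m\<in>keys f. const (lookup f m) * X m) \<in> I" by (intro sumI) auto
    then show "f \<in> Idl\<^bsub>poly_ring n\<^esub> (X ` M)" using poly_expansion[of f] by (simp add: I_def)
  qed
qed

lemma max_ideal_eq: "max_ideal n = (mspan {m \<in> monomials n. m \<noteq> 0} :: 'a::field mpoly set)"
proof -
  define V where "V = (\<lambda>i. Poly_Mapping.single i (1::nat)) ` {1..n}"
  have "upset n V = {m \<in> monomials n. m \<noteq> 0}"
  proof (intro equalityI subsetI)
    fix m assume "m \<in> upset n V"
    then show "m \<in> {m \<in> monomials n. m \<noteq> 0}"
      by (auto simp: upset_def V_def monomials_single simp flip: mdeg_eq_0_iff)
  next
    fix m assume m: "m \<in> {m \<in> monomials n. m \<noteq> 0}"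
    then obtain i where i: "i \<in> keys m" by (auto simp: poly_mapping_eq_iff fun_eq_iff in_keys_iff)
    define v where "v = m - Poly_Mapping.single i 1"
    have v: "m = Poly_Mapping.single i 1 + v" using mon_split[OF i] by (simp add: v_def add.commute)
    then have "v \<in> monomials n" using m by auto
    moreover have "i \<in> {1..n}" using i m by (auto simp: monomials_def)
    ultimately show "m \<in> upset n V" using v unfolding upset_def V_def by blast
  qed
  moreover have "V \<subseteq> monomials n" by (auto simp: V_def intro: monomials_single)
  ultimately show ?thesis
    using genideal_X[of V n, where 'a='a] by (simp add: max_ideal_def V_def image_image)
qed

lemma max_ideal_iff: "f \<in> max_ideal n \<longleftrightarrow> f \<in> polys n \<and> lookup f 0 = 0"
  by (auto simp: max_ideal_eq mspan_def polys_def in_keys_iff)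

lemma forms_max_ideal: "t > 0 \<Longrightarrow> f \<in> forms n t \<Longrightarrow> f \<in> max_ideal n"
  unfolding max_ideal_iff forms_def by (metis (mono_tags, lifting) in_keys_iff less_irrefl mdeg_zero mem_Collect_eq of_nat_0)

lemma ideal_prod_mspan:
  assumes "mon_closed n U" "mon_closed n V"
  shows "ideal_prod (poly_ring n) (mspan U) (mspan V) = (mspan {u + v | u v. u \<in> U \<and> v \<in> V} :: 'a::field mpoly set)"
    (is "?L = mspan ?W")
proof
  show "?L \<subseteq> mspan ?W"
  proof
    fix f :: "'a mpoly" assume "f \<in> ?L"
    then show "f \<in> mspan ?W"
    proof (induction rule: ideal_prod.induct)
      case (prod i j)
      then show ?case using keys_mult[of i j] unfolding mspan_def by fastforce
    qed (auto intro: mspan_add)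
  qed
  have sumI: "sum h A \<in> ?L" if "finite A" "\<And>x. x \<in> A \<Longrightarrow> h x \<in> ?L" for h :: "mon \<Rightarrow> 'a mpoly" and A
    using that
  proof (induction A rule: finite_induct)
    case empty
    \<comment> \<open>\<open>ideal_prod\<close> is inductively generated by products and sums alone,
      so the empty sum is obtained as a product of zeros.\<close>
    have "0 * 0 \<in> ?L" using ideal_prod.prod[of 0 "mspan U" 0 "mspan V" "poly_ring n"] by simp
    then show ?case by simp
  next
    case (insert x A)
    then show ?case using ideal_prod.sum[of "h x" "poly_ring n" "mspan U" "mspan V" "sum h A"] by auto
  qed
  show "mspan ?W \<subseteq> ?L"
  proof
    fix f :: "'a mpoly" assume f: "f \<in> mspan ?W"
    have "const (lookup f m) * X m \<in> ?L" if m: "m \<in> keys f" for m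
    proof -
      obtain u v where uv: "m = u + v" "u \<in> U" "v \<in> V"
        using m f unfolding mspan_def by blast
      have "X u * const (lookup f m) \<in> mspan U"
        using assms(1) uv by (intro mspan_mult) auto
      then have "(X u * const (lookup f m)) * X v \<in> ?L"
        using ideal_prod.prod[of "X u * const (lookup f m)" "mspan U" "X v" "mspan V" "poly_ring n"] uv by auto
      then show ?thesis using uv by (simp add: X_add mult_ac)
    qed
    then have "(\<Sum>m\<in>keys f. const (lookup f m) * X m) \<in> ?L" by (intro sumI) auto
    then show "f \<in> ?L" using poly_expansion[of f] by simp
  qed
qed

lemma ideal_power_max_ideal:
  "ideal_power n (max_ideal n) t = (mspan {m \<in> monomials n. t \<le> mdeg m} :: 'a::field mpoly set)"
proof (induction t)
  case 0
  then show ?case by (simp add: ideal_power_def ideals_set_def mspan_def polys_def Collect_mem_eq)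
next
  case (Suc t)
  let ?U = "{m \<in> monomials n. t \<le> mdeg m}" and ?V = "{m \<in> monomials n. m \<noteq> 0}"
  have "ideal_power n (max_ideal n) (Suc t)
      = ideal_prod (poly_ring n) (ideal_power n (max_ideal n) t) (max_ideal n :: 'a mpoly set)"
    by (simp add: ideal_power_def ideals_set_def)
  also have "\<dots> = mspan {u + v | u v. u \<in> ?U \<and> v \<in> ?V}"
    unfolding Suc unfolding max_ideal_eq by (rule ideal_prod_mspan) (auto simp: mon_closed_def)
  also have "{u + v | u v. u \<in> ?U \<and> v \<in> ?V} = {m \<in> monomials n. Suc t \<le> mdeg m}"
  proof (intro equalityI subsetI)
    fix m assume "m \<in> {u + v | u v. u \<in> ?U \<and> v \<in> ?V}"
    then obtain u v where "m = u + v" "u \<in> ?U" "v \<in> ?V" by blast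
    moreover then have "1 \<le> mdeg v" using mdeg_eq_0_iff[of v] by (auto simp: Suc_le_eq simp del: mdeg_eq_0_iff)
    ultimately show "m \<in> {m \<in> monomials n. Suc t \<le> mdeg m}" by auto
  next
    fix m assume m: "m \<in> {m \<in> monomials n. Suc t \<le> mdeg m}"
    then have "m \<noteq> 0" by auto
    then obtain i where i: "i \<in> keys m" by (auto simp: poly_mapping_eq_iff fun_eq_iff in_keys_iff)
    define v where "v = m - Poly_Mapping.single i 1"
    have v: "m = v + Poly_Mapping.single i 1" using mon_split[OF i] by (simp add: v_def)
    then have "mdeg m = mdeg v + 1" by simp
    then have "v \<in> ?U" "Poly_Mapping.single i 1 \<in> ?V" using m v by (auto simp flip: mdeg_eq_0_iff)
    then show "m \<in> {u + v | u v. u \<in> ?U \<and> v \<in> ?V}" using v by blast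
  qed
  finally show ?case .
qed

section \<open>Lifting along free resolutions\<close>

definition pmat :: "nat \<Rightarrow> nat \<Rightarrow> nat \<Rightarrow> 'a::field mpoly mat set" where
  "pmat n r c = {A \<in> carrier_mat r c. \<forall>i<r. \<forall>j<c. A $$ (i, j) \<in> polys n}"

text \<open>Homogeneous maps of degree 0 from the sum of the \<open>R(-s)\<close> with s in
  \<open>cs\<close> to the sum of the \<open>R(-s)\<close> with s in \<open>rs\<close>; a negative
  difference of shifts forces the entry 0.\<close>

definition gmat :: "nat \<Rightarrow> nat list \<Rightarrow> nat list \<Rightarrow> 'a::field mpoly mat set" where
  "gmat n rs cs = {A \<in> carrier_mat (length rs) (length cs).
     \<forall>i<length rs. \<forall>j<length cs. A $$ (i, j) \<in> forms n (int (cs ! j) - int (rs ! i))}"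

lemma pmat_carrier: "A \<in> pmat n r c \<Longrightarrow> A \<in> carrier_mat r c"
  by (simp add: pmat_def)

lemma gmat_pmat: "A \<in> gmat n rs cs \<Longrightarrow> A \<in> pmat n (length rs) (length cs)"
  by (auto simp: gmat_def pmat_def forms_def)

lemma index_mult_mat_sum:
  assumes "A \<in> carrier_mat r m" "B \<in> carrier_mat m c" "i < r" "j < c"
  shows "(A * B) $$ (i, j) = (\<Sum>k<m. A $$ (i, k) * B $$ (k, j))"
proof -
  have "(A * B) $$ (i, j) = (\<Sum>k\<in>{0..<m}. row A i $ k * col B j $ k)"
    using assms by (simp add: scalar_prod_def)
  also have "\<dots> = (\<Sum>k\<in>{0..<m}. A $$ (i, k) * B $$ (k, j))"
    using assms by (intro sum.cong) auto
  finally show ?thesis by (simp add: lessThan_atLeast0)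
qed

lemma pmat_mult: "A \<in> pmat n r m \<Longrightarrow> B \<in> pmat n m c \<Longrightarrow> A * B \<in> pmat n r c"
  unfolding pmat_def by (auto simp: index_mult_mat_sum[of A r m B c] simp del: index_mult_mat(1) intro!: polys_sum polys_mult)

lemma pmat_minus: "A \<in> pmat n r c \<Longrightarrow> B \<in> pmat n r c \<Longrightarrow> A - B \<in> pmat n r c"
  unfolding pmat_def by (auto intro!: polys_diff)

lemma pmat_one: "1\<^sub>m r \<in> pmat n r r"
  unfolding pmat_def by auto

lemma gmat_mult:
  assumes "A \<in> gmat n rs ms" "B \<in> gmat n ms cs"
  shows "A * B \<in> gmat n rs cs"
proof -
  have "(A * B) $$ (i, j) \<in> forms n (int (cs ! j) - int (rs ! i))" if "i < length rs" "j < length cs" for i j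
  proof -
    have "A $$ (i, k) * B $$ (k, j) \<in> forms n (int (cs ! j) - int (rs ! i))" if "k < length ms" for k
      using forms_mult[of "A $$ (i, k)" n "int (ms ! k) - int (rs ! i)" "B $$ (k, j)" "int (cs ! j) - int (ms ! k)"]
        assms that \<open>i < length rs\<close> \<open>j < length cs\<close> by (simp add: gmat_def)
    then show ?thesis
      using assms that index_mult_mat_sum[of A "length rs" "length ms" B "length cs" i j]
      by (simp add: gmat_def del: index_mult_mat(1)) (rule forms_sum, simp)
  qed
  then show ?thesis using assms by (auto simp: gmat_def)
qed

text \<open>The entries of \<open>D\<close> are homogeneous, so components pass through
  \<open>D * N\<close>: entry \<open>(k, j)\<close> of \<open>N\<close> is cut down to degree
  \<open>cs ! j - ms ! k\<close>, which is the right one for every row \<open>i\<close> at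
  once.\<close>

lemma gmat_hcomp:
  assumes D: "D \<in> gmat n rs ms" and N: "N \<in> pmat n (length ms) (length cs)"
  shows "\<exists>N' \<in> gmat n ms cs. \<forall>i<length rs. \<forall>j<length cs.
    (D * N') $$ (i, j) = hcomp (int (cs ! j) - int (rs ! i)) ((D * N) $$ (i, j))"
proof -
  define N' where "N' = mat (length ms) (length cs) (\<lambda>(k, j). hcomp (int (cs ! j) - int (ms ! k)) (N $$ (k, j)))"
  have N': "N' \<in> gmat n ms cs"
    using N by (auto simp: gmat_def N'_def pmat_def intro!: hcomp_forms)
  have "(D * N') $$ (i, j) = hcomp (int (cs ! j) - int (rs ! i)) ((D * N) $$ (i, j))"
    if ij: "i < length rs" "j < length cs" for i j
  proof -
    let ?t = "int (cs ! j) - int (rs ! i)"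
    have "(D * N') $$ (i, j) = (\<Sum>k<length ms. D $$ (i, k) * hcomp (int (cs ! j) - int (ms ! k)) (N $$ (k, j)))"
      using D N' ij index_mult_mat_sum[of D "length rs" "length ms" N' "length cs" i j]
      by (simp add: gmat_def N'_def del: index_mult_mat(1))
    also have "\<dots> = (\<Sum>k<length ms. hcomp ?t (D $$ (i, k) * N $$ (k, j)))"
    proof (rule sum.cong)
      fix k assume "k \<in> {..<length ms}"
      then have "D $$ (i, k) \<in> forms n (int (ms ! k) - int (rs ! i))"
        using D ij by (auto simp: gmat_def)
      from hcomp_mult[OF this, of "int (cs ! j) - int (ms ! k)"]
      show "D $$ (i, k) * hcomp (int (cs ! j) - int (ms ! k)) (N $$ (k, j)) = hcomp ?t (D $$ (i, k) * N $$ (k, j))"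
        by simp
    qed simp
    also have "\<dots> = hcomp ?t ((D * N) $$ (i, j))"
      using D pmat_carrier[OF N] ij index_mult_mat_sum[of D "length rs" "length ms" N "length cs" i j]
      by (simp add: gmat_def hcomp_sum del: index_mult_mat(1))
    finally show ?thesis .
  qed
  then show ?thesis using N' by blast
qed

text \<open>Exactness yields lifts with arbitrary polynomial entries; their components of the right
  degrees solve the same equation because its right-hand side is already graded.\<close>

lemma gmat_lift:
  assumes D: "D \<in> gmat n rs ms" and N: "N \<in> pmat n (length ms) (length cs)"
    and M: "D * N \<in> gmat n rs cs"
  shows "\<exists>N' \<in> gmat n ms cs. D * N' = D * N"
proof -
  obtain N' where N': "N' \<in> gmat n ms cs" "\<And>i j. i < length rs \<Longrightarrow> j < length cs \<Longrightarrow>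
      (D * N') $$ (i, j) = hcomp (int (cs ! j) - int (rs ! i)) ((D * N) $$ (i, j))"
    using gmat_hcomp[OF D N] by blast
  have "D * N' = D * N"
  proof (rule eq_matI)
    fix i j assume "i < dim_row (D * N)" "j < dim_col (D * N)"
    then have ij: "i < length rs" "j < length cs" using D pmat_carrier[OF N] by (auto simp: gmat_def)
    then show "(D * N') $$ (i, j) = (D * N) $$ (i, j)"
      unfolding N'(2)[OF ij] using M by (intro hcomp_form) (auto simp: gmat_def)
  qed (use D pmat_carrier[OF N] N' in \<open>auto simp: gmat_def\<close>)
  then show ?thesis using N' by blast
qed

section \<open>Lifting of cycles and the comparison theorem\<close>

lemma free_mod_iff: "v \<in> free_mod n r \<longleftrightarrow> v \<in> carrier_vec r \<and> (\<forall>a<r. v $ a \<in> polys n)"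
  by (simp add: free_mod_def)

lemma free_mod_minus: "v \<in> free_mod n r \<Longrightarrow> w \<in> free_mod n r \<Longrightarrow> v - w \<in> free_mod n r"
  by (auto simp: free_mod_iff polys_add polys_diff)

lemma free_mod_mult: "A \<in> pmat n r c \<Longrightarrow> v \<in> free_mod n c \<Longrightarrow> A *\<^sub>v v \<in> free_mod n r"
  by (auto simp: pmat_def free_mod_iff scalar_prod_def intro!: polys_sum polys_mult)

lemma free_mod_col: "A \<in> pmat n r c \<Longrightarrow> j < c \<Longrightarrow> col A j \<in> free_mod n r"
  by (auto simp: pmat_def free_mod_iff)

text \<open>A one-row matrix into \<open>R\<close> with shift list \<open>[0]\<close>, so that the
  lemmas on graded matrices apply to the augmentation; equations for it hold only modulo
  \<open>J\<close>.\<close>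

definition augm :: "'a::field free_complex \<Rightarrow> 'a mpoly mat" where
  "augm F = mat 1 (rk F 0) (\<lambda>(i, j). aug F $ j)"

text \<open>In homological degree 0 the next map goes to \<open>R/J\<close>, so membership of
  representatives in \<open>J\<close> replaces vanishing.\<close>

definition is_cyc :: "'a::field mpoly set \<Rightarrow> 'a free_complex \<Rightarrow> nat \<Rightarrow> 'a mpoly mat \<Rightarrow> bool" where
  "is_cyc J F p M = (case p of
      0 \<Rightarrow> (\<forall>b<dim_col M. (augm F * M) $$ (0, b) \<in> J)
    | Suc q \<Rightarrow> diff F q * M = 0\<^sub>m (rk F q) (dim_col M))"

lemma graded_diff: "graded_complex n F \<Longrightarrow> diff F p \<in> gmat n (shifts F p) (shifts F (Suc p))"
  by (auto simp: graded_complex_def gmat_def)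

lemma graded_augm: "graded_complex n F \<Longrightarrow> augm F \<in> gmat n [0] (shifts F 0)"
  by (auto simp: graded_complex_def gmat_def augm_def)

lemma augm_mult:
  assumes "graded_complex n F" "M \<in> carrier_mat (rk F 0) c" "b < c"
  shows "(augm F * M) $$ (0, b) = aug F \<bullet> col M b"
proof -
  have "row (augm F) 0 = aug F" using assms by (intro eq_vecI) (auto simp: augm_def graded_complex_def)
  then show ?thesis using assms by (simp add: augm_def)
qed

text \<open>Exactness of the resolution, applied to one column at a time.\<close>

lemma res_lift:
  assumes F: "free_resolution n J F" and M: "M \<in> pmat n (rk F p) c" and cyc: "is_cyc J F p M"
  shows "\<exists>N \<in> pmat n (rk F (Suc p)) c. diff F p * N = M"
proof -
  have g: "graded_complex n F" using F by (simp add: free_resolution_def)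
  have "\<exists>w \<in> free_mod n (rk F (Suc p)). diff F p *\<^sub>v w = col M b" if b: "b < c" for b
  proof (cases p)
    case 0
    have "aug F \<bullet> col M b \<in> J" using cyc 0 pmat_carrier[OF M] b augm_mult[OF g, of M c b] by (auto simp: is_cyc_def)
    then have "col M b \<in> {v \<in> free_mod n (rk F 0). aug F \<bullet> v \<in> J}"
      using M b 0 free_mod_col by auto
    also have "\<dots> = (\<lambda>w. diff F 0 *\<^sub>v w) ` free_mod n (rk F 1)"
      using F by (simp add: free_resolution_def)
    finally show ?thesis using 0 by auto
  next
    case (Suc q)
    have d: "diff F q \<in> carrier_mat (rk F q) (rk F (Suc q))" using graded_diff[OF g] by (auto simp: gmat_def)
    have "diff F q *\<^sub>v col M b = col (diff F q * M) b"
      using pmat_carrier[OF M] d b Suc by auto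
    also have "\<dots> = 0\<^sub>v (rk F q)"
      using cyc Suc pmat_carrier[OF M] b by (auto simp: is_cyc_def)
    finally have "col M b \<in> {v \<in> free_mod n (rk F (Suc q)). diff F q *\<^sub>v v = 0\<^sub>v (rk F q)}"
      using M b Suc free_mod_col by auto
    also have "\<dots> = (\<lambda>w. diff F (Suc q) *\<^sub>v w) ` free_mod n (rk F (Suc (Suc q)))"
      using F by (simp add: free_resolution_def)
    finally show ?thesis using Suc by auto
  qed
  then obtain w where w: "\<And>b. b < c \<Longrightarrow> w b \<in> free_mod n (rk F (Suc p)) \<and> diff F p *\<^sub>v w b = col M b"
    by metis
  define N where "N = mat (rk F (Suc p)) c (\<lambda>(i, b). w b $ i)"
  have N: "N \<in> pmat n (rk F (Suc p)) c" using w by (auto simp: N_def pmat_def free_mod_iff)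
  have colN: "col N b = w b" if "b < c" for b
    using w[OF that] that by (intro eq_vecI) (auto simp: N_def free_mod_iff)
  have d: "diff F p \<in> carrier_mat (rk F p) (rk F (Suc p))" using graded_diff[OF g] by (auto simp: gmat_def)
  have "diff F p * N = M"
  proof (rule eq_matI)
    fix i b assume "i < dim_row M" "b < dim_col M"
    then have ib: "i < rk F p" "b < c" using M by (auto simp: pmat_def)
    have "(diff F p * N) $$ (i, b) = (diff F p *\<^sub>v col N b) $ i"
      using d N ib by (auto simp: pmat_def)
    also have "\<dots> = M $$ (i, b)" using w[OF ib(2)] colN[OF ib(2)] M ib by (auto simp: pmat_def)
    finally show "(diff F p * N) $$ (i, b) = M $$ (i, b)" .
  qed (use d N M in \<open>auto simp: pmat_def\<close>)
  then show ?thesis using N by blast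
qed

lemma unit_vec_free_mod: "b < r \<Longrightarrow> unit_vec r b \<in> free_mod n r"
  by (auto simp: free_mod_iff unit_vec_def)

text \<open>Each column is the image of a unit vector, so the inclusion of images in kernels applies
  to it.\<close>

lemma res_cyc:
  assumes F: "free_resolution n J F" shows "is_cyc J F p (diff F p)"
proof -
  have g: "graded_complex n F" using F by (simp add: free_resolution_def)
  have d: "diff F q \<in> carrier_mat (rk F q) (rk F (Suc q))" for q
    using graded_diff[OF g] by (auto simp: gmat_def)
  have cold: "col (diff F q) b = diff F q *\<^sub>v unit_vec (rk F (Suc q)) b" if "b < rk F (Suc q)" for q b
    using d[of q] that by (intro eq_vecI) (auto intro!: scalar_prod_right_unit[symmetric])
  show ?thesis
  proof (cases p)
    case 0
    have "aug F \<bullet> col (diff F 0) b \<in> J" if "b < rk F 1" for b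
      using F cold[of b 0] unit_vec_free_mod[OF that, of n] that unfolding free_resolution_def by auto
    then show ?thesis using 0 d[of 0] augm_mult[OF g d[of 0]] by (auto simp: is_cyc_def)
  next
    case (Suc q)
    have "diff F q * diff F (Suc q) = 0\<^sub>m (rk F q) (rk F (Suc (Suc q)))"
    proof (rule eq_matI)
      fix i b assume "i < dim_row (0\<^sub>m (rk F q) (rk F (Suc (Suc q))) :: 'a mpoly mat)" "b < dim_col (0\<^sub>m (rk F q) (rk F (Suc (Suc q))) :: 'a mpoly mat)"
      then have ib: "i < rk F q" "b < rk F (Suc (Suc q))" by auto
      have "col (diff F (Suc q)) b \<in> (\<lambda>w. diff F (Suc q) *\<^sub>v w) ` free_mod n (rk F (Suc (Suc q)))"
        unfolding cold[OF ib(2)] by (rule imageI, rule unit_vec_free_mod[OF ib(2)])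
      also have "\<dots> = {v \<in> free_mod n (rk F (Suc q)). diff F q *\<^sub>v v = 0\<^sub>v (rk F q)}"
        using F by (simp add: free_resolution_def)
      finally have "diff F q *\<^sub>v col (diff F (Suc q)) b = 0\<^sub>v (rk F q)" by simp
      moreover have "(diff F q * diff F (Suc q)) $$ (i, b) = (diff F q *\<^sub>v col (diff F (Suc q)) b) $ i"
        using d[of q] d[of "Suc q"] ib by auto
      ultimately show "(diff F q * diff F (Suc q)) $$ (i, b) = 0\<^sub>m (rk F q) (rk F (Suc (Suc q))) $$ (i, b)"
        using ib by auto
    qed (use d[of q] d[of "Suc q"] in auto)
    then show ?thesis using Suc d[of p] by (simp add: is_cyc_def)
  qed
qed

text \<open>Since \<open>F\<close> is exact, the cycles \<open>f p * D p\<close> lift to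
  \<open>f (Suc p)\<close>, and \<open>D p * D (Suc p) = 0\<close> makes
  \<open>f (Suc p) * D (Suc p)\<close> consist of cycles again. The source is a general graded
  complex because the cone construction takes a resolution with negated differentials.\<close>

lemma chain_lift:
  assumes F: "free_resolution n J F"
    and D: "\<And>p. D p \<in> gmat n (cs p) (cs (Suc p))"
    and DD: "\<And>p. D p * D (Suc p) = 0\<^sub>m (length (cs p)) (length (cs (Suc (Suc p))))"
    and f0: "f0 \<in> gmat n (shifts F 0) (cs 0)" and c0: "is_cyc J F 0 (f0 * D 0)"
  shows "\<exists>f. f 0 = f0 \<and> (\<forall>p. f p \<in> gmat n (shifts F p) (cs p) \<and> diff F p * f (Suc p) = f p * D p)"
proof -
  have g: "graded_complex n F" using F by (simp add: free_resolution_def)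
  \<comment> \<open>The clause for \<open>p = 0\<close> carries the prescribed start through the
    dependent choice.\<close>
  define P where "P p f \<longleftrightarrow> f \<in> gmat n (shifts F p) (cs p) \<and> is_cyc J F p (f * D p) \<and> (p = 0 \<longrightarrow> f = f0)" for p f
  have "\<exists>f. \<forall>p. P p (f p) \<and> diff F p * f (Suc p) = f p * D p"
  proof (rule dependent_nat_choice)
    show "\<exists>f. P 0 f" using f0 c0 by (auto simp: P_def)
  next
    fix f p assume f: "P p f"
    have M: "f * D p \<in> gmat n (shifts F p) (cs (Suc p))"
      using f D[of p] by (auto simp: P_def intro: gmat_mult)
    then obtain N where N: "N \<in> pmat n (rk F (Suc p)) (length (cs (Suc p)))" "diff F p * N = f * D p"
      using res_lift[OF F gmat_pmat[OF M]] f by (auto simp: P_def)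
    obtain N' where N': "N' \<in> gmat n (shifts F (Suc p)) (cs (Suc p))" "diff F p * N' = f * D p"
      using gmat_lift[OF graded_diff[OF g] N(1)] M N(2) by auto
    have "diff F p * (N' * D (Suc p)) = (diff F p * N') * D (Suc p)"
      using graded_diff[OF g, of p] N'(1) D[of "Suc p"] by (auto simp: gmat_def intro!: assoc_mult_mat[symmetric])
    also have "\<dots> = f * (D p * D (Suc p))"
      unfolding N'(2) using f D[of p] D[of "Suc p"] by (auto simp: gmat_def P_def intro!: assoc_mult_mat)
    also have "\<dots> = 0\<^sub>m (rk F p) (length (cs (Suc (Suc p))))"
      unfolding DD using f by (auto simp: P_def gmat_def)
    finally have "P (Suc p) N'"
      using N' D[of "Suc p"] by (auto simp: P_def is_cyc_def gmat_def)
    then show "\<exists>f'. P (Suc p) f' \<and> diff F p * f' = f * D p" using N' by auto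
  qed
  then show ?thesis by (metis P_def)
qed

section \<open>Uniqueness of graded Betti numbers\<close>

text \<open>If \<open>A\<close> were smaller, padding both factors with zeros to square matrices
  would give the identity as a product whose first factor has a zero column.\<close>

lemma card_le_if_left_inverse:
  fixes P :: "'b \<Rightarrow> 'c \<Rightarrow> 'k::field"
  assumes fin: "finite A" "finite B"
    and PQ: "\<And>b b'. b \<in> B \<Longrightarrow> b' \<in> B \<Longrightarrow> (\<Sum>a\<in>A. P b a * Q a b') = (if b = b' then 1 else 0)"
  shows "card B \<le> card A"
proof (rule ccontr)
  assume "\<not> card B \<le> card A"
  then have lt: "card A < card B" by simp
  let ?n = "card B"
  obtain f where f: "bij_betw f {0..<card A} A" using ex_bij_betw_nat_finite[OF fin(1)] by blast
  obtain g where g: "bij_betw g {0..<?n} B" using ex_bij_betw_nat_finite[OF fin(2)] by blast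
  define M1 where "M1 = mat ?n ?n (\<lambda>(i, k). if k < card A then P (g i) (f k) else 0)"
  define M2 where "M2 = mat ?n ?n (\<lambda>(k, j). if k < card A then Q (f k) (g j) else 0)"
  have c: "M1 \<in> carrier_mat ?n ?n" "M2 \<in> carrier_mat ?n ?n" by (auto simp: M1_def M2_def)
  have "M1 * M2 = 1\<^sub>m ?n"
  proof (rule eq_matI)
    fix i j assume "i < dim_row (1\<^sub>m ?n :: 'k mat)" "j < dim_col (1\<^sub>m ?n :: 'k mat)"
    then have ij: "i < ?n" "j < ?n" by auto
    have "(M1 * M2) $$ (i, j) = (\<Sum>k\<in>{0..<?n}. M1 $$ (i, k) * M2 $$ (k, j))"
      using c ij by (auto simp: scalar_prod_def)
    also have "\<dots> = (\<Sum>k\<in>{0..<?n}. if k < card A then P (g i) (f k) * Q (f k) (g j) else 0)"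
      using ij by (intro sum.cong) (auto simp: M1_def M2_def)
    also have "\<dots> = (\<Sum>k\<in>{0..<card A}. P (g i) (f k) * Q (f k) (g j))"
      using lt by (intro sum.mono_neutral_cong_right) auto
    also have "\<dots> = (\<Sum>a\<in>A. P (g i) a * Q a (g j))"
      by (rule sum.reindex_bij_betw[OF f])
    also have "\<dots> = (if g i = g j then 1 else 0)"
      using ij g by (intro PQ) (auto simp: bij_betw_def)
    also have "g i = g j \<longleftrightarrow> i = j" using g ij by (auto simp: bij_betw_def inj_on_def)
    finally show "(M1 * M2) $$ (i, j) = 1\<^sub>m ?n $$ (i, j)" using ij by simp
  qed (use c in auto)
  then have d: "det M1 * det M2 = 1" using det_mult[OF c] by simp
  \<comment> \<open>Column \<open>card A\<close> is the first column of the padding.\<close>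
  let ?v = "unit_vec ?n (card A) :: 'k vec"
  have "M1 *\<^sub>v ?v = 0\<^sub>v ?n"
    using lt c by (intro eq_vecI) (auto simp: M1_def)
  moreover have "?v \<noteq> 0\<^sub>v ?n"
  proof
    assume "?v = 0\<^sub>v ?n"
    then have "?v $ card A = 0\<^sub>v ?n $ card A" by simp
    then show False using lt by simp
  qed
  ultimately have "det M1 = 0"
    using det_0_iff_vec_prod_zero_field[OF c(1)] unit_vec_carrier by blast
  then show False using d by simp
qed

section \<open>Constant terms, comparison maps and homotopies\<close>

lemma count_list_card: "count_list xs y = card {i. i < length xs \<and> xs ! i = y}"
  by (simp add: count_list_eq_length_filter length_filter_conv_card eq_commute)

lemma const_term_mult:
  assumes "A \<in> carrier_mat r m" "B \<in> carrier_mat m c" "i < r" "j < c"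
  shows "lookup ((A * B) $$ (i, j)) 0 = (\<Sum>k<m. lookup (A $$ (i, k)) 0 * lookup ((B $$ (k, j)) :: 'a::field mpoly) 0)"
  using index_mult_mat_sum[OF assms] by (simp add: lookup_sum lookup_mult_zero)

text \<open>The degree 0 part of \<open>F'\<close> maps onto the quotient ring, which lifts the
  entries of \<open>aug F\<close>. These are homogeneous and the ideal contains the components of
  its elements, so the lift can be made graded.\<close>

lemma augm_lift:
  assumes F': "free_resolution n (mspan U) F'" and F: "graded_complex n F" and U: "mon_closed n U"
  shows "\<exists>f \<in> gmat n (shifts F' 0) (shifts F 0). \<forall>b<rk F 0. (augm F' * f - augm F) $$ (0, b) \<in> mspan U"
proof -
  have g': "graded_complex n F'" using F' by (simp add: free_resolution_def)
  have "\<exists>v\<in>free_mod n (rk F' 0). aug F $ b - aug F' \<bullet> v \<in> mspan U" if "b < rk F 0" for b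
    using F' F that unfolding free_resolution_def graded_complex_def by (auto dest!: forms_polys)
  then obtain v where v: "\<And>b. b < rk F 0 \<Longrightarrow> v b \<in> free_mod n (rk F' 0)"
     "\<And>b. b < rk F 0 \<Longrightarrow> aug F $ b - aug F' \<bullet> v b \<in> mspan U" by metis
  define N where "N = mat (rk F' 0) (rk F 0) (\<lambda>(i, b). v b $ i)"
  have N: "N \<in> pmat n (rk F' 0) (rk F 0)" using v(1) by (auto simp: N_def pmat_def free_mod_iff)
  have colN: "col N b = v b" if "b < rk F 0" for b
    using v(1)[OF that] that by (intro eq_vecI) (auto simp: N_def free_mod_iff)
  obtain N' where N': "N' \<in> gmat n (shifts F' 0) (shifts F 0)" "\<And>b. b < rk F 0 \<Longrightarrow>
      (augm F' * N') $$ (0, b) = hcomp (int (shifts F 0 ! b)) ((augm F' * N) $$ (0, b))"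
    using gmat_hcomp[OF graded_augm[OF g'] N] by auto
  have "(augm F' * N' - augm F) $$ (0, b) \<in> mspan U" if b: "b < rk F 0" for b
  proof -
    have a: "aug F $ b \<in> forms n (int (shifts F 0 ! b))" using F b by (auto simp: graded_complex_def)
    have "(augm F' * N' - augm F) $$ (0, b) = (augm F' * N') $$ (0, b) - aug F $ b"
      using b by (simp add: augm_def)
    also have "\<dots> = - hcomp (int (shifts F 0 ! b)) (aug F $ b - aug F' \<bullet> v b)"
    proof -
      have "aug F $ b = hcomp (int (shifts F 0 ! b)) (aug F $ b - aug F' \<bullet> v b) + hcomp (int (shifts F 0 ! b)) (aug F' \<bullet> v b)"
        using hcomp_form[OF a] hcomp_add[of "int (shifts F 0 ! b)" "aug F $ b - aug F' \<bullet> v b" "aug F' \<bullet> v b"] by simp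
      then show ?thesis
        unfolding N'(2)[OF b] augm_mult[OF g' pmat_carrier[OF N] b] colN[OF b] by (metis add_diff_cancel_right' minus_diff_eq)
    qed
    also have "\<dots> \<in> mspan U" by (intro mspan_uminus mspan_hcomp v b)
    finally show ?thesis .
  qed
  then show ?thesis using N'(1) by blast
qed

lemma mspan_mat_mult:
  assumes U: "mon_closed n U" and A: "A \<in> carrier_mat 1 m" and "\<And>k. k < m \<Longrightarrow> A $$ (0, k) \<in> mspan U"
    and B: "B \<in> pmat n m c" and b: "b < c"
  shows "(A * B) $$ (0, b) \<in> mspan U"
proof -
  have "A $$ (0, k) * B $$ (k, b) \<in> mspan U" if "k < m" for k
    by (rule mspan_mult[OF U assms(3)[OF that]]) (use B b that in \<open>simp add: pmat_def\<close>)
  then have "(\<Sum>k<m. A $$ (0, k) * B $$ (k, b)) \<in> mspan U" by (intro mspan_sum) simp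
  then show ?thesis using index_mult_mat_sum[OF A pmat_carrier[OF B], of 0 b] b by simp
qed

text \<open>Congruences of augmentations modulo the ideal compose, because multiplying by the
  polynomial matrix \<open>g\<close> stays inside the ideal.\<close>

lemma augm_compose:
  assumes U: "mon_closed n U"
    and A: "A \<in> carrier_mat 1 a" and f: "f \<in> pmat n a b" and B: "B \<in> carrier_mat 1 b"
    and g: "g \<in> pmat n b c" and C: "C \<in> carrier_mat 1 c"
    and "\<And>k. k < b \<Longrightarrow> (A * f - B) $$ (0, k) \<in> mspan U"
    and "\<And>k. k < c \<Longrightarrow> (B * g - C) $$ (0, k) \<in> mspan U" and k: "k < c"
  shows "(A * (f * g) - C) $$ (0, k) \<in> mspan U"
proof -
  note c = pmat_carrier[OF f] pmat_carrier[OF g]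
  have "A * (f * g) = (A * f) * g" using assoc_mult_mat[OF A c] by simp
  moreover have "(A * f - B) * g = (A * f) * g - B * g"
    by (rule minus_mult_distrib_mat[OF mult_carrier_mat[OF A c(1)] B c(2)])
  moreover have "((A * f - B) * g) $$ (0, k) \<in> mspan U"
    by (rule mspan_mat_mult[OF U _ assms(7) g k]) (use A B c in auto)
  ultimately have "(A * (f * g)) $$ (0, k) - (B * g) $$ (0, k) \<in> mspan U"
    using A B c k by (simp del: index_mult_mat(1))
  from mspan_add[OF this assms(8)[OF k]] show ?thesis
    using A B C c k by (simp del: index_mult_mat(1))
qed

text \<open>Here \<open>A\<close> is a differential, \<open>S\<close> and \<open>T\<close> are an
  endomorphism of the complex on its target and its source, \<open>K\<close> is the homotopy found
  last and \<open>E\<close> the contribution of the one before. Then \<open>A * (T - 1 - K * A) = S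
  * A - A - (S - 1 - E) * A = E * A = 0\<close>, so the next homotopy is a lift of
  \<open>T - 1 - K * A\<close>.\<close>

lemma homotopy_step:
  fixes A :: "'b::comm_ring_1 mat"
  assumes A: "A \<in> carrier_mat r m" and T: "T \<in> carrier_mat m m" and S: "S \<in> carrier_mat r r"
    and K: "K \<in> carrier_mat m r" and E: "E \<in> carrier_mat r r"
    and AT: "A * T = S * A" and AK: "A * K = S - 1\<^sub>m r - E" and EA: "E * A = 0\<^sub>m r m"
  shows "A * (T - 1\<^sub>m m - K * A) = 0\<^sub>m r m"
proof -
  have KA: "K * A \<in> carrier_mat m m" and SA: "S * A \<in> carrier_mat r m" using K A S by auto
  have "A * (T - 1\<^sub>m m - K * A) = A * (T - 1\<^sub>m m) - A * (K * A)"
    using A T KA by (intro mult_minus_distrib_mat) (auto intro!: minus_carrier_mat)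
  also have "A * (T - 1\<^sub>m m) = S * A - A"
    using mult_minus_distrib_mat[OF A T one_carrier_mat] A AT by simp
  also have "A * (K * A) = (S - 1\<^sub>m r - E) * A"
    using assoc_mult_mat[OF A K A] AK by simp
  also have "\<dots> = (S - 1\<^sub>m r) * A - E * A"
    using A S E by (intro minus_mult_distrib_mat) (auto intro!: minus_carrier_mat)
  also have "(S - 1\<^sub>m r) * A = S * A - A"
    using minus_mult_distrib_mat[OF S one_carrier_mat A] A by simp
  finally show ?thesis using A SA EA by (intro eq_matI) (auto simp del: index_mult_mat(1))
qed

text \<open>The endomorphism lifts the identity of \<open>R/J\<close>, so \<open>t - 1\<close> is a
  sum of products each having a differential as a factor. By minimality differentials have entries
  in the maximal ideal, and these products have constant term 0. The induction builds the homotopy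
  along with the conclusion.\<close>

lemma const_term_endo:
  assumes F: "minimal_free_resolution n J F"
    and t: "\<And>p. t p \<in> gmat n (shifts F p) (shifts F p)"
    and chain: "\<And>p. diff F p * t (Suc p) = t p * diff F p"
    and base: "is_cyc J F 0 (t 0 - 1\<^sub>m (rk F 0))"
    and ab: "a < rk F p" "b < rk F p"
  shows "lookup (t p $$ (a, b)) 0 = (if a = b then 1 else 0)"
proof -
  have F': "free_resolution n J F" using F by (simp add: minimal_free_resolution_def)
  then have g: "graded_complex n F" by (simp add: free_resolution_def)
  let ?r = "rk F" and ?d = "diff F"
  have d: "?d p \<in> pmat n (?r p) (?r (Suc p))" for p using graded_diff[OF g] gmat_pmat by blast
  note dc = pmat_carrier[OF d]
  have t': "t p \<in> pmat n (?r p) (?r p)" for p using t gmat_pmat by blast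
  note tc = pmat_carrier[OF t']
  have dm: "lookup (?d p $$ (a, b)) 0 = 0" if "a < ?r p" "b < ?r (Suc p)" for p a b
    using F that by (auto simp: minimal_free_resolution_def max_ideal_iff)
  have dd: "?d p * ?d (Suc p) = 0\<^sub>m (?r p) (?r (Suc (Suc p)))" for p
    using res_cyc[OF F', of "Suc p"] dc[of "Suc p"] by (simp add: is_cyc_def)
  define good where "good p \<longleftrightarrow> (\<forall>a<?r p. \<forall>b<?r p. lookup (t p $$ (a, b)) 0 = (if a = b then 1 else 0))" for p
  have "good p \<and> (\<exists>h \<in> pmat n (?r (Suc p)) (?r p).
      ?d p * (t (Suc p) - 1\<^sub>m (?r (Suc p)) - h * ?d p) = 0\<^sub>m (?r p) (?r (Suc p)))" for p
  proof (induction p)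
    case 0
    have "t 0 - 1\<^sub>m (?r 0) \<in> pmat n (?r 0) (?r 0)" by (intro pmat_minus t' pmat_one)
    then obtain h where h: "h \<in> pmat n (?r 1) (?r 0)" "?d 0 * h = t 0 - 1\<^sub>m (?r 0)"
      using res_lift[OF F', of _ 0] base by auto
    note hc = pmat_carrier[OF h(1)]
    have "good 0"
      unfolding good_def
    proof (intro allI impI)
      fix a b assume ab: "a < ?r 0" "b < ?r 0"
      have "lookup ((t 0 - 1\<^sub>m (?r 0)) $$ (a, b)) 0 = 0"
        unfolding h(2)[symmetric] using ab const_term_mult[OF dc[of 0] hc[unfolded One_nat_def] ab] dm[of _ 0] by simp
      then show "lookup (t 0 $$ (a, b)) 0 = (if a = b then 1 else 0)"
        using ab by (auto simp: lookup_minus split: if_splits)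
    qed
    moreover have "?d 0 * (t 1 - 1\<^sub>m (?r 1) - h * ?d 0) = 0\<^sub>m (?r 0) (?r 1)"
      \<comment> \<open>There is no earlier homotopy in degree 0, so \<open>E\<close> is the zero
        matrix.\<close>
      by (rule homotopy_step[OF _ tc[of 1] tc[of 0] _ zero_carrier_mat[of "?r 0" "?r 0"]])
        (use dc[of 0] tc[of 0] hc chain[of 0] h(2) in \<open>auto simp: minus_r_inv_mat intro!: eq_matI\<close>)
    ultimately show ?case using h(1) by auto
  next
    case (Suc p)
    then obtain h where h: "h \<in> pmat n (?r (Suc p)) (?r p)"
       and dh: "?d p * (t (Suc p) - 1\<^sub>m (?r (Suc p)) - h * ?d p) = 0\<^sub>m (?r p) (?r (Suc p))" by blast
    let ?M = "t (Suc p) - 1\<^sub>m (?r (Suc p)) - h * ?d p"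
    have M: "?M \<in> pmat n (?r (Suc p)) (?r (Suc p))" by (intro pmat_minus pmat_mult[of _ n _ "?r p"] t' pmat_one h d)
    note hc = pmat_carrier[OF h] and Mc = pmat_carrier[OF M]
    have "is_cyc J F (Suc p) ?M" using dh carrier_matD(2)[OF Mc] by (simp add: is_cyc_def del: index_minus_mat)
    then obtain k where k: "k \<in> pmat n (?r (Suc (Suc p))) (?r (Suc p))" "?d (Suc p) * k = ?M"
      using res_lift[OF F' M] by auto
    note kc = pmat_carrier[OF k(1)]
    have "good (Suc p)"
      unfolding good_def
    proof (intro allI impI)
      fix a b assume ab: "a < ?r (Suc p)" "b < ?r (Suc p)"
      have "lookup (?M $$ (a, b)) 0 = 0"
        unfolding k(2)[symmetric] using ab const_term_mult[OF dc[of "Suc p"] kc ab] dm[of _ "Suc p"] by simp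
      moreover have "lookup ((h * ?d p) $$ (a, b)) 0 = 0"
        using ab const_term_mult[OF hc dc[of p] ab] dm[of _ p] by simp
      ultimately show "lookup (t (Suc p) $$ (a, b)) 0 = (if a = b then 1 else 0)"
        using ab hc dc[of p] by (auto simp: lookup_minus simp del: index_mult_mat(1) split: if_splits)
    qed
    moreover have "?d (Suc p) * (t (Suc (Suc p)) - 1\<^sub>m (?r (Suc (Suc p))) - k * ?d (Suc p)) = 0\<^sub>m (?r (Suc p)) (?r (Suc (Suc p)))"
    proof (rule homotopy_step[OF dc[of "Suc p"] tc[of "Suc (Suc p)"] tc[of "Suc p"] kc _ chain k(2)])
      show "h * ?d p * ?d (Suc p) = 0\<^sub>m (?r (Suc p)) (?r (Suc (Suc p)))"
        using assoc_mult_mat[OF hc dc[of p] dc[of "Suc p"]] dd[of p] right_mult_zero_mat[OF hc] by simp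
    qed (use hc dc[of p] in auto)
    ultimately show ?case using k(1) by auto
  qed
  then show ?thesis using ab by (auto simp: good_def)
qed

text \<open>A nonzero constant has degree 0, so modulo the maximal ideal graded maps connect only
  equal shifts. This refines the comparison of ranks to each internal degree.\<close>

lemma gmat_const_term:
  assumes "A \<in> gmat n rs cs" "i < length rs" "j < length cs" "rs ! i \<noteq> cs ! j"
  shows "lookup (A $$ (i, j)) 0 = 0"
proof (rule ccontr)
  assume "lookup (A $$ (i, j)) 0 \<noteq> 0"
  then have "0 \<in> keys (A $$ (i, j))" by (simp add: in_keys_iff)
  moreover have "A $$ (i, j) \<in> forms n (int (cs ! j) - int (rs ! i))" using assms by (simp add: gmat_def)
  ultimately have "int (mdeg 0) = int (cs ! j) - int (rs ! i)" unfolding forms_def by blast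
  then show False using assms by simp
qed

lemma chain_map_exists:
  fixes F F' :: "'a::field free_complex"
  assumes F: "free_resolution n (mspan U) F" and F': "free_resolution n (mspan U) F'" and U: "mon_closed n U"
  shows "\<exists>f. (\<forall>b<rk F 0. (augm F' * f 0 - augm F) $$ (0, b) \<in> mspan U) \<and>
    (\<forall>p. f p \<in> gmat n (shifts F' p) (shifts F p) \<and> diff F' p * f (Suc p) = f p * diff F p)"
proof -
  have g: "graded_complex n F" "graded_complex n F'" using F F' by (simp_all add: free_resolution_def)
  obtain f0 where f0: "f0 \<in> gmat n (shifts F' 0) (shifts F 0)"
     and a: "\<And>b. b < rk F 0 \<Longrightarrow> (augm F' * f0 - augm F) $$ (0, b) \<in> mspan U"
    using augm_lift[OF F' g(1) U] by blast
  have A: "augm F' \<in> carrier_mat 1 (rk F' 0)" "augm F \<in> carrier_mat 1 (rk F 0)" by (auto simp: augm_def)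
  have d: "diff F p \<in> pmat n (rk F p) (rk F (Suc p))" for p using graded_diff[OF g(1)] gmat_pmat by blast
  note dc = pmat_carrier[OF d]
  have dd: "diff F p * diff F (Suc p) = 0\<^sub>m (rk F p) (rk F (Suc (Suc p)))" for p
    using res_cyc[OF F, of "Suc p"] dc[of "Suc p"] by (simp add: is_cyc_def)
  have f0c: "f0 \<in> carrier_mat (rk F' 0) (rk F 0)" using gmat_pmat[OF f0] by (rule pmat_carrier)
  have "is_cyc (mspan U) F' 0 (f0 * diff F 0)"
  proof -
    have "(augm F' * (f0 * diff F 0)) $$ (0, b) \<in> mspan U" if b: "b < rk F 1" for b
    proof -
      have "(augm F * diff F 0 - 0\<^sub>m 1 (rk F 1)) $$ (0, b) \<in> mspan U" if "b < rk F 1" for b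
        using res_cyc[OF F, of 0] dc[of 0] that A by (auto simp: is_cyc_def simp del: index_mult_mat(1))
      from augm_compose[OF U A(1) gmat_pmat[OF f0] A(2) d[of 0] _ a, of "0\<^sub>m 1 (rk F 1)" b] this b
      have "(augm F' * (f0 * diff F 0) - 0\<^sub>m 1 (rk F 1)) $$ (0, b) \<in> mspan U" by simp
      then show ?thesis using b by (simp del: index_mult_mat(1))
    qed
    then show ?thesis using dc[of 0] by (simp add: is_cyc_def)
  qed
  from chain_lift[where cs = "shifts F" and D = "diff F", OF F' graded_diff[OF g(1)] dd f0 this]
  obtain f where "f 0 = f0" "\<forall>p. f p \<in> gmat n (shifts F' p) (shifts F p) \<and> diff F' p * f (Suc p) = f p * diff F p"
    by blast
  then show ?thesis using a by (intro exI[of _ f]) simp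
qed

text \<open>The composite \<open>F -> F' -> F\<close> of comparison maps has the identity as its
  matrix of constant terms, by minimality of \<open>F\<close>. Constant terms respect shifts, so the
  block of shift \<open>j\<close> of \<open>F\<close> factors through that of
  \<open>F'\<close>.\<close>

lemma minimal_shifts_le:
  fixes F F' :: "'a::field free_complex"
  assumes F: "minimal_free_resolution n (mspan U) F" and F': "free_resolution n (mspan U) F'" and U: "mon_closed n U"
  shows "count_list (shifts F p) j \<le> count_list (shifts F' p) j"
proof -
  have F0: "free_resolution n (mspan U) F" using F by (simp add: minimal_free_resolution_def)
  have g: "graded_complex n F" "graded_complex n F'" using F0 F' by (simp_all add: free_resolution_def)
  obtain f where fa: "\<And>b. b < rk F 0 \<Longrightarrow> (augm F' * f 0 - augm F) $$ (0, b) \<in> mspan U"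
    and f: "\<And>p. f p \<in> gmat n (shifts F' p) (shifts F p)" "\<And>p. diff F' p * f (Suc p) = f p * diff F p"
    using chain_map_exists[OF F0 F' U] by blast
  obtain h where ha: "\<And>b. b < rk F' 0 \<Longrightarrow> (augm F * h 0 - augm F') $$ (0, b) \<in> mspan U"
    and h: "\<And>p. h p \<in> gmat n (shifts F p) (shifts F' p)" "\<And>p. diff F p * h (Suc p) = h p * diff F' p"
    using chain_map_exists[OF F' F0 U] by blast
  note fp = gmat_pmat[OF f(1)] and hp = gmat_pmat[OF h(1)]
  note fc = pmat_carrier[OF fp] and hc = pmat_carrier[OF hp]
  have dc: "diff F p \<in> carrier_mat (rk F p) (rk F (Suc p))" "diff F' p \<in> carrier_mat (rk F' p) (rk F' (Suc p))" for p
    using graded_diff[OF g(1)] graded_diff[OF g(2)] by (auto simp: gmat_def)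
  have A: "augm F' \<in> carrier_mat 1 (rk F' 0)" "augm F \<in> carrier_mat 1 (rk F 0)" by (auto simp: augm_def)
  define t where "t p = h p * f p" for p
  have t: "t p \<in> gmat n (shifts F p) (shifts F p)" for p
    unfolding t_def by (rule gmat_mult[OF h(1) f(1)])
  have tchain: "diff F p * t (Suc p) = t p * diff F p" for p
  proof -
    have "diff F p * t (Suc p) = diff F p * h (Suc p) * f (Suc p)"
      unfolding t_def using dc(1)[of p] hc[of "Suc p"] fc[of "Suc p"] by (simp add: assoc_mult_mat)
    also have "\<dots> = h p * (diff F' p * f (Suc p))"
      unfolding h(2) using dc(2)[of p] hc[of p] fc[of "Suc p"] by (simp add: assoc_mult_mat)
    also have "\<dots> = t p * diff F p"
      unfolding f(2) t_def using dc(1)[of p] hc[of p] fc[of p] by (simp add: assoc_mult_mat)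
    finally show ?thesis .
  qed
  have "is_cyc (mspan U) F 0 (t 0 - 1\<^sub>m (rk F 0))"
  proof -
    have "(augm F * (t 0 - 1\<^sub>m (rk F 0))) $$ (0, b) \<in> mspan U" if b: "b < rk F 0" for b
    proof -
      have "augm F * (t 0 - 1\<^sub>m (rk F 0)) = augm F * t 0 - augm F * 1\<^sub>m (rk F 0)"
        using A gmat_pmat[OF t[of 0], THEN pmat_carrier] by (intro mult_minus_distrib_mat) auto
      also have "\<dots> = augm F * (h 0 * f 0) - augm F" unfolding t_def using A by simp
      also have "\<dots> $$ (0, b) \<in> mspan U"
        by (rule augm_compose[OF U A(2) hp A(1) fp A(2) ha fa b])
      finally show ?thesis .
    qed
    then show ?thesis by (simp add: is_cyc_def)
  qed
  note ct = const_term_endo[OF F t tchain this]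
  let ?A = "{i. i < rk F' p \<and> shifts F' p ! i = j}" and ?B = "{i. i < rk F p \<and> shifts F p ! i = j}"
  have "card ?B \<le> card ?A"
  proof (rule card_le_if_left_inverse)
    fix b b' assume b: "b \<in> ?B" "b' \<in> ?B"
    \<comment> \<open>Summands with another shift vanish for degree reasons, so the sum over the
      block is an entry of the full matrix product.\<close>
    have "(\<Sum>a\<in>?A. lookup (h p $$ (b, a)) 0 * lookup (f p $$ (a, b')) 0)
        = (\<Sum>a<rk F' p. lookup (h p $$ (b, a)) 0 * lookup (f p $$ (a, b')) 0)"
    proof (intro sum.mono_neutral_left)
      show "\<forall>a\<in>{..<rk F' p} - ?A. lookup (h p $$ (b, a)) 0 * lookup (f p $$ (a, b')) 0 = 0"
        using b gmat_const_term[OF h(1)[of p], of b] by fastforce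
    qed auto
    also have "\<dots> = lookup (t p $$ (b, b')) 0"
      unfolding t_def using b const_term_mult[OF hc fc, of b p b'] by simp
    finally show "(\<Sum>a\<in>?A. lookup (h p $$ (b, a)) 0 * lookup (f p $$ (a, b')) 0) = (if b = b' then 1 else 0)"
      using ct b by simp
  qed auto
  then show ?thesis by (simp add: count_list_card)
qed

text \<open>\<open>betti\<close> reads the shifts of an unspecified minimal resolution; the
  inequality in both directions lets an explicit one replace it.\<close>

lemma betti_eq:
  fixes F :: "'a::field free_complex"
  assumes F: "minimal_free_resolution n (mspan U) F" and U: "mon_closed n U"
  shows "betti n (mspan U :: 'a mpoly set) p j = count_list (shifts F p) j"
proof -
  let ?F = "SOME F. minimal_free_resolution n (mspan U :: 'a mpoly set) F"
  have "minimal_free_resolution n (mspan U) ?F" using F by (rule someI)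
  then have "count_list (shifts ?F p) j = count_list (shifts F p) j"
    using minimal_shifts_le[OF F _ U, of ?F p j] minimal_shifts_le[OF _ _ U, of ?F F p j] F
    unfolding minimal_free_resolution_def by simp
  then show ?thesis by (simp add: betti_def)
qed

section \<open>Mapping cones and linear quotients\<close>

lemma res_diff_carrier:
  "graded_complex n F \<Longrightarrow> diff F p \<in> carrier_mat (rk F p) (rk F (Suc p))"
  using graded_diff[of n F p] by (simp add: gmat_def)

lemma res_exact:
  assumes F: "free_resolution n J F"
    and v: "v \<in> free_mod n (rk F p)"
    and c: "case p of 0 \<Rightarrow> aug F \<bullet> v \<in> J | Suc q \<Rightarrow> diff F q *\<^sub>v v = 0\<^sub>v (rk F q)"
  obtains w where "w \<in> free_mod n (rk F (Suc p))" "v = diff F p *\<^sub>v w"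
proof (cases p)
  case 0
  then have "v \<in> (\<lambda>w. diff F 0 *\<^sub>v w) ` free_mod n (rk F 1)"
    using F v c by (auto simp: free_resolution_def)
  then show thesis using that 0 by auto
next
  case (Suc q)
  have "{v \<in> free_mod n (rk F (Suc q)). diff F q *\<^sub>v v = 0\<^sub>v (rk F q)} =
        (\<lambda>w. diff F (Suc q) *\<^sub>v w) ` free_mod n (rk F (Suc (Suc q)))"
    using F by (simp add: free_resolution_def)
  moreover have "v \<in> {v \<in> free_mod n (rk F (Suc q)). diff F q *\<^sub>v v = 0\<^sub>v (rk F q)}"
    using v c Suc by simp
  ultimately have "v \<in> (\<lambda>w. diff F (Suc q) *\<^sub>v w) ` free_mod n (rk F (Suc (Suc q)))" by simp
  then show thesis using that Suc by auto
qed

lemma res_complex: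
  assumes F: "free_resolution n J F" and w: "w \<in> free_mod n (rk F (Suc p))"
  shows "case p of 0 \<Rightarrow> aug F \<bullet> (diff F p *\<^sub>v w) \<in> J | Suc q \<Rightarrow> diff F q *\<^sub>v (diff F p *\<^sub>v w) = 0\<^sub>v (rk F q)"
proof (cases p)
  case 0
  have "diff F 0 *\<^sub>v w \<in> {v \<in> free_mod n (rk F 0). aug F \<bullet> v \<in> J}"
    using F w 0 by (simp add: free_resolution_def)
  then show ?thesis using 0 by simp
next
  case (Suc q)
  have "{v \<in> free_mod n (rk F (Suc q)). diff F q *\<^sub>v v = 0\<^sub>v (rk F q)} =
        (\<lambda>w. diff F (Suc q) *\<^sub>v w) ` free_mod n (rk F (Suc (Suc q)))"
    using F by (simp add: free_resolution_def)
  then have "diff F (Suc q) *\<^sub>v w \<in> {v \<in> free_mod n (rk F (Suc q)). diff F q *\<^sub>v v = 0\<^sub>v (rk F q)}"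
    using w Suc by auto
  then show ?thesis using Suc by simp
qed

text \<open>The normalization makes the projection from \<open>R\<close> itself the augmentation, so
  that a comparison map can start with the 1 by 1 matrix \<open>X g\<close> and the cone is
  normalized again.\<close>

definition cyclic_res :: "nat \<Rightarrow> mon set \<Rightarrow> 'a::field free_complex \<Rightarrow> bool" where
  "cyclic_res n U F \<longleftrightarrow> minimal_free_resolution n (mspan U) F \<and> shifts F 0 = [0] \<and> aug F = vec 1 (\<lambda>_. 1)"

lemma cyclic_resD:
  assumes "cyclic_res n U F"
  shows "free_resolution n (mspan U) F" "graded_complex n F" "rk F 0 = 1"
    "v \<in> carrier_vec 1 \<Longrightarrow> aug F \<bullet> v = v $ 0"
    "a < rk F p \<Longrightarrow> b < rk F (Suc p) \<Longrightarrow> diff F p $$ (a, b) \<in> max_ideal n"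
proof -
  show "free_resolution n (mspan U) F" "graded_complex n F" "rk F 0 = 1"
    "a < rk F p \<Longrightarrow> b < rk F (Suc p) \<Longrightarrow> diff F p $$ (a, b) \<in> max_ideal n"
    using assms by (auto simp: cyclic_res_def minimal_free_resolution_def free_resolution_def)
  show "v \<in> carrier_vec 1 \<Longrightarrow> aug F \<bullet> v = v $ 0"
    using assms by (simp add: cyclic_res_def scalar_prod_def)
qed

section \<open>Mapping cones\<close>

lemma gmat_four_block:
  assumes "A \<in> gmat n r1 c1" "B \<in> gmat n r1 c2" "C \<in> gmat n r2 c1" "D \<in> gmat n r2 c2"
  shows "four_block_mat A B C D \<in> gmat n (r1 @ r2) (c1 @ c2)"
proof -
  have d: "dim_row A = length r1" "dim_col A = length c1" "dim_row D = length r2" "dim_col D = length c2"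
    using assms by (auto simp: gmat_def)
  show ?thesis
    using assms unfolding gmat_def by (auto simp: d nth_append)
qed

lemma gmat_zero: "0\<^sub>m (length rs) (length cs) \<in> gmat n rs cs"
  by (auto simp: gmat_def)

lemma free_mod_append: "x \<in> free_mod n r \<Longrightarrow> y \<in> free_mod n s \<Longrightarrow> x @\<^sub>v y \<in> free_mod n (r + s)"
  by (auto simp: free_mod_iff)

lemma free_mod_split:
  assumes "v \<in> free_mod n (r + s)"
  obtains x y where "x \<in> free_mod n r" "y \<in> free_mod n s" "v = x @\<^sub>v y"
proof
  show "vec_first v r \<in> free_mod n r" "vec_last v s \<in> free_mod n s"
    using assms by (auto simp: free_mod_iff vec_first_def vec_last_def)
  show "v = vec_first v r @\<^sub>v vec_last v s"
    using assms by (simp add: free_mod_iff)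
qed

definition shift_up :: "nat \<Rightarrow> nat list \<Rightarrow> nat list" where
  "shift_up t xs = map (\<lambda>s. s + t) xs"

lemma length_shift_up [simp]: "length (shift_up t xs) = length xs"
  by (simp add: shift_up_def)

lemma gmat_shift_up: "A \<in> gmat n rs cs \<Longrightarrow> A \<in> gmat n (shift_up t rs) (shift_up t cs)"
  by (simp add: gmat_def shift_up_def)

lemma uminus_gmat: "A \<in> gmat n rs cs \<Longrightarrow> - A \<in> gmat n rs cs"
  by (auto simp: gmat_def forms_uminus)

text \<open>\<open>K\<close> moved up by one homological and \<open>t\<close> internal degrees, with
  the zero module in homological degree 0.\<close>

definition prev_shifts :: "nat \<Rightarrow> 'a::field free_complex \<Rightarrow> nat \<Rightarrow> nat list" where
  "prev_shifts t K p = (case p of 0 \<Rightarrow> [] | Suc q \<Rightarrow> shift_up t (shifts K q))"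

definition prev_diff :: "'a::field free_complex \<Rightarrow> nat \<Rightarrow> 'a mpoly mat" where
  "prev_diff K p = (case p of 0 \<Rightarrow> 0\<^sub>m 0 (rk K 0) | Suc q \<Rightarrow> diff K q)"

text \<open>
  The usual signs are absorbed into \<open>f\<close>, which is to anticommute with the differentials.
\<close>

definition cone :: "nat \<Rightarrow> 'a::field free_complex \<Rightarrow> 'a free_complex \<Rightarrow> (nat \<Rightarrow> 'a mpoly mat) \<Rightarrow> 'a free_complex" where
  "cone t F K f = \<lparr>shifts = (\<lambda>p. shifts F p @ prev_shifts t K p), aug = aug F,
     diff = (\<lambda>p. four_block_mat (diff F p) (f p)
        (0\<^sub>m (length (prev_shifts t K p)) (rk F (Suc p))) (prev_diff K p))\<rparr>"

lemma prev_shifts_simps [simp]: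
  "prev_shifts t K 0 = []" "prev_shifts t K (Suc q) = shift_up t (shifts K q)"
  by (simp_all add: prev_shifts_def)

lemma prev_diff_simps [simp]:
  "prev_diff K 0 = 0\<^sub>m 0 (rk K 0)" "prev_diff K (Suc q) = diff K q"
  by (simp_all add: prev_diff_def)

lemma vec_add_eq_0_cancel:
  fixes x :: "'b::ab_group_add vec"
  assumes "x \<in> carrier_vec r" "y \<in> carrier_vec r" "z \<in> carrier_vec r" "x + y = 0\<^sub>v r" "z + y = 0\<^sub>v r"
  shows "x = z"
proof (rule eq_vecI)
  fix i assume "i < dim_vec z"
  then have i: "i < r" using assms by auto
  have "x $ i + y $ i = (x + y) $ i" "z $ i + y $ i = (z + y) $ i" using assms(1-3) i by auto
  then have "x $ i + y $ i = z $ i + y $ i" using assms(4,5) by simp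
  then show "x $ i = z $ i" by simp
qed (use assms in auto)

lemma vec_minus_add_cancel:
  fixes x :: "'b::ab_group_add vec"
  shows "x \<in> carrier_vec r \<Longrightarrow> y \<in> carrier_vec r \<Longrightarrow> x - y + y = x"
  by (intro eq_vecI) auto

text \<open>\<open>V\<close> spans the colon ideal of \<open>mspan U\<close> by \<open>X g\<close>,
  so multiplication by \<open>X g\<close> gives a short exact sequence 0 -> R/V -> R/U -> R/(U, g)
  -> 0. The proof is the diagram chase for the cone of a lift of its first map.\<close>

lemma cone_exact:
  fixes F K :: "'a::field free_complex"
  assumes F: "cyclic_res n U F" and K: "cyclic_res n V K" and U: "mon_closed n U"
    and g: "g \<in> monomials n" and V: "V = {m \<in> monomials n. g + m \<in> U}"
    and f: "\<And>p. f p \<in> gmat n (shifts F p) (shift_up t (shifts K p))"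
    and f0: "f 0 = mat 1 1 (\<lambda>_. X g)"
    and rel: "\<And>p. diff F p * f (Suc p) = f p * (- diff K p)"
  shows "free_resolution n (mspan (U \<union> (+) g ` monomials n)) (cone t F K f)"
proof -
  let ?W = "U \<union> (+) g ` monomials n" and ?C = "cone t F K f"
  note Fd = cyclic_resD[OF F] and Kd = cyclic_resD[OF K]
  let ?r = "rk F" and ?k = "\<lambda>p. length (prev_shifts t K p)"
  have dF: "diff F p \<in> pmat n (?r p) (?r (Suc p))" for p using graded_diff[OF Fd(2)] gmat_pmat by blast
  have dK: "diff K p \<in> pmat n (rk K p) (rk K (Suc p))" for p using graded_diff[OF Kd(2)] gmat_pmat by blast
  have fp: "f p \<in> pmat n (?r p) (rk K p)" for p using gmat_pmat[OF f[of p]] by simp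
  note dFc = pmat_carrier[OF dF] and dKc = pmat_carrier[OF dK] and fc = pmat_carrier[OF fp]
  have pdK: "prev_diff K p \<in> pmat n (?k p) (rk K p)" for p
    using dK by (cases p) (auto simp: pmat_def)
  note pdKc = pmat_carrier[OF pdK]
  have gpd: "prev_diff K p \<in> gmat n (prev_shifts t K p) (shift_up t (shifts K p))" for p
    using graded_diff[OF Kd(2)] by (cases p) (auto simp: gmat_def shift_up_def)
  have gC: "diff ?C p \<in> gmat n (shifts ?C p) (shifts ?C (Suc p))" for p
    using gmat_four_block[OF graded_diff[OF Fd(2), of p] f[of p] gmat_zero[of "prev_shifts t K p" "shifts F (Suc p)"] gpd[of p]]
    by (simp add: cone_def)
  have graded: "graded_complex n ?C"
    using Fd(2) gC unfolding graded_complex_def gmat_def by (simp add: cone_def)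
  have rkC: "rk ?C p = ?r p + ?k p" for p by (simp add: cone_def)
  have dC: "diff ?C p *\<^sub>v (w @\<^sub>v z) = (diff F p *\<^sub>v w + f p *\<^sub>v z) @\<^sub>v (prev_diff K p *\<^sub>v z)"
    if "w \<in> carrier_vec (?r (Suc p))" "z \<in> carrier_vec (rk K p)" for p w z
  proof -
    have "0\<^sub>m (?k p) (?r (Suc p)) *\<^sub>v w + prev_diff K p *\<^sub>v z = prev_diff K p *\<^sub>v z"
      using that pdKc[of p] by (intro eq_vecI) auto
    then show ?thesis
      using four_block_mat_mult_vec[OF dFc[of p] fc[of p] zero_carrier_mat pdKc[of p] that] by (simp add: cone_def)
  qed
  \<comment> \<open>The two paths from \<open>K\<close> to \<open>F\<close> cancel, since
    \<open>f\<close> anticommutes with the differentials.\<close>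
  have relv: "diff F p *\<^sub>v (f (Suc p) *\<^sub>v z) + f p *\<^sub>v (diff K p *\<^sub>v z) = 0\<^sub>v (?r p)"
    if z: "z \<in> carrier_vec (rk K (Suc p))" for p z
  proof -
    have "diff F p *\<^sub>v (f (Suc p) *\<^sub>v z) = (f p * (- diff K p)) *\<^sub>v z"
      using assoc_mult_mat_vec[OF dFc[of p] fc[of "Suc p"] z] rel[of p] by simp
    also have "\<dots> = - ((f p * diff K p) *\<^sub>v z)"
      using z fc[of p] dKc[of p] by (simp add: uminus_mult_mat_vec)
    also have "(f p * diff K p) *\<^sub>v z = f p *\<^sub>v (diff K p *\<^sub>v z)"
      by (rule assoc_mult_mat_vec[OF fc[of p] dKc[of p] z])
    finally show ?thesis using fc[of p] by (intro eq_vecI) (auto simp del: index_mult_mat_vec)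
  qed
  have f0v: "(f 0 *\<^sub>v z) $ 0 = X g * z $ 0" "f 0 *\<^sub>v z \<in> carrier_vec 1" if "z \<in> carrier_vec 1" for z
    using that by (auto simp: f0 scalar_prod_def intro!: carrier_vecI)
  have XgV: "X g * h \<in> mspan U \<longleftrightarrow> h \<in> mspan V" if "h \<in> polys n" for h :: "'a mpoly"
    using that by (auto simp: mspan_def keys_X_mult V polys_def)
  \<comment> \<open>A monomial of the enlarged set lies in \<open>U\<close> or is a multiple of
    \<open>g\<close>, which splits every element of the new ideal term by term.\<close>
  have W: "h \<in> mspan ?W \<longleftrightarrow> (\<exists>a b. a \<in> mspan U \<and> b \<in> polys n \<and> h = a + X g * b)" for h :: "'a mpoly"
  proof
    assume h: "h \<in> mspan ?W"
    have "\<exists>a b. a \<in> mspan U \<and> b \<in> polys n \<and> const (lookup h m) * X m = a + X g * b" if m: "m \<in> keys h" for m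
    proof (cases "m \<in> U")
      case True
      then have "const (lookup h m) * X m \<in> mspan U" by (simp add: mspan_def const_mult_X)
      then show ?thesis by (intro exI[of _ "const (lookup h m) * X m"] exI[of _ 0]) auto
    next
      case False
      then obtain u where u: "m = g + u" "u \<in> monomials n" using h m by (auto simp: mspan_def)
      then show ?thesis
        by (intro exI[of _ 0] exI[of _ "const (lookup h m) * X u"]) (auto simp: X_add mult_ac intro!: polys_mult)
    qed
    then obtain a b where ab: "\<And>m. m \<in> keys h \<Longrightarrow> a m \<in> mspan U \<and> b m \<in> polys n \<and> const (lookup h m) * X m = a m + X g * b m"
      by metis
    have "h = (\<Sum>m\<in>keys h. const (lookup h m) * X m)" by (rule poly_expansion)
    also have "\<dots> = (\<Sum>m\<in>keys h. a m + X g * b m)" using ab by (intro sum.cong) auto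
    also have "\<dots> = (\<Sum>m\<in>keys h. a m) + X g * (\<Sum>m\<in>keys h. b m)"
      by (simp add: sum.distrib sum_distrib_left)
    finally have "h = (\<Sum>m\<in>keys h. a m) + X g * (\<Sum>m\<in>keys h. b m)" .
    moreover have "(\<Sum>m\<in>keys h. a m) \<in> mspan U" using ab by (intro mspan_sum) auto
    moreover have "(\<Sum>m\<in>keys h. b m) \<in> polys n" using ab by (intro polys_sum) auto
    ultimately show "\<exists>a b. a \<in> mspan U \<and> b \<in> polys n \<and> h = a + X g * b" by blast
  next
    assume "\<exists>a b. a \<in> mspan U \<and> b \<in> polys n \<and> h = a + X g * b"
    then obtain a b where "a \<in> mspan U" "b \<in> polys n" "h = a + X g * b" by blast
    moreover then have "a \<in> mspan ?W" "X g * b \<in> mspan ?W"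
      by (auto simp: mspan_def polys_def keys_X_mult)
    ultimately show "h \<in> mspan ?W" using mspan_add by blast
  qed
  have augC: "aug ?C \<bullet> v = v $ 0" if "v \<in> carrier_vec 1" for v
    using Fd(4) that by (simp add: cone_def)
  show ?thesis
    unfolding free_resolution_def
  proof (intro conjI allI)
    show "graded_complex n ?C" by (rule graded)
    show "\<forall>h\<in>polys n. \<exists>v\<in>free_mod n (rk ?C 0). h - aug ?C \<bullet> v \<in> mspan ?W"
    proof
      fix h :: "'a mpoly" assume h: "h \<in> polys n"
      have "aug ?C \<bullet> vec 1 (\<lambda>_. h) = h" by (simp add: augC)
      then show "\<exists>v\<in>free_mod n (rk ?C 0). h - aug ?C \<bullet> v \<in> mspan ?W"
        using h Fd(3) by (intro bexI[of _ "vec 1 (\<lambda>_. h)"]) (auto simp: rkC free_mod_iff)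
    qed
    show "{v \<in> free_mod n (rk ?C 0). aug ?C \<bullet> v \<in> mspan ?W} =
        (\<lambda>w. diff ?C 0 *\<^sub>v w) ` free_mod n (rk ?C 1)"
    proof (intro equalityI subsetI)
      fix v assume "v \<in> {v \<in> free_mod n (rk ?C 0). aug ?C \<bullet> v \<in> mspan ?W}"
      then have v: "v \<in> free_mod n 1" "v $ 0 \<in> mspan ?W"
        using augC[of v] by (auto simp: rkC Fd(3) free_mod_iff)
      then obtain a b where ab: "a \<in> mspan U" "b \<in> polys n" "v $ 0 = a + X g * b" using W by blast
      have aU: "vec 1 (\<lambda>_. a) \<in> free_mod n 1" using ab mspan_polys[OF U] by (auto simp: free_mod_iff)
      obtain w where w: "w \<in> free_mod n (rk F 1)" "vec 1 (\<lambda>_. a) = diff F 0 *\<^sub>v w"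
        using res_exact[OF Fd(1), of "vec 1 (\<lambda>_. a)" 0] aU ab(1) Fd(3,4) by auto
      let ?z = "vec 1 (\<lambda>_. b)"
      have z: "?z \<in> free_mod n (rk K 0)" using ab by (auto simp: free_mod_iff Kd(3))
      have "diff ?C 0 *\<^sub>v (w @\<^sub>v ?z) = (diff F 0 *\<^sub>v w + f 0 *\<^sub>v ?z) @\<^sub>v (prev_diff K 0 *\<^sub>v ?z)"
        using w z by (intro dC) (auto simp: free_mod_iff)
      also have "\<dots> = v"
      proof (rule eq_vecI)
        fix i assume "i < dim_vec v"
        then have i: "i = 0" using v by (auto simp: free_mod_iff)
        have d: "dim_vec (diff F 0 *\<^sub>v w + f 0 *\<^sub>v ?z) = 1" by (simp add: f0)
        show "((diff F 0 *\<^sub>v w + f 0 *\<^sub>v ?z) @\<^sub>v (prev_diff K 0 *\<^sub>v ?z)) $ i = v $ i"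
          using i ab(3) f0v[of ?z] unfolding w(2)[symmetric] by (simp add: f0)
      qed (use v in \<open>auto simp: f0 free_mod_iff\<close>)
      finally show "v \<in> (\<lambda>w. diff ?C 0 *\<^sub>v w) ` free_mod n (rk ?C 1)"
        using free_mod_append[OF w(1) z] by (intro image_eqI[of _ _ "w @\<^sub>v ?z"]) (auto simp: rkC)
    next
      fix v assume "v \<in> (\<lambda>w. diff ?C 0 *\<^sub>v w) ` free_mod n (rk ?C 1)"
      then obtain u where u: "u \<in> free_mod n (?r 1 + rk K 0)" "v = diff ?C 0 *\<^sub>v u" by (auto simp: rkC)
      obtain w z where wz: "w \<in> free_mod n (?r 1)" "z \<in> free_mod n (rk K 0)" "u = w @\<^sub>v z"
        using free_mod_split[OF u(1)] by blast
      have z1: "z \<in> carrier_vec 1" "z $ 0 \<in> polys n" using wz(2) by (auto simp: free_mod_iff Kd(3))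
      have v: "v = (diff F 0 *\<^sub>v w + f 0 *\<^sub>v z) @\<^sub>v (prev_diff K 0 *\<^sub>v z)"
        unfolding u(2) wz(3) using wz by (intro dC) (auto simp: free_mod_iff)
      have Fw: "diff F 0 *\<^sub>v w \<in> free_mod n 1" using free_mod_mult[OF dF[of 0]] wz(1) by (simp add: Fd(3))
      have a: "(diff F 0 *\<^sub>v w) $ 0 \<in> mspan U"
        using res_complex[OF Fd(1), of w 0] wz(1) Fd(4)[of "diff F 0 *\<^sub>v w"] Fw by (auto simp: free_mod_iff)
      have v0: "v $ 0 = (diff F 0 *\<^sub>v w) $ 0 + X g * z $ 0"
      proof -
        have "dim_row (f 0) = 1" by (simp add: f0)
        then show ?thesis unfolding v using f0v[OF z1(1)] Fw by (auto simp: free_mod_iff simp del: index_mult_mat_vec)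
      qed
      have "diff ?C 0 \<in> pmat n (rk ?C 0) (rk ?C 1)" using gmat_pmat[OF gC[of 0]] by simp
      then have "v \<in> free_mod n (rk ?C 0)" unfolding u(2) using u(1)
        by (intro free_mod_mult[of _ n _ "rk ?C 1"]) (auto simp: rkC)
      moreover have "v $ 0 \<in> mspan ?W" unfolding v0 using a z1 by (subst W) blast
      moreover have "v \<in> carrier_vec 1" using calculation(1) by (simp add: rkC free_mod_iff Fd(3))
      ultimately show "v \<in> {v \<in> free_mod n (rk ?C 0). aug ?C \<bullet> v \<in> mspan ?W}"
        using augC[of v] by simp
    qed
  next
    fix q
    show "{v \<in> free_mod n (rk ?C (Suc q)). diff ?C q *\<^sub>v v = 0\<^sub>v (rk ?C q)} =
        (\<lambda>w. diff ?C (Suc q) *\<^sub>v w) ` free_mod n (rk ?C (Suc (Suc q)))"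
    proof (intro equalityI subsetI)
      fix v assume "v \<in> {v \<in> free_mod n (rk ?C (Suc q)). diff ?C q *\<^sub>v v = 0\<^sub>v (rk ?C q)}"
      then have v: "v \<in> free_mod n (?r (Suc q) + rk K q)" "diff ?C q *\<^sub>v v = 0\<^sub>v (rk ?C q)" by (auto simp: rkC)
      obtain x y where xy: "x \<in> free_mod n (?r (Suc q))" "y \<in> free_mod n (rk K q)" "v = x @\<^sub>v y"
        using free_mod_split[OF v(1)] by blast
      have xc: "x \<in> carrier_vec (?r (Suc q))" "y \<in> carrier_vec (rk K q)" using xy by (auto simp: free_mod_iff)
      have "(diff F q *\<^sub>v x + f q *\<^sub>v y) @\<^sub>v (prev_diff K q *\<^sub>v y) = 0\<^sub>v (?r q) @\<^sub>v 0\<^sub>v (?k q)"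
        using v(2) dC[OF xc] unfolding xy(3) by (auto simp: rkC)
      moreover have "diff F q *\<^sub>v x + f q *\<^sub>v y \<in> carrier_vec (?r q)"
        using dFc[of q] fc[of q] by (intro carrier_vecI) simp
      ultimately have eq: "diff F q *\<^sub>v x + f q *\<^sub>v y = 0\<^sub>v (?r q)" "prev_diff K q *\<^sub>v y = 0\<^sub>v (?k q)"
        using append_vec_eq[of _ "?r q" "0\<^sub>v (?r q)"] by auto
      \<comment> \<open>For \<open>q = 0\<close> the relation puts \<open>X g * y $ 0\<close> into
        \<open>mspan U\<close>; this means \<open>y $ 0\<close> is in \<open>mspan V\<close>, as
        \<open>V\<close> is the colon ideal.\<close>
      have cycK: "case q of 0 \<Rightarrow> aug K \<bullet> y \<in> mspan V | Suc r \<Rightarrow> diff K r *\<^sub>v y = 0\<^sub>v (rk K r)"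
      proof (cases q)
        case 0
        have Fx: "diff F 0 *\<^sub>v x \<in> free_mod n 1" using free_mod_mult[OF dF[of 0]] xy(1) 0 by (simp add: Fd(3))
        have y1: "y \<in> carrier_vec 1" "y $ 0 \<in> polys n" using xy(2) 0 by (auto simp: free_mod_iff Kd(3))
        have "(diff F 0 *\<^sub>v x + f 0 *\<^sub>v y) $ 0 = 0" using eq(1) 0 Fd(3) by simp
        then have "(diff F 0 *\<^sub>v x) $ 0 + X g * y $ 0 = 0"
        proof -
          have "dim_row (f 0) = 1" by (simp add: f0)
          with \<open>(diff F 0 *\<^sub>v x + f 0 *\<^sub>v y) $ 0 = 0\<close> show ?thesis
            using f0v[OF y1(1)] by (simp del: index_mult_mat_vec)
        qed
        then have "X g * y $ 0 = - (diff F 0 *\<^sub>v x) $ 0" by (simp add: eq_neg_iff_add_eq_0 add.commute)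
        moreover have "(diff F 0 *\<^sub>v x) $ 0 \<in> mspan U"
          using res_complex[OF Fd(1), of x 0] xy(1) 0 Fd(4)[of "diff F 0 *\<^sub>v x"] Fx by (auto simp: free_mod_iff)
        ultimately have "X g * y $ 0 \<in> mspan U" by (simp add: mspan_uminus)
        then show ?thesis using 0 XgV[OF y1(2)] Kd(4)[OF y1(1)] by simp
      next
        case (Suc r)
        then show ?thesis using eq(2) by simp
      qed
      obtain z where z: "z \<in> free_mod n (rk K (Suc q))" "y = diff K q *\<^sub>v z"
        using res_exact[OF Kd(1) xy(2) cycK] by blast
      have zc: "z \<in> carrier_vec (rk K (Suc q))" using z by (simp add: free_mod_iff)
      have fz: "f (Suc q) *\<^sub>v z \<in> free_mod n (?r (Suc q))" by (rule free_mod_mult[OF fp z(1)])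
      then have fzc: "f (Suc q) *\<^sub>v z \<in> carrier_vec (?r (Suc q))" by (simp add: free_mod_iff)
      \<comment> \<open>Subtracting the image of \<open>z\<close> under \<open>f (Suc q)\<close>
        turns \<open>x\<close> into a cycle of \<open>F\<close>, so exactness of \<open>F\<close>
        supplies the remaining component \<open>w\<close>.\<close>
      have "diff F q *\<^sub>v (x - f (Suc q) *\<^sub>v z) = diff F q *\<^sub>v x - diff F q *\<^sub>v (f (Suc q) *\<^sub>v z)"
        by (rule mult_minus_distrib_mat_vec[OF dFc xc(1) fzc])
      also have "diff F q *\<^sub>v x = diff F q *\<^sub>v (f (Suc q) *\<^sub>v z)"
      proof (rule vec_add_eq_0_cancel[OF _ _ _ eq(1)])
        show "diff F q *\<^sub>v (f (Suc q) *\<^sub>v z) + f q *\<^sub>v y = 0\<^sub>v (?r q)"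
          unfolding z(2) by (rule relv[OF zc])
      qed (use dFc[of q] fc[of q] in \<open>auto intro!: carrier_vecI\<close>)
      also have "diff F q *\<^sub>v (f (Suc q) *\<^sub>v z) - diff F q *\<^sub>v (f (Suc q) *\<^sub>v z) = 0\<^sub>v (?r q)"
        using dFc[of q] by (intro eq_vecI) auto
      finally have "diff F q *\<^sub>v (x - f (Suc q) *\<^sub>v z) = 0\<^sub>v (?r q)" .
      then obtain w where w: "w \<in> free_mod n (?r (Suc (Suc q)))" "x - f (Suc q) *\<^sub>v z = diff F (Suc q) *\<^sub>v w"
        using res_exact[OF Fd(1), of "x - f (Suc q) *\<^sub>v z" "Suc q"] free_mod_minus[OF xy(1) fz] by auto
      have "diff ?C (Suc q) *\<^sub>v (w @\<^sub>v z) = (diff F (Suc q) *\<^sub>v w + f (Suc q) *\<^sub>v z) @\<^sub>v (prev_diff K (Suc q) *\<^sub>v z)"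
        using w z by (intro dC) (auto simp: free_mod_iff)
      also have "diff F (Suc q) *\<^sub>v w + f (Suc q) *\<^sub>v z = x"
        unfolding w(2)[symmetric] by (rule vec_minus_add_cancel[OF xc(1) fzc])
      finally have "diff ?C (Suc q) *\<^sub>v (w @\<^sub>v z) = v" using xy(3) z(2) by simp
      then show "v \<in> (\<lambda>w. diff ?C (Suc q) *\<^sub>v w) ` free_mod n (rk ?C (Suc (Suc q)))"
        using free_mod_append[OF w(1) z(1)] by (intro image_eqI[of _ _ "w @\<^sub>v z"]) (auto simp: rkC)
    next
      fix v assume "v \<in> (\<lambda>w. diff ?C (Suc q) *\<^sub>v w) ` free_mod n (rk ?C (Suc (Suc q)))"
      then obtain u where u: "u \<in> free_mod n (?r (Suc (Suc q)) + rk K (Suc q))" "v = diff ?C (Suc q) *\<^sub>v u" by (auto simp: rkC)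
      obtain w z where wz: "w \<in> free_mod n (?r (Suc (Suc q)))" "z \<in> free_mod n (rk K (Suc q))" "u = w @\<^sub>v z"
        using free_mod_split[OF u(1)] by blast
      have wc: "w \<in> carrier_vec (?r (Suc (Suc q)))" "z \<in> carrier_vec (rk K (Suc q))" using wz by (auto simp: free_mod_iff)
      let ?x = "diff F (Suc q) *\<^sub>v w" and ?y = "diff K q *\<^sub>v z"
      have v: "v = (?x + f (Suc q) *\<^sub>v z) @\<^sub>v ?y"
        unfolding u(2) wz(3) using dC[OF wc] by simp
      have xc: "?x \<in> carrier_vec (?r (Suc q))" "f (Suc q) *\<^sub>v z \<in> carrier_vec (?r (Suc q))" "?y \<in> carrier_vec (rk K q)"
        using dFc[of "Suc q"] fc[of "Suc q"] dKc[of q] by (auto intro!: carrier_vecI)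
      have dx: "diff F q *\<^sub>v ?x = 0\<^sub>v (?r q)" using res_complex[OF Fd(1) wz(1)] by simp
      have dy: "prev_diff K q *\<^sub>v ?y = 0\<^sub>v (?k q)"
        using res_complex[OF Kd(1) wz(2)] by (cases q) auto
      have "diff ?C q *\<^sub>v v = (diff F q *\<^sub>v (?x + f (Suc q) *\<^sub>v z) + f q *\<^sub>v ?y) @\<^sub>v (prev_diff K q *\<^sub>v ?y)"
        unfolding v by (intro dC add_carrier_vec xc)
      also have "diff F q *\<^sub>v (?x + f (Suc q) *\<^sub>v z) = diff F q *\<^sub>v ?x + diff F q *\<^sub>v (f (Suc q) *\<^sub>v z)"
        by (rule mult_add_distrib_mat_vec[OF dFc xc(1,2)])
      also have "\<dots> = diff F q *\<^sub>v (f (Suc q) *\<^sub>v z)" unfolding dx using dFc[of q]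
        by (intro left_zero_vec carrier_vecI) simp
      also have "\<dots> + f q *\<^sub>v ?y = 0\<^sub>v (?r q)" by (rule relv[OF wc(2)])
      finally have "diff ?C q *\<^sub>v v = 0\<^sub>v (rk ?C q)" using dy by (auto simp: rkC)
      moreover have "diff ?C (Suc q) \<in> pmat n (rk ?C (Suc q)) (rk ?C (Suc (Suc q)))" using gmat_pmat[OF gC[of "Suc q"]] by simp
      then have "v \<in> free_mod n (rk ?C (Suc q))" unfolding u(2) using u(1)
        by (intro free_mod_mult[of _ n _ "rk ?C (Suc (Suc q))"]) (auto simp: rkC)
      ultimately show "v \<in> {v \<in> free_mod n (rk ?C (Suc q)). diff ?C q *\<^sub>v v = 0\<^sub>v (rk ?C q)}" by simp
    qed
  qed
qed

text \<open>The condition on shifts forces every entry of the comparison map to have positive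
  degree, so the cone of minimal resolutions is again minimal.\<close>

lemma cone_res:
  fixes F K :: "'a::field free_complex"
  assumes F: "cyclic_res n U F" and K: "cyclic_res n V K" and U: "mon_closed n U"
    and g: "g \<in> monomials n" and V: "V = {m \<in> monomials n. g + m \<in> U}"
    and lt: "\<And>p s s'. s \<in> set (shifts F p) \<Longrightarrow> s' \<in> set (shifts K p) \<Longrightarrow> s < s' + mdeg g"
  shows "\<exists>C :: 'a free_complex. cyclic_res n (U \<union> (+) g ` monomials n) C \<and>
    (\<forall>p. shifts C (Suc p) = shifts F (Suc p) @ shift_up (mdeg g) (shifts K p))"
proof -
  let ?t = "mdeg g"
  note Fd = cyclic_resD[OF F] and Kd = cyclic_resD[OF K]
  have s0: "shifts F 0 = [0]" "shifts K 0 = [0]" using F K by (auto simp: cyclic_res_def)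
  let ?cs = "\<lambda>p. shift_up ?t (shifts K p)"
  define f0 :: "'a mpoly mat" where "f0 = mat 1 1 (\<lambda>_. X g)"
  have f0: "f0 \<in> gmat n (shifts F 0) (?cs 0)"
    using forms_X[OF g] by (auto simp: f0_def s0 gmat_def shift_up_def)
  have dK: "diff K p \<in> gmat n (shifts K p) (shifts K (Suc p))" for p by (rule graded_diff[OF Kd(2)])
  note dKc = gmat_pmat[OF dK, THEN pmat_carrier]
  \<comment> \<open>Lifting along the negated differentials of \<open>K\<close> yields a map that
    anticommutes with the original ones.\<close>
  have D: "- diff K p \<in> gmat n (?cs p) (?cs (Suc p))" for p
    by (intro uminus_gmat gmat_shift_up dK)
  have DD: "- diff K p * - diff K (Suc p) = 0\<^sub>m (length (?cs p)) (length (?cs (Suc (Suc p))))" for p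
    using res_cyc[OF Kd(1), of "Suc p"] dKc[of p] dKc[of "Suc p"] by (simp add: is_cyc_def)
  have "is_cyc (mspan U) F 0 (f0 * - diff K 0)"
  proof -
    have aug1: "augm F = 1\<^sub>m 1" "augm K = 1\<^sub>m 1"
      using F K by (auto simp: augm_def cyclic_res_def intro!: eq_matI)
    have "(f0 * - diff K 0) $$ (0, b) \<in> mspan U" if b: "b < rk K 1" for b
    proof -
      have "diff K 0 $$ (0, b) \<in> mspan V"
        using res_cyc[OF Kd(1), of 0] b dKc[of 0] aug1 Kd(3) by (auto simp: is_cyc_def)
      then have "X g * diff K 0 $$ (0, b) \<in> mspan U" by (auto simp: mspan_def keys_X_mult V)
      moreover have "(f0 * - diff K 0) $$ (0, b) = - (X g * diff K 0 $$ (0, b))"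
        using b dKc[of 0] Kd(3) by (simp add: f0_def scalar_prod_def)
      ultimately show ?thesis by (simp add: mspan_uminus)
    qed
    then show ?thesis using dKc[of 0] Kd(3) aug1 by (simp add: is_cyc_def f0_def)
  qed
  from chain_lift[where cs = ?cs and D = "\<lambda>p. - diff K p", OF Fd(1) D DD f0 this]
  obtain f where f: "f 0 = f0" "\<And>p. f p \<in> gmat n (shifts F p) (?cs p)"
      "\<And>p. diff F p * f (Suc p) = f p * - diff K p" by blast
  let ?C = "cone ?t F K f"
  have res: "free_resolution n (mspan (U \<union> (+) g ` monomials n)) ?C"
    by (rule cone_exact[OF F K U g V f(2) _ f(3)]) (simp add: f(1) f0_def)
  have fm: "f p $$ (a, b) \<in> max_ideal n" if "a < rk F p" "b < rk K p" for p a b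
  proof (rule forms_max_ideal)
    show "f p $$ (a, b) \<in> forms n (int (?cs p ! b) - int (shifts F p ! a))"
      using f(2)[of p] that by (simp add: gmat_def)
    show "0 < int (?cs p ! b) - int (shifts F p ! a)"
      using lt[of "shifts F p ! a" p "shifts K p ! b"] that by (simp add: shift_up_def)
  qed
  have zm: "0 \<in> max_ideal n" by (simp add: max_ideal_iff)
  have dFc: "diff F p \<in> carrier_mat (rk F p) (rk F (Suc p))" for p by (rule res_diff_carrier[OF Fd(2)])
  have pd: "prev_diff K p \<in> carrier_mat (length (prev_shifts ?t K p)) (rk K p)" for p
    using dKc by (cases p) auto
  have pm: "prev_diff K p $$ (a, b) \<in> max_ideal n" if "a < length (prev_shifts ?t K p)" "b < rk K p" for p a b
    using that Kd(5) by (cases p) auto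
  have "diff ?C p $$ (a, b) \<in> max_ideal n" if "a < rk ?C p" "b < rk ?C (Suc p)" for p a b
    using that dFc[of p] pd[of p] by (auto simp: cone_def Fd(5) fm zm pm)
  then have "minimal_free_resolution n (mspan (U \<union> (+) g ` monomials n)) ?C"
    using res by (simp add: minimal_free_resolution_def)
  then have "cyclic_res n (U \<union> (+) g ` monomials n) ?C"
    using F by (simp add: cyclic_res_def cone_def)
  moreover have "shifts ?C (Suc p) = shifts F (Suc p) @ ?cs p" for p by (simp add: cone_def)
  ultimately show ?thesis by blast
qed

lemma cyclic_res_zero_ideal:
  "\<exists>F :: 'a::field free_complex. cyclic_res n {} F \<and> (\<forall>p. shifts F (Suc p) = [])"
proof -
  define sh where "sh p = (if p = 0 then [0::nat] else [])" for p :: nat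
  define F :: "'a free_complex" where
    "F = \<lparr>shifts = sh, aug = vec 1 (\<lambda>_. 1), diff = (\<lambda>p. 0\<^sub>m (length (sh p)) 0)\<rparr>"
  have g: "graded_complex n F"
    by (auto simp: graded_complex_def F_def sh_def forms_1)
  have fm0: "free_mod n 0 = {0\<^sub>v 0 :: 'a mpoly vec}" by (auto simp: free_mod_iff)
  have m0: "0\<^sub>m r 0 *\<^sub>v v = (0\<^sub>v r :: 'a mpoly vec)" if "v \<in> carrier_vec 0" for r v
    using that by (intro eq_vecI) (auto simp: scalar_prod_def)
  have av: "vec 1 (\<lambda>_. 1) \<bullet> v = v $ 0" if "v \<in> carrier_vec 1" for v :: "'a mpoly vec"
    using that by (simp add: scalar_prod_def)
  have "free_resolution n (mspan {}) F"
    unfolding free_resolution_def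
  proof (intro conjI allI)
    show "\<forall>f\<in>polys n. \<exists>v\<in>free_mod n (rk F 0). f - aug F \<bullet> v \<in> mspan {}"
    proof
      fix f :: "'a mpoly" assume "f \<in> polys n"
      then show "\<exists>v\<in>free_mod n (rk F 0). f - aug F \<bullet> v \<in> mspan {}"
        using av[of "vec 1 (\<lambda>_. f)"] by (intro bexI[of _ "vec 1 (\<lambda>_. f)"]) (auto simp: F_def sh_def free_mod_iff)
    qed
    have "{v \<in> free_mod n 1. vec 1 (\<lambda>_. 1) \<bullet> v \<in> mspan {}} = {0\<^sub>v 1 :: 'a mpoly vec}"
    proof (intro equalityI subsetI)
      fix v :: "'a mpoly vec" assume "v \<in> {v \<in> free_mod n 1. vec 1 (\<lambda>_. 1) \<bullet> v \<in> mspan {}}"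
      then have "v \<in> carrier_vec 1" "v $ 0 = 0" using av[of v] by (auto simp: free_mod_iff mspan_def)
      then show "v \<in> {0\<^sub>v 1}" by (auto intro!: eq_vecI)
    qed (auto simp: free_mod_iff av)
    then show "{v \<in> free_mod n (rk F 0). aug F \<bullet> v \<in> mspan {}} = (\<lambda>w. diff F 0 *\<^sub>v w) ` free_mod n (rk F 1)"
      by (simp add: F_def sh_def fm0 m0)
  next
    fix p
    show "{v \<in> free_mod n (rk F (Suc p)). diff F p *\<^sub>v v = 0\<^sub>v (rk F p)} =
        (\<lambda>w. diff F (Suc p) *\<^sub>v w) ` free_mod n (rk F (Suc (Suc p)))"
      by (auto simp: F_def sh_def fm0 m0)
  qed (rule g)
  then have "cyclic_res n {} F"
    by (simp add: cyclic_res_def minimal_free_resolution_def) (simp add: F_def sh_def)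
  then show ?thesis by (intro exI[of _ F]) (simp add: F_def sh_def)
qed

section \<open>Koszul complexes on the first variables\<close>

definition var_ideal :: "nat \<Rightarrow> nat \<Rightarrow> mon set" where
  "var_ideal n r = {m \<in> monomials n. keys m \<inter> {1..r} \<noteq> {}}"

lemma var_ideal_closed: "mon_closed n (var_ideal n r)"
  by (auto simp: mon_closed_def var_ideal_def keys_add_nat)

text \<open>The colon ideal of \<open>(x_1, ..., x_r)\<close> by the next variable is that ideal
  itself, so \<open>K\<close> serves as both complexes of the cone, and Pascal's rule gives the
  ranks.\<close>

lemma koszul_res:
  "r \<le> n \<Longrightarrow> \<exists>K :: 'a::field free_complex. cyclic_res n (var_ideal n r) K \<and>
    (\<forall>p. shifts K p = replicate (r choose p) p)"
proof (induction r)
  case 0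
  obtain F :: "'a free_complex" where F: "cyclic_res n {} F" "\<And>p. shifts F (Suc p) = []"
    using cyclic_res_zero_ideal by blast
  have "shifts F p = replicate (0 choose p) p" for p
    using F by (cases p) (auto simp: cyclic_res_def)
  moreover have "var_ideal n 0 = {}" by (simp add: var_ideal_def)
  ultimately show ?case using F(1) by (intro exI[of _ F]) simp
next
  case (Suc r)
  then obtain K :: "'a free_complex" where K: "cyclic_res n (var_ideal n r) K"
      "\<And>p. shifts K p = replicate (r choose p) p" by auto
  let ?g = "Poly_Mapping.single (Suc r) (1::nat)"
  have g: "?g \<in> monomials n" using Suc.prems by (intro monomials_single) auto
  have V: "var_ideal n r = {m \<in> monomials n. ?g + m \<in> var_ideal n r}"
    using g by (auto simp: var_ideal_def keys_add_nat)
  obtain C :: "'a free_complex" where C: "cyclic_res n (var_ideal n r \<union> (+) ?g ` monomials n) C"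
     "\<And>p. shifts C (Suc p) = shifts K (Suc p) @ shift_up (mdeg ?g) (shifts K p)"
    using cone_res[OF K(1) K(1) var_ideal_closed g V] by (auto simp: K(2))
  have "var_ideal n r \<union> (+) ?g ` monomials n = var_ideal n (Suc r)"
  proof (intro equalityI subsetI)
    fix m assume m: "m \<in> var_ideal n (Suc r)"
    show "m \<in> var_ideal n r \<union> (+) ?g ` monomials n"
    proof (cases "Suc r \<in> keys m")
      case True
      from mon_split[OF True] have e: "m = ?g + (m - ?g)" by (simp add: add.commute)
      then have "m - ?g \<in> monomials n" using m monomials_add[of ?g "m - ?g" n] by (simp add: var_ideal_def)
      then show ?thesis using e by blast
    next
      case False
      then show ?thesis using m by (auto simp: var_ideal_def atLeastAtMostSuc_conv)
    qed
  qed (use g in \<open>auto simp: var_ideal_def keys_add_nat\<close>)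
  moreover have "shifts C p = replicate (Suc r choose p) p" for p
  proof (cases p)
    case 0
    then show ?thesis using C(1) by (simp add: cyclic_res_def)
  next
    case (Suc q)
    then show ?thesis by (simp add: C(2) K(2) shift_up_def replicate_add[symmetric] add.commute)
  qed
  ultimately show ?case using C(1) by (intro exI[of _ C]) simp
qed

section \<open>Linear quotients\<close>

definition top_var :: "mon \<Rightarrow> nat" where
  "top_var m = Max (keys m)"

text \<open>The degree comes first so that the comparison maps of the cones have entries of positive degree.\<close>

definition earlier :: "mon \<Rightarrow> mon \<Rightarrow> bool" where
  "earlier u v \<longleftrightarrow> mdeg u < mdeg v \<or> (mdeg u = mdeg v \<and> v < u)"

text \<open>Among the elements of largest degree, the lexicographically smallest one comes
  last.\<close>

lemma exists_latest:
  assumes "finite S" "S \<noteq> {}"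
  shows "\<exists>g\<in>S. \<forall>h\<in>S - {g}. earlier h g \<and> \<not> earlier g h"
proof -
  define T where "T = {g \<in> S. mdeg g = Max (mdeg ` S)}"
  have "Max (mdeg ` S) \<in> mdeg ` S" using assms by simp
  then obtain g0 where "g0 \<in> S" "mdeg g0 = Max (mdeg ` S)" by (auto simp: image_iff)
  then have T: "finite T" "T \<noteq> {}" using assms by (auto simp: T_def)
  have mx: "mdeg h \<le> Max (mdeg ` S)" if "h \<in> S" for h using that assms by simp
  show ?thesis
  proof (intro bexI[of _ "Min T"] ballI)
    show "Min T \<in> S" using Min_in[OF T] by (simp add: T_def)
    fix h assume h: "h \<in> S - {Min T}"
    have m: "mdeg (Min T) = Max (mdeg ` S)" using Min_in[OF T] by (simp add: T_def)
    show "earlier h (Min T) \<and> \<not> earlier (Min T) h"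
    proof (cases "h \<in> T")
      case True
      then have "Min T \<le> h" using T(1) by simp
      then have "Min T < h" using h by (metis Diff_iff insertI1 order_le_imp_less_or_eq)
      then show ?thesis using True m by (auto simp: earlier_def T_def)
    next
      case False
      then have "mdeg h < Max (mdeg ` S)" using h mx[of h] by (auto simp: T_def)
      then show ?thesis using m by (auto simp: earlier_def)
    qed
  qed
qed

lemma count_list_replicate: "count_list (replicate k x) y = (if x = y then k else 0)"
  by (induction k) auto

lemma set_iff_count_list: "x \<in> set xs \<longleftrightarrow> count_list xs x \<noteq> 0"
  by (metis count_list_0_iff)

text \<open>Removing the latest generator \<open>g\<close> leaves the predecessor sets of the others
  unchanged, so the induction hypothesis applies. Adjoining \<open>g\<close> again attaches a Koszul
  complex on \<open>top_var g - 1\<close> variables, whose part in degree \<open>p\<close> ends up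
  in homological degree \<open>Suc p\<close> and internal degree \<open>mdeg g + p\<close>.\<close>

lemma linear_quotients_res:
  assumes "finite S" "S \<subseteq> monomials n" "0 \<notin> S"
    and "\<And>g. g \<in> S \<Longrightarrow> {m \<in> monomials n. g + m \<in> upset n {h \<in> S. earlier h g}} = var_ideal n (top_var g - 1)"
  shows "\<exists>F :: 'a::field free_complex. cyclic_res n (upset n S) F \<and>
    (\<forall>p j. count_list (shifts F (Suc p)) j =
       (\<Sum>g\<in>S. if j = mdeg g + p then (top_var g - 1) choose p else 0))"
  using assms
proof (induction "card S" arbitrary: S)
  case 0
  then have "S = {}" by simp
  then show ?case using cyclic_res_zero_ideal[of n, where 'a='a] by (auto simp: upset_def)
next
  case (Suc k)
  then have "S \<noteq> {}" by auto
  then obtain g where g: "g \<in> S" "\<And>h. h \<in> S - {g} \<Longrightarrow> earlier h g \<and> \<not> earlier g h"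
    using exists_latest[OF Suc.prems(1)] by blast
  let ?T = "S - {g}"
  have "\<not> earlier g g" by (auto simp: earlier_def)
  then have eg: "{h \<in> S. earlier h g} = ?T" using g by auto
  have eh: "{h' \<in> ?T. earlier h' h} = {h' \<in> S. earlier h' h}" if "h \<in> ?T" for h
    using that g by auto
  have "\<exists>F :: 'a free_complex. cyclic_res n (upset n ?T) F \<and>
    (\<forall>p j. count_list (shifts F (Suc p)) j =
       (\<Sum>g\<in>?T. if j = mdeg g + p then (top_var g - 1) choose p else 0))"
  proof (rule Suc.hyps(1))
    show "k = card ?T" using Suc.hyps(2) g(1) Suc.prems(1) by simp
    fix h assume h: "h \<in> ?T"
    show "{m \<in> monomials n. h + m \<in> upset n {h' \<in> ?T. earlier h' h}} = var_ideal n (top_var h - 1)"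
      unfolding eh[OF h] using Suc.prems(4)[of h] h by simp
  qed (use Suc.prems in auto)
  then obtain F :: "'a free_complex" where F: "cyclic_res n (upset n ?T) F"
    "\<And>p j. count_list (shifts F (Suc p)) j =
       (\<Sum>g\<in>?T. if j = mdeg g + p then (top_var g - 1) choose p else 0)" by blast
  have gm: "g \<in> monomials n" "g \<noteq> 0" using g(1) Suc.prems by auto
  then have "keys g \<noteq> {}" by (auto simp: poly_mapping_eq_iff fun_eq_iff in_keys_iff)
  then have "top_var g \<in> keys g" unfolding top_var_def by (intro Max_in) auto
  then have "top_var g \<in> {1..n}" using gm(1) unfolding monomials_def by blast
  then have tv: "top_var g - 1 \<le> n" by (meson atLeastAtMost_iff diff_le_self le_trans)
  obtain K :: "'a free_complex" where K: "cyclic_res n (var_ideal n (top_var g - 1)) K"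
      "\<And>p. shifts K p = replicate ((top_var g - 1) choose p) p"
    using koszul_res[OF tv] by blast
  have V: "var_ideal n (top_var g - 1) = {m \<in> monomials n. g + m \<in> upset n ?T}"
    using Suc.prems(4)[OF g(1)] eg by simp
  have cl: "mon_closed n (upset n ?T)" using Suc.prems by (intro upset_closed) auto
  \<comment> \<open>A shift of \<open>F\<close> in homological degree \<open>p = Suc q\<close> is
    \<open>mdeg h + q\<close> with \<open>mdeg h <= mdeg g\<close>, because the order compares
    degrees first; the shifts of the Koszul complex there are \<open>p\<close>. For
    \<open>p = 0\<close> the positive degree of \<open>g\<close> suffices.\<close>
  have lt: "s < s' + mdeg g" if s: "s \<in> set (shifts F p)" "s' \<in> set (shifts K p)" for p s s'
  proof (cases p)
    case 0
    then have "s = 0" using s F(1) by (auto simp: cyclic_res_def)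
    moreover have "mdeg g > 0" using gm by (simp flip: neq0_conv)
    ultimately show ?thesis by simp
  next
    case (Suc q)
    then have "count_list (shifts F (Suc q)) s \<noteq> 0" using s by (simp add: set_iff_count_list)
    then have "\<exists>h\<in>?T. s = mdeg h + q"
      unfolding F(2) by (rule contrapos_np) (intro sum.neutral, auto)
    then obtain h where h: "h \<in> ?T" "s = mdeg h + q" by blast
    then have "mdeg h \<le> mdeg g" using g(2)[of h] by (auto simp: earlier_def)
    moreover have "s' = p" using s K(2) by simp
    ultimately show ?thesis using h Suc by simp
  qed
  obtain C :: "'a free_complex" where C0: "cyclic_res n (upset n ?T \<union> (+) g ` monomials n) C \<and>
     (\<forall>p. shifts C (Suc p) = shifts F (Suc p) @ shift_up (mdeg g) (shifts K p))"
    using cone_res[OF F(1) K(1) cl gm(1) V lt] by (rule exE)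
  note C = conjunct1[OF C0] spec[OF conjunct2[OF C0]]
  have "upset n ?T \<union> (+) g ` monomials n = upset n S"
    using g(1) by (auto simp: upset_def)
  moreover have "count_list (shifts C (Suc p)) j =
       (\<Sum>g\<in>S. if j = mdeg g + p then (top_var g - 1) choose p else 0)" for p j
  proof -
    have "shift_up (mdeg g) (shifts K p) = replicate ((top_var g - 1) choose p) (p + mdeg g)"
      by (simp add: shift_up_def K(2))
    then show ?thesis
      using Suc.prems(1) g(1) by (simp add: C(2) F(2) count_list_replicate sum.remove[of S g] add.commute)
  qed
  ultimately show ?case using C(1) by (intro exI[of _ C]) simp
qed

section \<open>Counting monomials\<close>

text \<open>Monomials of positive degree are split by divisibility by the last variable, which gives
  finiteness as well as the Pascal recursion.\<close>

lemma finite_monomials_mdeg: "finite {m \<in> monomials n. mdeg m = t}"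
  and card_monomials_mdeg_rec:
    "card {m \<in> monomials (Suc n). mdeg m = Suc t} =
     card {m \<in> monomials (Suc n). mdeg m = t} + card {m \<in> monomials n. mdeg m = Suc t}"
proof -
  have split: "{m \<in> monomials (Suc n). mdeg m = Suc t} =
      (+) (Poly_Mapping.single (Suc n) 1) ` {m \<in> monomials (Suc n). mdeg m = t} \<union> {m \<in> monomials n. mdeg m = Suc t}"
    for n t
  proof (intro equalityI subsetI)
    fix m assume m: "m \<in> {m \<in> monomials (Suc n). mdeg m = Suc t}"
    show "m \<in> (+) (Poly_Mapping.single (Suc n) 1) ` {m \<in> monomials (Suc n). mdeg m = t} \<union> {m \<in> monomials n. mdeg m = Suc t}"
    proof (cases "Suc n \<in> keys m")
      case True
      define v where "v = m - Poly_Mapping.single (Suc n) 1"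
      have v: "m = Poly_Mapping.single (Suc n) 1 + v" using mon_split[OF True] by (simp add: v_def add.commute)
      then have "v \<in> {m \<in> monomials (Suc n). mdeg m = t}" using m by auto
      then show ?thesis using v by blast
    next
      case False
      then show ?thesis using m by (auto simp: monomials_def subset_iff le_Suc_eq)
    qed
  next
    fix m assume "m \<in> (+) (Poly_Mapping.single (Suc n) 1) ` {m \<in> monomials (Suc n). mdeg m = t} \<union> {m \<in> monomials n. mdeg m = Suc t}"
    then show "m \<in> {m \<in> monomials (Suc n). mdeg m = Suc t}"
      by (auto simp: monomials_single) (auto simp: monomials_def)
  qed
  have fin: "finite {m \<in> monomials n. mdeg m = t}" for n t
  proof (induction n arbitrary: t)
    case 0
    have "{m \<in> monomials 0. mdeg m = t} \<subseteq> {0}"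
      by (auto simp: monomials_def)
    then show ?case by (rule finite_subset) simp
  next
    case (Suc n)
    show ?case
    proof (induction t)
      case 0
      have "{m \<in> monomials (Suc n). mdeg m = 0} \<subseteq> {0}" by auto
      then show ?case by (rule finite_subset) simp
    next
      case (Suc t)
      then show ?case unfolding split using \<open>\<And>t. finite {m \<in> monomials n. mdeg m = t}\<close> by blast
    qed
  qed
  show "finite {m \<in> monomials n. mdeg m = t}" by (rule fin)
  have disj: "(+) (Poly_Mapping.single (Suc n) 1) ` {m \<in> monomials (Suc n). mdeg m = t} \<inter> {m \<in> monomials n. mdeg m = Suc t} = {}"
    by (auto simp: monomials_def keys_add_nat)
  show "card {m \<in> monomials (Suc n). mdeg m = Suc t} =
     card {m \<in> monomials (Suc n). mdeg m = t} + card {m \<in> monomials n. mdeg m = Suc t}"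
    unfolding split using disj fin by (subst card_Un_disjoint) (auto simp: card_image)
qed

lemma card_monomials_mdeg_0: "card {m \<in> monomials n. mdeg m = 0} = 1"
proof -
  have "{m \<in> monomials n. mdeg m = 0} = {0}" by auto
  then show ?thesis by simp
qed

lemma card_monomials_no_vars: "card {m \<in> monomials 0. mdeg m = t} = (if t = 0 then 1 else 0)"
proof -
  have "{m \<in> monomials 0. mdeg m = t} = (if t = 0 then {0} else {})"
    by (auto simp: monomials_def)
  then show ?thesis by simp
qed

lemma card_monomials_mdeg: "card {m \<in> monomials (Suc r). mdeg m = t} = (t + r) choose t"
proof (induction r arbitrary: t)
  case 0
  show ?case
  proof (induction t)
    case (Suc t)
    then show ?case unfolding card_monomials_mdeg_rec by (simp add: card_monomials_no_vars)
  next
    case 0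
    show ?case using card_monomials_mdeg_0[of "Suc 0"] by simp
  qed
next
  case (Suc r)
  note IH = Suc
  show ?case
  proof (induction t)
    case (Suc t)
    then show ?case unfolding card_monomials_mdeg_rec[of "Suc r" t] IH by simp
  next
    case 0
    show ?case using card_monomials_mdeg_0[of "Suc (Suc r)"] by simp
  qed
qed

lemma card_monomials_mdeg': "r \<ge> 1 \<Longrightarrow> card {m \<in> monomials r. mdeg m = t} = (t + r - 1) choose t"
  using card_monomials_mdeg[of "r - 1" t] by simp

text \<open>Both boundary cases of \<open>binom\<close> occur later: \<open>r = 0\<close> as
  \<open>n - 1\<close> for \<open>n = 1\<close>, and negative \<open>t\<close> as
  \<open>e + 1 - q\<close> for \<open>q > e + 1\<close>.\<close>

lemma card_monomials_eq_binom:
  "card {m \<in> monomials r. int (mdeg m) = t} = binom (t + int r - 1) (int r - 1)"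
proof (cases "t < 0")
  case True
  then have "{m \<in> monomials r. int (mdeg m) = t} = {}" by auto
  then show ?thesis using True by (simp only:) (simp add: binom_def)
next
  case False
  define u where "u = nat t"
  have t: "t = int u" using False by (simp add: u_def)
  show ?thesis
  proof (cases r)
    case 0
    then show ?thesis by (simp add: t card_monomials_no_vars binom_def)
  next
    case (Suc s)
    have "nat (int u + int s) = u + s" by simp
    moreover have "(u + s) choose s = (u + s) choose u" using binomial_symmetric[of s "u + s"] by simp
    ultimately show ?thesis
      using Suc by (auto simp: t card_monomials_mdeg binom_def)
  qed
qed

lemma dim_k_forms: "dim_k (forms r t :: 'a::field mpoly set) = card {m \<in> monomials r. int (mdeg m) = t}"
proof -
  interpret vs: vector_space "\<lambda>c f. const c * f :: 'a mpoly"
  proof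
    fix a b :: 'a and x y :: "'a mpoly"
    show "const a * (x + y) = const a * x + const a * y" by (simp add: distrib_left)
    show "const (a + b) * x = const a * x + const b * x"
      by (simp add: const_def single_add distrib_right)
    show "const a * (const b * x) = const (a * b) * x"
      by (simp add: const_def mult_single mult.assoc[symmetric])
    show "const 1 * x = x" by (simp add: const_def)
  qed
  let ?M = "{m \<in> monomials r. int (mdeg m) = t}"
  have fin: "finite ?M"
    using finite_monomials_mdeg[of r "nat t"] by (rule finite_subset[rotated]) auto
  have inj: "inj_on (X :: mon \<Rightarrow> 'a mpoly) ?M"
    by (rule inj_onI) (metis keys_X singleton_inject)
  have ind: "vs.independent (X ` ?M)"
    unfolding vs.independent_explicit_finite_subsets
  proof (intro allI impI ballI)
    fix A u v assume A: "A \<subseteq> X ` ?M" "finite A" "(\<Sum>v\<in>A. const (u v) * v) = 0" and v: "v \<in> A"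
    obtain m where m: "v = X m" using A v by blast
    have "lookup (\<Sum>v\<in>A. const (u v) * v) m = (\<Sum>w\<in>A. if w = v then u w else 0)"
      unfolding lookup_sum
    proof (rule sum.cong)
      fix w assume "w \<in> A"
      then obtain m' where m': "w = X m'" using A by blast
      then have "w = v \<longleftrightarrow> m' = m" unfolding m by (metis keys_X singleton_inject)
      then show "lookup (const (u w) * w) m = (if w = v then u w else 0)"
        unfolding m' by (auto simp: lookup_X)
    qed simp
    then show "u v = 0" using A v by simp
  qed
  have span: "vs.span (X ` ?M) = forms r t"
  proof (intro equalityI subsetI)
    fix f :: "'a mpoly" assume "f \<in> vs.span (X ` ?M)"
    then show "f \<in> forms r t"
    proof (induction rule: vs.span_induct_alt)
      case (step c x y)
      then obtain m where "x = X m" "m \<in> ?M" by blast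
      then have "const c * x \<in> forms r t" by (simp add: const_mult_X forms_def polys_def)
      then show ?case using step by (intro forms_add) auto
    qed simp
  next
    fix f :: "'a mpoly" assume f: "f \<in> forms r t"
    have "(\<Sum>m\<in>keys f. const (lookup f m) * X m) \<in> vs.span (X ` ?M)"
      using f by (intro vs.span_sum vs.span_scale vs.span_base) (auto simp: forms_def polys_def)
    then show "f \<in> vs.span (X ` ?M)" by (subst poly_expansion)
  qed
  have "dim_k (forms r t :: 'a mpoly set) = vs.dim (vs.span (X ` ?M))"
    by (simp add: dim_k_def span)
  also have "\<dots> = card ((X :: mon \<Rightarrow> 'a mpoly) ` ?M)"
    unfolding vs.dim_span by (rule vs.dim_eq_card_independent[OF ind])
  finally show ?thesis using card_image[OF inj] by simp
qed

section \<open>Weight ideals\<close>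

definition wt :: "nat \<Rightarrow> (nat \<Rightarrow> nat) \<Rightarrow> mon \<Rightarrow> nat" where
  "wt n w m = (\<Sum>i\<in>{1..n}. w i * lookup m i)"

definition wideal :: "nat \<Rightarrow> (nat \<Rightarrow> nat) \<Rightarrow> nat \<Rightarrow> mon set" where
  "wideal n w N = {m \<in> monomials n. N \<le> wt n w m}"

definition gens :: "nat \<Rightarrow> mon set \<Rightarrow> mon set" where
  "gens n U = {m \<in> U. \<forall>u\<in>U. lookup u \<le> lookup m \<longrightarrow> u = m}"

lemma min_gens_mspan: "U \<subseteq> monomials n \<Longrightarrow> min_gens n (mspan U :: 'a::field mpoly set) = gens n U"
  by (auto simp: min_gens_def gens_def)

lemma wt_add [simp]: "wt n w (u + v) = wt n w u + wt n w v"
  by (simp add: wt_def lookup_add sum.distrib distrib_left)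

lemma wt_single [simp]: "i \<in> {1..n} \<Longrightarrow> wt n w (Poly_Mapping.single i k) = w i * k"
  by (simp add: wt_def lookup_single when_def if_distrib[of "(*) _"] cong: if_cong)

lemma mdeg_sum_monomial: "m \<in> monomials n \<Longrightarrow> mdeg m = (\<Sum>i\<in>{1..n}. lookup m i)"
  by (rule mdeg_sum) (auto simp: monomials_def)

lemma monomials_lookup_0: "m \<in> monomials n \<Longrightarrow> i \<notin> {1..n} \<Longrightarrow> lookup m i = 0"
  by (auto simp: monomials_def in_keys_iff)

lemma nonzero_keys: "m \<noteq> 0 \<Longrightarrow> \<exists>i. i \<in> keys m" for m :: mon
  by (auto simp: poly_mapping_eq_iff fun_eq_iff in_keys_iff)

lemma wideal_closed: "mon_closed n (wideal n w N)"
  by (auto simp: mon_closed_def wideal_def)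

lemma gens_divides:
  assumes "m \<in> U" "U \<subseteq> monomials n"
  shows "\<exists>g\<in>gens n U. \<exists>v\<in>monomials n. m = g + v"
  using assms(1)
proof (induction "mdeg m" arbitrary: m rule: less_induct)
  case less
  show ?case
  proof (cases "m \<in> gens n U")
    case True
    then show ?thesis by (intro bexI[of _ m] bexI[of _ 0]) auto
  next
    case False
    then obtain u where u: "u \<in> U" "lookup u \<le> lookup m" "u \<noteq> m" using less.prems by (auto simp: gens_def)
    then obtain v where v: "m = u + v" by (auto simp: mon_le_iff)
    then have "v \<noteq> 0" using u by auto
    then have "mdeg u < mdeg m" using v mdeg_eq_0_iff[of v] by (simp del: mdeg_eq_0_iff)
    from less.hyps[OF this u(1)] obtain g v' where g: "g \<in> gens n U" "u = g + v'" by blast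
    have "m = g + (v' + v)" using v g by (simp add: add.assoc)
    moreover have "m \<in> monomials n" using less.prems assms(2) by blast
    ultimately show ?thesis using g(1) by (metis monomials_add)
  qed
qed

lemma upset_gens: "mon_closed n U \<Longrightarrow> upset n (gens n U) = U"
proof (intro equalityI subsetI)
  fix m assume "mon_closed n U" "m \<in> U"
  then show "m \<in> upset n (gens n U)"
    using gens_divides[of m U n] by (auto simp: upset_def mon_closed_def)
qed (auto simp: upset_def gens_def mon_closed_def)

section \<open>Monomials of weight at least \<open>N\<close>: linear quotients and Betti
  numbers\<close>

context
  fixes n N :: nat and w :: "nat \<Rightarrow> nat"
  assumes pos: "\<And>i. i \<in> {1..n} \<Longrightarrow> 1 \<le> w i"
    and anti: "\<And>i j. 1 \<le> i \<Longrightarrow> i \<le> j \<Longrightarrow> j \<le> n \<Longrightarrow> w j \<le> w i"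
    and N: "1 \<le> N"
begin

lemma mdeg_le_wt: "m \<in> monomials n \<Longrightarrow> mdeg m \<le> wt n w m"
  unfolding mdeg_sum_monomial wt_def using pos by (intro sum_mono) auto

text \<open>Dividing a minimal generator by \<open>x_i\<close> must leave the ideal, so the quotient
  has weight below \<open>N\<close>.\<close>

lemma gens_wideal_lt:
  assumes g: "g \<in> gens n (wideal n w N)" and i: "i \<in> keys g"
  shows "wt n w g < N + w i"
proof (rule ccontr)
  assume neg: "\<not> wt n w g < N + w i"
  let ?x = "Poly_Mapping.single i (1::nat)"
  have gm: "g \<in> monomials n" using g by (simp add: gens_def wideal_def)
  then have i': "i \<in> {1..n}" using i unfolding monomials_def by blast
  note s = mon_split[OF i]
  have "wt n w g = wt n w (g - ?x) + w i" using i' arg_cong[OF s, of "wt n w"] by simp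
  then have "g - ?x \<in> wideal n w N"
    using neg gm s monomials_add[of "g - ?x" ?x n] by (simp add: wideal_def)
  moreover have "lookup (g - ?x) \<le> lookup g" by (simp add: le_fun_def lookup_minus)
  ultimately have "g - ?x = g" using g by (simp add: gens_def)
  then have "mdeg g = mdeg g + 1" using arg_cong[OF s, of mdeg] by simp
  then show False by simp
qed

lemma zero_notin_gens_wideal: "0 \<notin> gens n (wideal n w N)"
  using N by (simp add: gens_def wideal_def wt_def)

text \<open>Removing one variable brings the weight below \<open>N\<close>, and a weight is at least
  the degree; hence degrees are at most \<open>N\<close>.\<close>

lemma finite_gens_wideal: "finite (gens n (wideal n w N))"
proof (rule finite_subset)
  show "gens n (wideal n w N) \<subseteq> (\<Union>t\<in>{..N}. {m \<in> monomials n. mdeg m = t})"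
  proof
    fix g assume g: "g \<in> gens n (wideal n w N)"
    then have gm: "g \<in> monomials n" by (simp add: gens_def wideal_def)
    have "g \<noteq> 0" using g zero_notin_gens_wideal by auto
    then obtain i where i: "i \<in> keys g" using nonzero_keys by blast
    let ?x = "Poly_Mapping.single i (1::nat)"
    have i': "i \<in> {1..n}" using gm i unfolding monomials_def by blast
    note s = mon_split[OF i]
    have "g - ?x \<in> monomials n" using gm s monomials_add[of "g - ?x" ?x n] by simp
    from mdeg_le_wt[OF this] have "mdeg g + w i \<le> wt n w g + 1"
      using i' arg_cong[OF s, of "wt n w"] arg_cong[OF s, of mdeg] by simp
    then show "g \<in> (\<Union>t\<in>{..N}. {m \<in> monomials n. mdeg m = t})"
      using gens_wideal_lt[OF g i] gm by auto
  qed
qed (simp add: finite_monomials_mdeg)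

text \<open>Let \<open>r = top_var g\<close>. For \<open>i < r\<close>, exchanging one
  \<open>x_r\<close> in \<open>g\<close> for \<open>x_i\<close> does not lower the weight, and a
  generator dividing the result is earlier than \<open>g\<close>. Conversely, a multiplier free of
  \<open>x_1, ..., x_{r-1}\<close> cannot reach an earlier generator: one of smaller degree would
  contradict the minimality of \<open>g\<close>, and one of equal degree would be a proper multiple
  of \<open>g\<close>.\<close>

lemma colon_wideal:
  assumes g: "g \<in> gens n (wideal n w N)"
  shows "{m \<in> monomials n. g + m \<in> upset n {h \<in> gens n (wideal n w N). earlier h g}} = var_ideal n (top_var g - 1)"
proof -
  let ?W = "wideal n w N" and ?M = "top_var g"
  have gm: "g \<in> monomials n" and gN: "N \<le> wt n w g" using g by (auto simp: gens_def wideal_def)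
  have "keys g \<noteq> {}" using g zero_notin_gens_wideal nonzero_keys by auto
  then have M: "?M \<in> keys g" unfolding top_var_def by (intro Max_in) auto
  have M': "?M \<in> {1..n}" using gm M unfolding monomials_def by blast
  have gM: "lookup g i = 0" if "i > ?M" for i
    using that Max_ge[OF finite_keys, of i g] unfolding top_var_def by (meson in_keys_iff leD)
  show ?thesis
  proof (intro equalityI subsetI)
    fix m assume m: "m \<in> var_ideal n (?M - 1)"
    then obtain i where i: "i \<in> keys m" "i \<in> {1..?M - 1}" and mm: "m \<in> monomials n"
      unfolding var_ideal_def by blast
    then have i: "i \<in> keys m" "1 \<le> i" "i < ?M" by auto
    let ?x = "Poly_Mapping.single i (1::nat)" and ?y = "Poly_Mapping.single ?M (1::nat)"
    define u where "u = g - ?y + ?x"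
    have gy: "g - ?y \<in> monomials n" using gm mon_split[OF M] monomials_add[of "g - ?y" ?y n] by simp
    have um: "u \<in> monomials n" using gy i M' by (auto simp: u_def monomials_single)
    have gu: "g + ?x = u + ?y" using mon_split[OF M] by (simp add: u_def add_ac)
    have "wt n w g + w i = wt n w u + w ?M" using arg_cong[OF gu, of "wt n w"] i M' by simp
    moreover have "w ?M \<le> w i" using anti[of i ?M] i M' by simp
    ultimately have "u \<in> ?W" using gN um by (simp add: wideal_def)
    then obtain h v where h: "h \<in> gens n ?W" "v \<in> monomials n" "u = h + v"
      using gens_divides[of u ?W n] by (auto simp: wideal_def)
    have du: "mdeg u = mdeg g" using arg_cong[OF gu, of mdeg] by simp
    \<comment> \<open>Either \<open>h\<close> is a proper divisor of \<open>u\<close> and has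
      smaller degree than \<open>g\<close>, or \<open>h = u\<close>, which is lexicographically
      larger than \<open>g\<close> since the first difference is at \<open>i\<close>.\<close>
    have "earlier h g"
    proof (cases "v = 0")
      case True
      have "lookup g i < lookup u i" "\<forall>k'<i. lookup g k' = lookup u k'"
        using i by (auto simp: u_def lookup_add lookup_minus lookup_single when_def)
      then have "g < u" by (auto simp: less_poly_mapping.rep_eq less_fun_def)
      then show ?thesis using True h du by (simp add: earlier_def)
    next
      case False
      then have "mdeg h < mdeg u" using h(3) mdeg_eq_0_iff[of v] by (simp del: mdeg_eq_0_iff)
      then show ?thesis using du by (simp add: earlier_def)
    qed
    note sm = mon_split[OF i(1)]
    have mx: "m - ?x \<in> monomials n" using mm sm monomials_add[of "m - ?x" ?x n] by simp
    have "g + m = g + ?x + (m - ?x)" using sm by (metis add.assoc add.commute)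
    also have "\<dots> = h + (v + ?y + (m - ?x))" unfolding gu h(3) by (simp add: add_ac)
    finally have "g + m \<in> upset n {h \<in> gens n ?W. earlier h g}"
      unfolding upset_def using h mx \<open>earlier h g\<close> M' monomials_single[of ?M n 1]
      by (intro CollectI exI[of _ h] exI[of _ "v + ?y + (m - ?x)"] conjI) auto
    then show "m \<in> {m \<in> monomials n. g + m \<in> upset n {h \<in> gens n ?W. earlier h g}}"
      using mm by simp
  next
    fix m assume "m \<in> {m \<in> monomials n. g + m \<in> upset n {h \<in> gens n ?W. earlier h g}}"
    then obtain h v where mm: "m \<in> monomials n" and h: "h \<in> gens n ?W" "earlier h g" "g + m = h + v"
      by (auto simp: upset_def)
    have hm: "h \<in> monomials n" and hN: "N \<le> wt n w h" using h by (auto simp: gens_def wideal_def)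
    show "m \<in> var_ideal n (?M - 1)"
    proof (rule ccontr)
      assume "m \<notin> var_ideal n (?M - 1)"
      then have m0: "lookup m i = 0" if "i < ?M" for i
        using mm that monomials_lookup_0[OF mm, of i] by (cases "i = 0") (auto simp: var_ideal_def in_keys_iff)
      have hg: "lookup h i \<le> lookup g i" if "i < ?M" for i
        using m0[OF that] arg_cong[OF h(3), of "\<lambda>f. lookup f i"] by (simp add: lookup_add)
      consider "mdeg h < mdeg g" | "mdeg h = mdeg g" "g < h" using h(2) by (auto simp: earlier_def)
      then show False
      proof cases
        case 1
        \<comment> \<open>With \<open>r = ?M\<close> this says
          \<open>(w i - w r) (h_i - g_i) <= 0\<close>: before \<open>r\<close> the first factor is
          nonnegative and the second nonpositive; after \<open>r\<close> it is the other way round,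
          since \<open>g_i = 0\<close> there. Summed up, the weight of \<open>g\<close> is at least
          that of \<open>h\<close> plus \<open>w r\<close>, too much for a minimal
          generator.\<close>
        have "w i * lookup h i + w ?M * lookup g i \<le> w i * lookup g i + w ?M * lookup h i"
          if i: "i \<in> {1..n}" for i
        proof (cases "i < ?M")
          case True
          then have "w ?M \<le> w i" using anti[of i ?M] i M' by simp
          then obtain a where a: "w i = w ?M + a" using le_Suc_ex by blast
          obtain b where b: "lookup g i = lookup h i + b" using hg[OF True] le_Suc_ex by blast
          show ?thesis unfolding a b by (simp add: algebra_simps)
        next
          case False
          show ?thesis
          proof (cases "i = ?M")
            case False
            then have "i > ?M" using \<open>\<not> i < ?M\<close> by simp
            then show ?thesis using gM[of i] anti[of ?M i] i M' by simp
          qed simp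
        qed
        then have "(\<Sum>i\<in>{1..n}. w i * lookup h i + w ?M * lookup g i) \<le> (\<Sum>i\<in>{1..n}. w i * lookup g i + w ?M * lookup h i)"
          by (rule sum_mono)
        then have "wt n w h + w ?M * mdeg g \<le> wt n w g + w ?M * mdeg h"
          by (simp add: wt_def mdeg_sum_monomial[OF gm] mdeg_sum_monomial[OF hm] sum.distrib sum_distrib_left)
        moreover have "w ?M * Suc (mdeg h) \<le> w ?M * mdeg g" using 1 by (intro mult_le_mono) auto
        ultimately have "wt n w h + w ?M \<le> wt n w g" by simp
        then show False using gens_wideal_lt[OF g M] hN by simp
      next
        case 2
        \<comment> \<open>The first difference favours \<open>h\<close>, so it lies at
          \<open>?M\<close> or later; after \<open>?M\<close> the exponents of \<open>g\<close> are
          0, and \<open>g\<close> properly divides \<open>h\<close>.\<close>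
        from \<open>g < h\<close> obtain k where k: "lookup g k < lookup h k" "\<And>k'. k' < k \<Longrightarrow> lookup g k' = lookup h k'"
          by (auto simp: less_poly_mapping.rep_eq less_fun_def)
        have kM: "?M \<le> k" using hg[of k] k(1) by (meson leD leI)
        have "lookup g i \<le> lookup h i" for i
        proof (cases i k rule: linorder_cases)
          case less then show ?thesis using k(2) by simp
        next
          case equal then show ?thesis using k(1) by simp
        next
          case greater then show ?thesis using gM[of i] kM by simp
        qed
        moreover have "k \<in> {1..n}" using k(1) monomials_lookup_0[OF hm, of k] by force
        ultimately have "mdeg g < mdeg h"
          unfolding mdeg_sum_monomial[OF gm] mdeg_sum_monomial[OF hm]
          using k(1) by (intro sum_strict_mono_ex1) auto
        then show False using 2 by simp
      qed
    qed
  qed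
qed

lemma wideal_res:
  "\<exists>F :: 'a::field free_complex. cyclic_res n (wideal n w N) F \<and>
    (\<forall>p j. count_list (shifts F (Suc p)) j =
       (\<Sum>g\<in>gens n (wideal n w N). if j = mdeg g + p then (top_var g - 1) choose p else 0))"
  using linear_quotients_res[OF finite_gens_wideal _ zero_notin_gens_wideal colon_wideal, where 'a='a]
    upset_gens[OF wideal_closed, of n w N]
  by (simp add: gens_def wideal_def subset_iff)

lemma betti_wideal_Suc:
  "betti n (mspan (wideal n w N) :: 'a::field mpoly set) (Suc p) j =
    (\<Sum>g\<in>gens n (wideal n w N). if j = mdeg g + p then (top_var g - 1) choose p else 0)"
  and betti_wideal_0: "betti n (mspan (wideal n w N) :: 'a::field mpoly set) 0 j = (if j = 0 then 1 else 0)"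
proof -
  obtain F :: "'a free_complex" where F: "cyclic_res n (wideal n w N) F"
    "\<And>p j. count_list (shifts F (Suc p)) j =
       (\<Sum>g\<in>gens n (wideal n w N). if j = mdeg g + p then (top_var g - 1) choose p else 0)"
    using wideal_res[where 'a='a] by blast
  have m: "minimal_free_resolution n (mspan (wideal n w N)) F" using F(1) by (simp add: cyclic_res_def)
  show "betti n (mspan (wideal n w N) :: 'a mpoly set) (Suc p) j =
    (\<Sum>g\<in>gens n (wideal n w N). if j = mdeg g + p then (top_var g - 1) choose p else 0)"
    using betti_eq[OF m wideal_closed] F(2) by simp
  show "betti n (mspan (wideal n w N) :: 'a mpoly set) 0 j = (if j = 0 then 1 else 0)"
    using betti_eq[OF m wideal_closed, of 0 j] F(1) by (simp add: cyclic_res_def)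
qed

lemma total_betti_wideal_0: "total_betti n (mspan (wideal n w N) :: 'a::field mpoly set) 0 = 1"
proof -
  have "{j. betti n (mspan (wideal n w N) :: 'a mpoly set) 0 j \<noteq> 0} = {0}" by (auto simp: betti_wideal_0)
  then show ?thesis by (simp add: total_betti_def betti_wideal_0)
qed

lemma total_betti_wideal_Suc:
  "total_betti n (mspan (wideal n w N) :: 'a::field mpoly set) (Suc p) =
    (\<Sum>g\<in>gens n (wideal n w N). (top_var g - 1) choose p)"
proof -
  let ?G = "gens n (wideal n w N)" and ?b = "betti n (mspan (wideal n w N) :: 'a mpoly set) (Suc p)"
  let ?J = "(\<lambda>g. mdeg g + p) ` ?G"
  have b0: "?b j = 0" if "j \<notin> ?J" for j
    unfolding betti_wideal_Suc using that by (intro sum.neutral) auto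
  have "total_betti n (mspan (wideal n w N) :: 'a mpoly set) (Suc p) = (\<Sum>j\<in>?J. ?b j)"
    unfolding total_betti_def
  proof (rule sum.mono_neutral_left)
    show "{j. ?b j \<noteq> 0} \<subseteq> ?J"
    proof (rule subsetI, rule ccontr)
      fix j assume j: "j \<in> {j. ?b j \<noteq> 0}" "j \<notin> ?J"
      from j(2) have "?b j = 0" by (rule b0)
      with j(1) show False by simp
    qed
    show "finite ?J" using finite_gens_wideal by (rule finite_imageI)
    show "\<forall>j\<in>?J - {j. ?b j \<noteq> 0}. ?b j = 0" by blast
  qed
  also have "\<dots> = (\<Sum>g\<in>?G. \<Sum>j\<in>?J. if j = mdeg g + p then (top_var g - 1) choose p else 0)"
    unfolding betti_wideal_Suc by (rule sum.swap)
  also have "\<dots> = (\<Sum>g\<in>?G. (top_var g - 1) choose p)"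
    using finite_gens_wideal by (intro sum.cong) auto
  finally show ?thesis .
qed

lemma num_gens_wideal:
  "num_gens n (mspan (wideal n w N) :: 'a::field mpoly set) i q =
    card {g \<in> gens n (wideal n w N). mdeg g = q \<and> top_var g = i}"
proof -
  have "(i \<in> keys g \<and> (\<forall>j>i. j \<notin> keys g)) = (top_var g = i)" if "g \<in> gens n (wideal n w N)" for g
  proof -
    have "keys g \<noteq> {}" using that zero_notin_gens_wideal nonzero_keys by auto
    then show ?thesis unfolding top_var_def
      by (metis Max_eqI Max_ge Max_in finite_keys leD leI)
  qed
  moreover have "min_gens n (mspan (wideal n w N) :: 'a mpoly set) = gens n (wideal n w N)"
    by (rule min_gens_mspan) (auto simp: wideal_def)
  ultimately show ?thesis unfolding num_gens_def by (intro arg_cong[where f = card]) auto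
qed

text \<open>A generator of degree \<open>q\<close> sits in homological degree 1 and internal degree
  \<open>q\<close>, and each further step of its Koszul complex raises the internal degree by 1;
  hence \<open>p + q - 1\<close>.\<close>

lemma betti_wideal_num_gens:
  assumes "p \<ge> 1"
  shows "betti n (mspan (wideal n w N) :: 'a::field mpoly set) p (p + q - 1) =
    (\<Sum>i = 1..n. num_gens n (mspan (wideal n w N) :: 'a mpoly set) i q * ((i - 1) choose (p - 1)))"
proof -
  let ?G = "{g \<in> gens n (wideal n w N). mdeg g = q}"
  obtain r where p: "p = Suc r" using assms by (cases p) auto
  have fin: "finite ?G" using finite_gens_wideal by simp
  have tv: "top_var ` ?G \<subseteq> {1..n}"
  proof
    fix i assume "i \<in> top_var ` ?G"
    then obtain g where g: "g \<in> gens n (wideal n w N)" "i = top_var g" by blast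
    then have "keys g \<noteq> {}" using zero_notin_gens_wideal nonzero_keys by auto
    then have "i \<in> keys g" unfolding g(2) top_var_def by (intro Max_in) auto
    then show "i \<in> {1..n}" using g(1) unfolding gens_def wideal_def monomials_def by blast
  qed
  have "betti n (mspan (wideal n w N) :: 'a mpoly set) p (p + q - 1) =
      (\<Sum>g\<in>gens n (wideal n w N). if mdeg g = q then (top_var g - 1) choose r else 0)"
    unfolding p betti_wideal_Suc by (intro sum.cong) auto
  also have "\<dots> = (\<Sum>g\<in>?G. (top_var g - 1) choose r)"
    by (rule sum.inter_filter[OF finite_gens_wideal, symmetric])
  also have "\<dots> = (\<Sum>i = 1..n. \<Sum>g\<in>{g \<in> ?G. top_var g = i}. (top_var g - 1) choose r)"
    by (rule sum.group[symmetric]) (use fin tv in auto)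
  also have "\<dots> = (\<Sum>i = 1..n. num_gens n (mspan (wideal n w N) :: 'a mpoly set) i q * ((i - 1) choose r))"
    unfolding num_gens_wideal by (intro sum.cong) (auto simp: conj_assoc)
  finally show ?thesis by (simp add: p)
qed

end

section \<open>The pairing\<close>

text \<open>With u! denoting the product of the factorials of the exponents, differentiating
  \<open>X^u\<close> by \<open>x^m\<close> gives u!/(u - m)! times \<open>X^(u - m)\<close>.
  Multiplying coefficients by u! therefore turns differentiation into contraction, which is already
  the action in positive characteristic.\<close>

definition act_factor :: "mon \<Rightarrow> 'a::field" where
  "act_factor u = (if CHAR('a) = 0 then of_nat (\<Prod>i\<in>keys u. fact (lookup u i)) else 1)"

definition scaled :: "'a::field mpoly \<Rightarrow> mon \<Rightarrow> 'a" where
  "scaled g u = act_factor u * lookup g u"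

lemma act_factor_nonzero: "act_factor u \<noteq> (0::'a::field)"
proof (cases "CHAR('a) = 0")
  case True
  then have "of_nat k \<noteq> (0::'a)" if "k \<noteq> 0" for k
    using of_nat_eq_0_iff_char_dvd[where 'a='a, of k] that by simp
  then show ?thesis using True by (simp add: act_factor_def)
qed (simp add: act_factor_def)

lemma prod_fact_add_single:
  "(\<Prod>j\<in>keys (u + Poly_Mapping.single i 1). fact (lookup (u + Poly_Mapping.single i 1) j) :: nat) =
    Suc (lookup u i) * (\<Prod>j\<in>keys u. fact (lookup u j))" (is "?L = _")
proof -
  let ?A = "insert i (keys u)" and ?v = "u + Poly_Mapping.single i (1::nat)"
  have "?L = (\<Prod>j\<in>?A. fact (lookup ?v j))"
    by (rule prod.mono_neutral_left) (auto simp: in_keys_iff lookup_add lookup_single when_def split: if_splits)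
  also have "\<dots> = fact (lookup ?v i) * (\<Prod>j\<in>keys u - {i}. fact (lookup ?v j))"
    by (subst prod.insert_remove) auto
  also have "(\<Prod>j\<in>keys u - {i}. fact (lookup ?v j)) = (\<Prod>j\<in>keys u - {i}. fact (lookup u j) :: nat)"
    by (intro prod.cong) (auto simp: lookup_add lookup_single when_def)
  also have "fact (lookup ?v i) = Suc (lookup u i) * fact (lookup u i)"
    by (simp add: lookup_add)
  also have "Suc (lookup u i) * fact (lookup u i) * (\<Prod>j\<in>keys u - {i}. fact (lookup u j))
      = Suc (lookup u i) * (\<Prod>j\<in>?A. fact (lookup u j))"
    by (subst prod.insert_remove) (auto simp: algebra_simps)
  also have "(\<Prod>j\<in>?A. fact (lookup u j)) = (\<Prod>j\<in>keys u. fact (lookup u j) :: nat)"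
    by (rule prod.mono_neutral_right) (auto simp: in_keys_iff)
  finally show ?thesis .
qed

lemma scaled_var_act: "scaled (var_act i g) v = scaled (g::'a::field mpoly) (v + Poly_Mapping.single i 1)"
proof -
  let ?x = "Poly_Mapping.single i (1::nat)"
  let ?c = "\<lambda>m. (if CHAR('a) = 0 then of_nat (lookup m i) else 1) * lookup g m"
  have "lookup (var_act i g) v = (\<Sum>m\<in>keys g. if m = v + ?x then ?c m else 0)"
    unfolding var_act_def lookup_sum
  proof (rule sum.cong)
    fix m
    show "lookup (if lookup m i = 0 then 0 else Poly_Mapping.single (m - ?x) (?c m)) v
        = (if m = v + ?x then ?c m else 0)"
    proof (cases "lookup m i = 0")
      case True
      then have "m \<noteq> v + ?x" by (auto simp: lookup_add)
      then show ?thesis using True by simp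
    next
      case False
      then have "m = m - ?x + ?x" by (intro mon_split) (simp add: in_keys_iff)
      then have "m - ?x = v \<longleftrightarrow> m = v + ?x" by (metis add_diff_cancel_right')
      then show ?thesis using False by (auto simp: lookup_single when_def)
    qed
  qed simp
  also have "\<dots> = ?c (v + ?x)"
    by (auto simp: in_keys_iff)
  finally have l: "lookup (var_act i g) v = ?c (v + ?x)" .
  \<comment> \<open>The factor produced by differentiation is exactly the ratio of the two factorial
    products.\<close>
  have "act_factor (v + ?x) = (if CHAR('a) = 0 then of_nat (lookup (v + ?x) i) else 1) * (act_factor v :: 'a)"
    unfolding act_factor_def using prod_fact_add_single[of v i] by (simp add: lookup_add distrib_right)
  then show ?thesis unfolding scaled_def l by (simp add: mult_ac)
qed

lemma scaled_var_act_power: "scaled ((var_act i ^^ k) g) v = scaled g (v + Poly_Mapping.single i k)"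
proof (induction k arbitrary: v)
  case (Suc k)
  have "Poly_Mapping.single i (Suc k) = Poly_Mapping.single i 1 + Poly_Mapping.single i k"
    by (simp add: single_add[symmetric])
  then show ?case using Suc by (simp add: scaled_var_act add.assoc)
qed simp

lemma scaled_foldr:
  "distinct xs \<Longrightarrow> scaled (foldr (\<lambda>i. var_act i ^^ lookup m i) xs g) v =
    scaled g (v + (\<Sum>i\<in>set xs. Poly_Mapping.single i (lookup m i)))"
  by (induction xs arbitrary: v) (simp_all add: scaled_var_act_power add.assoc)

lemma scaled_mon_act: "m \<in> monomials n \<Longrightarrow> scaled (mon_act n m g) v = scaled g (m + v)"
  using poly_mapping_sum_single[of "{1..n}" m] scaled_foldr[of "[1..<Suc n]" m g v]
  by (simp add: mon_act_def monomials_def atLeastLessThanSuc_atLeastAtMost add.commute del: upt_Suc)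

text \<open>For \<open>L = scaled G\<close> this is the rescaled coefficient of \<open>X^v\<close>
  in the result of letting \<open>f\<close> act on \<open>G\<close>.\<close>

definition pairing :: "(mon \<Rightarrow> 'a::field) \<Rightarrow> 'a mpoly \<Rightarrow> mon \<Rightarrow> 'a" where
  "pairing L f v = (\<Sum>m\<in>keys f. lookup f m * L (m + v))"

text \<open>The scaling factors are nonzero, so \<open>act n f G\<close> vanishes iff all its
  rescaled coefficients do; those at exponents outside \<open>monomials n\<close> are 0 because
  \<open>G\<close> involves only the \<open>n\<close> variables.\<close>

lemma Ann_eq_pairing:
  assumes G: "G \<in> forms n e"
  shows "Ann n G = {f \<in> polys n. \<forall>v\<in>monomials n. pairing (scaled G) f v = 0}"
proof -
  have "act n f G = 0 \<longleftrightarrow> (\<forall>v\<in>monomials n. pairing (scaled G) f v = 0)" if f: "f \<in> polys n" for f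
  proof -
    have eq: "scaled (act n f G) v = pairing (scaled G) f v" for v
    proof -
      have "scaled (act n f G) v = (\<Sum>m\<in>keys f. lookup f m * scaled (mon_act n m G) v)"
        by (simp add: scaled_def act_def lookup_sum sum_distrib_left mult_ac)
      also have "\<dots> = pairing (scaled G) f v"
        unfolding pairing_def using f by (intro sum.cong) (auto simp: polys_def scaled_mon_act)
      finally show ?thesis .
    qed
    have "pairing (scaled G) f v = 0" if "v \<notin> monomials n" for v
    proof -
      have "scaled G (m + v) = 0" for m
      proof -
        have "m + v \<notin> keys G" using G that by (auto simp: forms_def polys_def)
        then show ?thesis by (simp add: scaled_def in_keys_iff)
      qed
      then show ?thesis by (simp add: pairing_def)
    qed
    then have "(\<forall>v\<in>monomials n. pairing (scaled G) f v = 0) \<longleftrightarrow> (\<forall>v. scaled (act n f G) v = 0)"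
      unfolding eq by blast
    also have "\<dots> \<longleftrightarrow> (\<forall>v. lookup (act n f G) v = 0)"
      by (simp add: scaled_def act_factor_nonzero)
    also have "\<dots> \<longleftrightarrow> act n f G = 0"
      by (auto simp: poly_mapping_eq_iff fun_eq_iff)
    finally show ?thesis ..
  qed
  then show ?thesis by (auto simp: Ann_def)
qed

lemma pairing_superset: "finite A \<Longrightarrow> keys f \<subseteq> A \<Longrightarrow> pairing L f v = (\<Sum>m\<in>A. lookup f m * L (m + v))"
  unfolding pairing_def by (rule sum.mono_neutral_left) (auto simp: in_keys_iff)

lemma pairing_add: "pairing L (f + g) v = pairing L f v + pairing L g v"
  using pairing_superset[of "keys f \<union> keys g" f L v] pairing_superset[of "keys f \<union> keys g" g L v]
    pairing_superset[of "keys f \<union> keys g" "f + g" L v] keys_add[of f g]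
  by (simp add: lookup_add distrib_right sum.distrib)

lemma pairing_X_mult: "pairing L (X u * f) v = pairing L f (u + v)"
proof -
  have "pairing L (X u * f) v = (\<Sum>m\<in>keys f. lookup (X u * f) (u + m) * L (u + m + v))"
    unfolding pairing_def keys_X_mult by (subst sum.reindex) (auto simp: inj_on_def)
  also have "\<dots> = pairing L f (u + v)"
    unfolding pairing_def lookup_X_mult by (simp add: add_ac)
  finally show ?thesis .
qed

lemma pairing_X: "pairing L (X u) v = L (u + v)"
  by (simp add: pairing_def lookup_X)

lemma exists_X_factor:
  assumes "f \<in> polys n" "\<And>u. u \<in> keys f \<Longrightarrow> k \<le> lookup u i"
  shows "\<exists>g \<in> polys n. f = X (Poly_Mapping.single i k) * g"
proof -
  let ?x = "Poly_Mapping.single i k"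
  have s: "u = ?x + (u - ?x)" if "u \<in> keys f" for u
  proof -
    have "lookup ?x \<le> lookup u" using assms(2)[OF that] by (auto simp: le_fun_def lookup_single when_def)
    then show ?thesis by (simp add: mon_le_add_diff)
  qed
  define g where "g = (\<Sum>u\<in>keys f. const (lookup f u) * X (u - ?x))"
  have "u - ?x \<in> monomials n" if "u \<in> keys f" for u
    using assms(1) s[OF that] that monomials_add[of ?x "u - ?x" n] by (auto simp: polys_def)
  then have "g \<in> polys n" unfolding g_def by (intro polys_sum polys_mult) auto
  moreover have "X ?x * g = (\<Sum>u\<in>keys f. const (lookup f u) * X u)"
    unfolding g_def sum_distrib_left
  proof (rule sum.cong)
    fix u assume "u \<in> keys f"
    then show "X ?x * (const (lookup f u) * X (u - ?x)) = const (lookup f u) * X u"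
      using s[of u] X_add[of ?x "u - ?x"] by (metis mult.left_commute)
  qed simp
  ultimately show ?thesis using poly_expansion[of f] by metis
qed

section \<open>Leading monomials\<close>

lemma drl_less_irrefl: "\<not> drl_less u u"
  by (simp add: drl_less_def)

lemma drl_less_trans: "drl_less u v \<Longrightarrow> drl_less v w \<Longrightarrow> drl_less u w"
proof -
  assume a: "drl_less u v" "drl_less v w"
  show ?thesis
  proof (cases "mdeg u = mdeg v \<and> mdeg v = mdeg w")
    case True
    then obtain i k where i: "lookup v i < lookup u i" "\<forall>j>i. lookup u j = lookup v j"
      and k: "lookup w k < lookup v k" "\<forall>j>k. lookup v j = lookup w j"
      using a by (auto simp: drl_less_def)
    have "lookup w (max i k) < lookup u (max i k) \<and> (\<forall>j>max i k. lookup u j = lookup w j)"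
      using i k by (cases i k rule: linorder_cases) (auto simp: max_def)
    then show ?thesis using True unfolding drl_less_def by metis
  next
    case False
    then show ?thesis using a by (auto simp: drl_less_def)
  qed
qed

lemma drl_less_total: "u \<noteq> v \<Longrightarrow> drl_less u v \<or> drl_less v u"
proof (cases "mdeg u = mdeg v")
  case True
  assume "u \<noteq> v"
  define D where "D = {i. lookup u i \<noteq> lookup v i}"
  have "D \<subseteq> keys u \<union> keys v" by (auto simp: D_def in_keys_iff)
  then have fin: "finite D" by (rule finite_subset) simp
  have "D \<noteq> {}" using \<open>u \<noteq> v\<close> by (auto simp: D_def poly_mapping_eq_iff fun_eq_iff)
  then have m: "Max D \<in> D" using fin by simp
  have "lookup u j = lookup v j" if "j > Max D" for j
    using Max_ge[OF fin, of j] that by (auto simp: D_def)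
  moreover have "lookup u (Max D) < lookup v (Max D) \<or> lookup v (Max D) < lookup u (Max D)"
    using m by (auto simp: D_def)
  ultimately show ?thesis using True unfolding drl_less_def by metis
qed (auto simp: drl_less_def)

lemma drl_max_exists: "finite A \<Longrightarrow> A \<noteq> {} \<Longrightarrow> \<exists>m\<in>A. \<forall>u\<in>A. u \<noteq> m \<longrightarrow> drl_less u m"
proof (induction A rule: finite_ne_induct)
  case (insert x A)
  then obtain m where m: "m \<in> A" "\<forall>u\<in>A. u \<noteq> m \<longrightarrow> drl_less u m" by blast
  then have "x \<noteq> m" using insert by blast
  then consider "drl_less x m" | "drl_less m x" using drl_less_total by blast
  then show ?case
  proof cases
    case 1
    then show ?thesis using m by blast
  next
    case 2
    have "drl_less u x" if "u \<in> insert x A" "u \<noteq> x" for u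
      using that m(2) 2 drl_less_trans[of u m x] by (cases "u = m") auto
    then show ?thesis by blast
  qed
qed auto

lemma lead_mon_eqI:
  assumes "m \<in> keys f" "\<And>u. u \<in> keys f \<Longrightarrow> u \<noteq> m \<Longrightarrow> drl_less u m"
  shows "lead_mon f = m"
  unfolding lead_mon_def
proof (rule the_equality)
  fix m' assume m': "m' \<in> keys f \<and> (\<forall>u\<in>keys f. u \<noteq> m' \<longrightarrow> drl_less u m')"
  show "m' = m"
  proof (rule ccontr)
    assume "m' \<noteq> m"
    then have "drl_less m m'" "drl_less m' m" using assms m' by auto
    then show False using drl_less_trans drl_less_irrefl by blast
  qed
qed (use assms in auto)

lemma lead_mon:
  assumes "f \<noteq> 0"
  shows "lead_mon f \<in> keys f" "u \<in> keys f \<Longrightarrow> u \<noteq> lead_mon f \<Longrightarrow> drl_less u (lead_mon f)"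
proof -
  obtain m where m: "m \<in> keys f" "\<forall>u\<in>keys f. u \<noteq> m \<longrightarrow> drl_less u m"
    using drl_max_exists[of "keys f"] assms by (auto simp: poly_mapping_eq_iff fun_eq_iff in_keys_iff)
  then have "lead_mon f = m" by (intro lead_mon_eqI) auto
  then show "lead_mon f \<in> keys f" "u \<in> keys f \<Longrightarrow> u \<noteq> lead_mon f \<Longrightarrow> drl_less u (lead_mon f)"
    using m by auto
qed

text \<open>In a fixed degree the exponents are compared from the last variable downwards, and a
  larger exponent makes a monomial smaller; so \<open>x_n\<close> decides first.\<close>

lemma drl_less_last_var:
  assumes "drl_less u v" "mdeg u = mdeg v" "u \<in> monomials n" "v \<in> monomials n"
  shows "lookup v n \<le> lookup u n"
proof -
  obtain i where i: "lookup v i < lookup u i" "\<forall>j>i. lookup u j = lookup v j"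
    using assms by (auto simp: drl_less_def)
  then have "i \<le> n" using monomials_lookup_0[OF assms(3), of i] by force
  then show ?thesis using i by (cases "i = n") auto
qed

lemma drl_less_last_varI:
  assumes "mdeg u = mdeg v" "lookup v n < lookup u n" "u \<in> monomials n" "v \<in> monomials n"
  shows "drl_less u v"
  unfolding drl_less_def using assms monomials_lookup_0[OF assms(3)] monomials_lookup_0[OF assms(4)]
  by (auto intro!: exI[of _ n])

text \<open>Every term of the second summand has the degree of \<open>m\<close> but a higher power
  of \<open>x_n\<close>, hence is smaller.\<close>

lemma lead_mon_X_plus:
  assumes m: "m \<in> monomials n" and g: "g \<in> forms n (int s)" and t: "mdeg m = k + s" and k: "lookup m n < k"
    and n: "1 \<le> n"
  shows "lead_mon (X m + X (Poly_Mapping.single n k) * g) = m" "X m + X (Poly_Mapping.single n k) * g \<noteq> 0"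
proof -
  let ?x = "Poly_Mapping.single n k" and ?f = "X m + X (Poly_Mapping.single n k) * g"
  have kg: "u \<in> monomials n \<and> mdeg u = mdeg m \<and> lookup m n < lookup u n" if "u \<in> keys (X ?x * g)" for u
    using that g t k n by (auto simp: keys_X_mult forms_def polys_def lookup_add monomials_single)
  then have "m \<notin> keys (X ?x * g)" by blast
  then have "lookup ?f m = 1" by (simp add: lookup_add lookup_X in_keys_iff)
  then have mk: "m \<in> keys ?f" by (simp add: in_keys_iff)
  then show "?f \<noteq> 0" by auto
  show "lead_mon ?f = m"
  proof (rule lead_mon_eqI[OF mk])
    fix u assume "u \<in> keys ?f" "u \<noteq> m"
    then have "u \<in> keys (X ?x * g)" using keys_add[of "X m" "X ?x * g"] by auto
    from kg[OF this] show "drl_less u m" using m by (intro drl_less_last_varI[of u m n]) auto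
  qed
qed

section \<open>Leading monomials of the annihilator\<close>

definition mons :: "nat \<Rightarrow> nat \<Rightarrow> mon set" where
  "mons n s = {m \<in> monomials n. mdeg m = s}"

text \<open>
  On the quotient by the annihilator, this says that \<open>x\<^sub>n\<close> is a strong Lefschetz element.
\<close>

definition lefschetz :: "nat \<Rightarrow> nat \<Rightarrow> (mon \<Rightarrow> 'a::field) \<Rightarrow> bool" where
  "lefschetz n e L \<longleftrightarrow> (\<forall>s. 2 * s \<le> e \<longrightarrow>
     (\<forall>f\<in>forms n (int s). (\<forall>v\<in>mons n s. pairing L f (Poly_Mapping.single n (e - 2 * s) + v) = 0) \<longrightarrow> f = 0) \<and>
     (\<forall>r. \<exists>f\<in>forms n (int s). \<forall>v\<in>mons n s. pairing L f (Poly_Mapping.single n (e - 2 * s) + v) = r v))"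

lemma lead_mon_annihilator:
  assumes n: "1 \<le> n" and L: "\<And>u. L u \<noteq> 0 \<Longrightarrow> u \<in> monomials n \<and> mdeg u = e" and lef: "lefschetz n e L"
  shows "{lead_mon f | f. f \<in> {f \<in> polys n. \<forall>v\<in>monomials n. pairing L f v = 0} \<and> f \<noteq> 0}
    = {m \<in> monomials n. e + lookup m n < 2 * mdeg m}" (is "{_ | f. f \<in> ?A \<and> _} = ?J")
proof (intro equalityI subsetI)
  have inj: "f = 0" if "2 * s \<le> e" "f \<in> forms n (int s)"
    "\<And>v. v \<in> mons n s \<Longrightarrow> pairing L f (Poly_Mapping.single n (e - 2 * s) + v) = 0" for f s
    using lef that unfolding lefschetz_def by blast
  fix m assume "m \<in> {lead_mon f | f. f \<in> ?A \<and> f \<noteq> 0}"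
  then obtain f where f: "f \<in> polys n" "\<And>v. v \<in> monomials n \<Longrightarrow> pairing L f v = 0" "f \<noteq> 0" "m = lead_mon f" by blast
  note lm = lead_mon[OF f(3), folded f(4)]
  have mm: "m \<in> monomials n" using lm(1) f(1) by (auto simp: polys_def)
  have "e + lookup m n < 2 * mdeg m"
  proof (rule ccontr)
    assume neg: "\<not> e + lookup m n < 2 * mdeg m"
    define t where "t = mdeg m"
    have t: "2 * t \<le> e + lookup m n" "t \<le> e" using neg lookup_le_mdeg[of m n] by (auto simp: t_def)
    \<comment> \<open>Because \<open>L\<close> is supported in degree \<open>e\<close>, the part of
      degree \<open>t\<close> still pairs to zero with all monomials of degree \<open>e - t\<close>,
      and it contains \<open>m\<close>.\<close>
    define ft where "ft = hcomp (int t) f"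
    have ftf: "ft \<in> forms n (int t)" unfolding ft_def by (rule hcomp_forms[OF f(1)])
    have mft: "m \<in> keys ft" using lm(1) by (simp add: ft_def keys_hcomp t_def)
    have pft: "pairing L ft v = 0" if v: "v \<in> monomials n" "mdeg v = e - t" for v
    proof -
      have "pairing L ft v = (\<Sum>u\<in>keys f. lookup ft u * L (u + v))"
        by (rule pairing_superset) (auto simp: ft_def keys_hcomp)
      also have "\<dots> = pairing L f v"
        unfolding pairing_def
      proof (rule sum.cong)
        fix u
        have "L (u + v) = 0" if "mdeg u \<noteq> t" using L[of "u + v"] that v t by force
        then show "lookup ft u * L (u + v) = lookup f u * L (u + v)" by (auto simp: ft_def lookup_hcomp)
      qed simp
      finally show ?thesis using f(2)[OF v(1)] by simp
    qed
    show False
    proof (cases "e \<le> 2 * t")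
      case True
      \<comment> \<open>Division of \<open>ft\<close> by \<open>x_n^(2t - e)\<close> gives a form
        \<open>g\<close> of degree \<open>s = e - t\<close>, and pairing \<open>g\<close> with
        \<open>x_n^(2t - e) v\<close> is pairing \<open>ft\<close> with \<open>v\<close>.\<close>
      define s where "s = e - t"
      have s: "2 * s \<le> e" "e - 2 * s = 2 * t - e" "t = (2 * t - e) + s" using True t by (auto simp: s_def)
      \<comment> \<open>Terms of \<open>ft\<close> are not larger than \<open>m\<close>, so they
        contain at least the power of \<open>x_n\<close> in \<open>m\<close>, whose exponent is at
        least \<open>2 * t - e\<close> by the inequality assumed for contradiction.\<close>
      have "2 * t - e \<le> lookup u n" if u: "u \<in> keys ft" for u
      proof -
        have u': "u \<in> keys f" "mdeg u = mdeg m" "u \<in> monomials n" using u ftf by (auto simp: ft_def keys_hcomp t_def forms_def polys_def)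
        have "lookup m n \<le> lookup u n"
        proof (cases "u = m")
          case False
          then show ?thesis using drl_less_last_var[OF lm(2)[OF u'(1)] u'(2,3) mm] by simp
        qed simp
        then show ?thesis using t by simp
      qed
      then obtain g where g: "g \<in> polys n" "ft = X (Poly_Mapping.single n (2 * t - e)) * g"
        using exists_X_factor[OF forms_polys[OF ftf]] by blast
      have "g \<in> forms n (int s)"
      proof (rule formsI[OF g(1)])
        fix u assume "u \<in> keys g"
        then have "Poly_Mapping.single n (2 * t - e) + u \<in> keys ft" by (simp add: g(2) keys_X_mult)
        then have "int (mdeg (Poly_Mapping.single n (2 * t - e) + u)) = int t" using ftf unfolding forms_def by blast
        then show "int (mdeg u) = int s" using s(3) by simp
      qed
      moreover have "pairing L g (Poly_Mapping.single n (e - 2 * s) + v) = 0" if "v \<in> mons n s" for v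
        using pft[of v] that s(2) unfolding g(2) pairing_X_mult by (simp add: mons_def s_def)
      ultimately have "g = 0" by (intro inj[OF s(1)])
      then show False using mft g(2) by simp
    next
      case False
      \<comment> \<open>Below the middle degree injectivity applies to \<open>ft\<close> itself, and
        the power of \<open>x_n\<close> is part of the monomial it is paired with.\<close>
      have "ft = 0"
      proof (rule inj[OF _ ftf])
        show "pairing L ft (Poly_Mapping.single n (e - 2 * t) + v) = 0" if "v \<in> mons n t" for v
          using that False n by (intro pft) (auto simp: mons_def monomials_single)
      qed (use False in simp)
      then show False using mft by simp
    qed
  qed
  then show "m \<in> ?J" using mm by simp
next
  fix m assume "m \<in> ?J"
  then have m: "m \<in> monomials n" "e + lookup m n < 2 * mdeg m" by auto
  show "m \<in> {lead_mon f | f. f \<in> ?A \<and> f \<noteq> 0}"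
  proof (cases "mdeg m > e")
    case True
    have "L (m + v) = 0" for v using L[of "m + v"] True by force
    then have "X m \<in> ?A" using m by (simp add: pairing_X)
    moreover have "m = lead_mon (X m :: 'a mpoly)" by (intro lead_mon_eqI[symmetric]) auto
    moreover have "(X m :: 'a mpoly) \<noteq> 0" by (metis keys_X keys_zero insert_not_empty)
    ultimately show ?thesis by blast
  next
    case False
    \<comment> \<open>\<open>s\<close> is complementary to the degree of \<open>m\<close>, and
      \<open>e - 2 * s = 2 * mdeg m - e\<close>. The prescribed values \<open>- L (m + v)\<close>
      make \<open>m + x_n^(e - 2s) g\<close> pair to zero with monomials of degree \<open>s\<close>;
      with those of other degrees it does so because \<open>L\<close> is supported in degree
      \<open>e\<close>.\<close>
    define s where "s = e - mdeg m"
    have s: "2 * s \<le> e" "mdeg m = (e - 2 * s) + s" "lookup m n < e - 2 * s"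
      using False m by (auto simp: s_def)
    let ?x = "Poly_Mapping.single n (e - 2 * s)"
    obtain g where g: "g \<in> forms n (int s)" "\<And>v. v \<in> mons n s \<Longrightarrow> pairing L g (?x + v) = - L (m + v)"
      using lef s(1) unfolding lefschetz_def by meson
    define f where "f = X m + X ?x * g"
    have "X ?x \<in> polys n" using n by (simp add: monomials_single)
    then have fp: "f \<in> polys n"
      unfolding f_def using forms_polys[OF g(1)] m(1) by (intro polys_add polys_mult) simp_all
    have "pairing L f v = 0" if v: "v \<in> monomials n" for v
    proof (cases "mdeg v = s")
      case True
      then show ?thesis using g(2)[of v] v by (simp add: f_def pairing_add pairing_X pairing_X_mult mons_def)
    next
      case False
      have "L (u + v) = 0" if "u \<in> keys f" for u
      proof -
        have "mdeg u = mdeg m"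
          using that keys_add[of "X m" "X ?x * g"] g(1) s(2) by (auto simp: f_def keys_X_mult forms_def)
        then show ?thesis using L[of "u + v"] False s by force
      qed
      then show ?thesis by (simp add: pairing_def)
    qed
    then have "f \<in> ?A" using fp by simp
    moreover have "lead_mon f = m" "f \<noteq> 0" unfolding f_def using lead_mon_X_plus[OF m(1) g(1) s(2,3) n] by auto
    ultimately show ?thesis by blast
  qed
qed

section \<open>Genericity\<close>

lemma poly_value_superset:
  "finite A \<Longrightarrow> keys P \<subseteq> A \<Longrightarrow> poly_value c P = (\<Sum>m\<in>A. lookup P m * (\<Prod>v\<in>keys m. c v ^ lookup m v))"
  unfolding poly_value_def by (rule sum.mono_neutral_left) (auto simp: in_keys_iff)

lemma mon_value_superset:
  "finite A \<Longrightarrow> keys m \<subseteq> A \<Longrightarrow> (\<Prod>v\<in>keys m. (c v :: 'a::field) ^ lookup m v) = (\<Prod>v\<in>A. c v ^ lookup m v)"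
  by (rule prod.mono_neutral_left) (auto simp: in_keys_iff)

lemma mon_value_add:
  fixes m m' :: "'v \<Rightarrow>\<^sub>0 nat" and c :: "'v \<Rightarrow> 'a::field"
  shows "(\<Prod>v\<in>keys (m + m'). c v ^ lookup (m + m') v) = (\<Prod>v\<in>keys m. c v ^ lookup m v) * (\<Prod>v\<in>keys m'. c v ^ lookup m' v)"
  using mon_value_superset[of "keys m \<union> keys m'" m c] mon_value_superset[of "keys m \<union> keys m'" m' c]
    mon_value_superset[of "keys m \<union> keys m'" "m + m'" c] keys_add[of m m']
  by (simp add: lookup_add power_add prod.distrib)

lemma poly_value_add: "poly_value c (P + Q) = poly_value c P + poly_value c Q"
  using poly_value_superset[of "keys P \<union> keys Q" P c] poly_value_superset[of "keys P \<union> keys Q" Q c]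
    poly_value_superset[of "keys P \<union> keys Q" "P + Q" c] keys_add[of P Q]
  by (simp add: lookup_add distrib_right sum.distrib)

lemma poly_value_0: "poly_value c 0 = 0"
  by (simp add: poly_value_def)

lemma poly_value_sum: "poly_value c (sum P A) = (\<Sum>x\<in>A. poly_value c (P x))"
  by (induction A rule: infinite_finite_induct) (simp_all add: poly_value_add poly_value_0)

lemma poly_value_single: "poly_value c (Poly_Mapping.single m a) = a * (\<Prod>v\<in>keys m. c v ^ lookup m v)"
  by (cases "a = 0") (simp_all add: poly_value_def)

lemma poly_value_mult: "poly_value c (P * Q) = poly_value c P * poly_value c Q"
proof -
  let ?s = "\<lambda>P m. Poly_Mapping.single m (lookup P m)"
  have "P * Q = (\<Sum>m\<in>keys P. ?s P m) * (\<Sum>m\<in>keys Q. ?s Q m)"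
    by (simp add: poly_mapping_sum_single)
  also have "\<dots> = (\<Sum>m\<in>keys P. \<Sum>m'\<in>keys Q. Poly_Mapping.single (m + m') (lookup P m * lookup Q m'))"
    by (simp add: sum_product mult_single)
  finally have "poly_value c (P * Q) = (\<Sum>m\<in>keys P. \<Sum>m'\<in>keys Q. poly_value c (Poly_Mapping.single (m + m') (lookup P m * lookup Q m')))"
    by (simp add: poly_value_sum)
  also have "\<dots> = poly_value c P * poly_value c Q"
    unfolding poly_value_single mon_value_add by (simp add: poly_value_def sum_product mult_ac)
  finally show ?thesis .
qed

lemma poly_value_1: "poly_value c 1 = 1"
  using poly_value_single[of c 0 1] by simp

lemma poly_value_hom: "comm_ring_hom (poly_value c)"
  by unfold_locales (simp_all add: poly_value_0 poly_value_1 poly_value_add poly_value_mult)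

lemma poly_value_prod: "poly_value c (prod P A) = (\<Prod>x\<in>A. poly_value c (P x))"
  by (induction A rule: infinite_finite_induct) (simp_all add: poly_value_mult poly_value_1)

text \<open>\<open>generic_form\<close> demands a polynomial in the coefficients at monomials of
  degree \<open>e\<close> only; this set is closed under the operations that form a
  determinant.\<close>

definition polys_in :: "'v set \<Rightarrow> (('v \<Rightarrow>\<^sub>0 nat) \<Rightarrow>\<^sub>0 'a::field) set" where
  "polys_in V = {P. \<forall>m\<in>keys P. keys m \<subseteq> V}"

lemma polys_in_0: "0 \<in> polys_in V"
  by (simp add: polys_in_def)

lemma polys_in_add: "P \<in> polys_in V \<Longrightarrow> Q \<in> polys_in V \<Longrightarrow> P + Q \<in> polys_in V"
  using keys_add[of P Q] by (auto simp: polys_in_def)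

lemma polys_in_uminus: "P \<in> polys_in V \<Longrightarrow> - P \<in> polys_in V"
  by (simp add: polys_in_def keys_uminus_field)

lemma polys_in_mult: "P \<in> polys_in V \<Longrightarrow> Q \<in> polys_in V \<Longrightarrow> P * Q \<in> polys_in V"
proof -
  assume PQ: "P \<in> polys_in V" "Q \<in> polys_in V"
  have "keys m \<subseteq> V" if "m \<in> keys (P * Q)" for m
  proof -
    obtain a b where "m = a + b" "a \<in> keys P" "b \<in> keys Q" using keys_mult[of P Q] \<open>m \<in> keys (P * Q)\<close> by blast
    then show ?thesis using PQ keys_add[of a b] unfolding polys_in_def by blast
  qed
  then show ?thesis by (simp add: polys_in_def)
qed

lemma polys_in_sum: "(\<And>x. x \<in> A \<Longrightarrow> P x \<in> polys_in V) \<Longrightarrow> sum P A \<in> polys_in V"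
  by (induction A rule: infinite_finite_induct) (auto intro: polys_in_add polys_in_0)

lemma polys_in_1: "1 \<in> polys_in V"
  by (simp add: polys_in_def)

lemma polys_in_prod: "(\<And>x. x \<in> A \<Longrightarrow> P x \<in> polys_in V) \<Longrightarrow> prod P A \<in> polys_in V"
  by (induction A rule: infinite_finite_induct) (auto intro: polys_in_mult polys_in_1)

lemma polys_in_det:
  assumes A: "A \<in> carrier_mat k k" and e: "\<And>i j. i < k \<Longrightarrow> j < k \<Longrightarrow> A $$ (i, j) \<in> polys_in V"
  shows "det A \<in> polys_in V"
proof -
  have "signof p * (\<Prod>i = 0..<k. A $$ (i, p i)) \<in> polys_in V" if p: "p permutes {0..<k}" for p
  proof -
    have "p i < k" if "i < k" for i using permutes_in_image[OF p, of i] that by simp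
    then have "(\<Prod>i = 0..<k. A $$ (i, p i)) \<in> polys_in V" by (intro polys_in_prod e) auto
    then show ?thesis by (cases "sign p = 1") (auto simp: sign_def polys_in_uminus)
  qed
  then show ?thesis unfolding det_def'[OF A] by (intro polys_in_sum) auto
qed

text \<open>
  The sum of the squared lengths of the exponent vectors is the same for both products, and the
  difference of the two sums is the sum of all \<open>\<bar>ms i - ms (p i)\<bar>\<^sup>2\<close>.
\<close>

lemma diagonal_product_unique:
  fixes ms :: "nat \<Rightarrow> mon"
  assumes p: "p permutes {0..<k}" and inj: "inj_on ms {0..<k}" and mon: "\<And>i. i < k \<Longrightarrow> ms i \<in> monomials n"
    and eq: "(\<Sum>i = 0..<k. Poly_Mapping.single (c + ms i + ms (p i)) (1::nat)) =
      (\<Sum>i = 0..<k. Poly_Mapping.single (c + ms i + ms i) 1)"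
  shows "p = id"
proof -
  define q :: "mon \<Rightarrow> int" where "q u = (\<Sum>j\<in>{1..n}. int (lookup u j) ^ 2)" for u
  \<comment> \<open>\<open>K\<close> encodes a multiset of monomials by multiplicities;
    \<open>Q\<close> adds up their squared lengths, so equal products give equal numbers.\<close>
  define Q :: "(mon \<Rightarrow>\<^sub>0 nat) \<Rightarrow> int" where "Q K = (\<Sum>u\<in>keys K. int (lookup K u) * q u)" for K
  have Qsup: "Q K = (\<Sum>u\<in>A. int (lookup K u) * q u)" if "finite A" "keys K \<subseteq> A" for K A
    unfolding Q_def using that by (intro sum.mono_neutral_left) (auto simp: in_keys_iff)
  have Qadd: "Q (K + K') = Q K + Q K'" for K K'
    using Qsup[of "keys K \<union> keys K'" K] Qsup[of "keys K \<union> keys K'" K'] Qsup[of "keys K \<union> keys K'" "K + K'"] keys_add[of K K']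
    by (simp add: lookup_add distrib_right sum.distrib)
  have Qsum: "Q (sum f A) = (\<Sum>x\<in>A. Q (f x))" for f :: "nat \<Rightarrow> _" and A
    by (induction A rule: infinite_finite_induct) (simp_all add: Qadd, simp_all add: Q_def)
  have Q1: "Q (Poly_Mapping.single u 1) = q u" for u by (simp add: Q_def)
  let ?l = "\<lambda>i j. int (lookup (ms i) j)"
  \<comment> \<open>With \<open>a = ms i\<close> and \<open>b = ms (p i)\<close>, we have
    \<open>|c + 2a|^2 - |c + a + b|^2 = |a - b|^2 + r(a) - r(b)\<close> for
    \<open>r(a) = 2|a|^2 + 2 c.a\<close>; the \<open>r\<close> terms cancel in the sum because
    \<open>p\<close> is a permutation.\<close>
  define r where "r i = (\<Sum>j\<in>{1..n}. 2 * ?l i j ^ 2 + 2 * int (lookup c j) * ?l i j)" for i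
  define D where "D i = (\<Sum>j\<in>{1..n}. (?l i j - ?l (p i) j) ^ 2)" for i
  have diff: "q (c + ms i + ms i) = q (c + ms i + ms (p i)) + D i + r i - r (p i)" for i
    unfolding q_def D_def r_def sum.distrib[symmetric] sum_subtractf[symmetric]
    by (intro sum.cong) (auto simp: lookup_add power2_eq_square algebra_simps)
  have "(\<Sum>i = 0..<k. q (c + ms i + ms (p i))) = (\<Sum>i = 0..<k. q (c + ms i + ms i))"
    using arg_cong[OF eq, of Q] unfolding Qsum Q1 .
  also have "\<dots> = (\<Sum>i = 0..<k. q (c + ms i + ms (p i))) + (\<Sum>i = 0..<k. D i) + (\<Sum>i = 0..<k. r i) - (\<Sum>i = 0..<k. r (p i))"
    unfolding diff by (simp add: sum.distrib sum_subtractf)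
  also have "(\<Sum>i = 0..<k. r (p i)) = (\<Sum>i = 0..<k. r i)"
    using sum.permute[OF p, of r] by (simp add: comp_def)
  finally have "(\<Sum>i = 0..<k. D i) = 0" by simp
  then have D0: "D i = 0" if "i < k" for i
    using sum_nonneg_eq_0_iff[of "{0..<k}" D] that by (simp add: D_def sum_nonneg)
  show "p = id"
  proof
    fix i
    show "p i = id i"
    proof (cases "i < k")
      case True
      then have pi: "p i < k" using permutes_in_image[OF p, of i] by simp
      have "(?l i j - ?l (p i) j) ^ 2 = 0" if "j \<in> {1..n}" for j
        using D0[OF True] that unfolding D_def by (subst (asm) sum_nonneg_eq_0_iff) auto
      then have "lookup (ms i) j = lookup (ms (p i)) j" for j
        using monomials_lookup_0[OF mon[OF True], of j] monomials_lookup_0[OF mon[OF pi], of j] by (cases "j \<in> {1..n}") auto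
      then have "ms i = ms (p i)" by (intro poly_mapping_eqI) auto
      then show ?thesis using inj True pi by (auto simp: inj_on_def)
    next
      case False
      then show ?thesis using permutes_not_in[OF p, of i] by simp
    qed
  qed
qed

section \<open>Determinants of the pairing\<close>

lemma prod_single:
  "(\<Prod>i\<in>A. Poly_Mapping.single (f i) (a i :: 'a::comm_semiring_1)) =
    Poly_Mapping.single (\<Sum>i\<in>A. f i :: 'b::comm_monoid_add) (\<Prod>i\<in>A. a i)"
  by (induction A rule: infinite_finite_induct) (simp_all add: mult_single)

text \<open>The variable is prescaled so that evaluation at the coefficients of \<open>G\<close>
  produces \<open>scaled G\<close> rather than \<open>lookup G\<close>.\<close>

definition gen_var :: "mon \<Rightarrow> (mon \<Rightarrow>\<^sub>0 nat) \<Rightarrow>\<^sub>0 'a::field" where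
  "gen_var u = Poly_Mapping.single (Poly_Mapping.single u 1) (act_factor u)"

lemma poly_value_gen_var: "poly_value (lookup G) (gen_var u) = scaled G u"
  by (simp add: gen_var_def poly_value_single scaled_def)

text \<open>For \<open>c = x_n^(e - 2s)\<close> and \<open>ms\<close> listing the monomials of
  degree \<open>s\<close>, this is the Gram matrix of the pairing
  \<open>(f, g) -> c f g\<close>.\<close>

definition hankel :: "nat \<Rightarrow> (nat \<Rightarrow> mon) \<Rightarrow> mon \<Rightarrow> (mon \<Rightarrow> 'b) \<Rightarrow> 'b mat" where
  "hankel k ms c L = mat k k (\<lambda>(i, j). L (c + ms i + ms j))"

lemma hankel_carrier [simp]: "hankel k ms c L \<in> carrier_mat k k"
  by (simp add: hankel_def)

text \<open>At the monomial of the diagonal product only the identity permutation contributes, and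
  its coefficient is a product of nonzero values of \<open>act_factor\<close>; this holds in every
  characteristic.\<close>

lemma det_hankel_gen_var_nonzero:
  fixes ms :: "nat \<Rightarrow> mon"
  assumes inj: "inj_on ms {0..<k}" and mon: "\<And>i. i < k \<Longrightarrow> ms i \<in> monomials n"
  shows "det (hankel k ms c (gen_var :: mon \<Rightarrow> (mon \<Rightarrow>\<^sub>0 nat) \<Rightarrow>\<^sub>0 'a::field)) \<noteq> 0"
proof -
  let ?H = "hankel k ms c (gen_var :: mon \<Rightarrow> (mon \<Rightarrow>\<^sub>0 nat) \<Rightarrow>\<^sub>0 'a)"
  let ?K = "\<lambda>p. \<Sum>i = 0..<k. Poly_Mapping.single (c + ms i + ms (p i)) (1::nat)"
  let ?a = "\<lambda>p. \<Prod>i = 0..<k. act_factor (c + ms i + ms (p i)) :: 'a"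
  have "lookup (signof p * (\<Prod>i = 0..<k. ?H $$ (i, p i))) (?K id) = (if p = id then ?a id else 0)"
    if p: "p permutes {0..<k}" for p
  proof -
    have "p i < k" if "i < k" for i using permutes_in_image[OF p, of i] that by simp
    then have "(\<Prod>i = 0..<k. ?H $$ (i, p i)) = (\<Prod>i = 0..<k. gen_var (c + ms i + ms (p i)))"
      by (intro prod.cong) (auto simp: hankel_def)
    also have "\<dots> = Poly_Mapping.single (?K p) (?a p)"
      unfolding gen_var_def by (rule prod_single)
    finally have e: "(\<Prod>i = 0..<k. ?H $$ (i, p i)) = Poly_Mapping.single (?K p) (?a p)" .
    show ?thesis
    proof (cases "p = id")
      case True
      then show ?thesis unfolding e by simp
    next
      case False
      then have "?K p \<noteq> ?K id" using diagonal_product_unique[OF p inj mon] by auto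
      then show ?thesis using False unfolding e
        by (cases "sign p = 1") (auto simp: sign_def lookup_single when_def)
    qed
  qed
  then have "lookup (det ?H) (?K id) = (\<Sum>p | p permutes {0..<k}. if p = id then ?a id else 0)"
    unfolding det_def'[OF hankel_carrier] lookup_sum by (intro sum.cong) auto
  also have "\<dots> = ?a id"
    by (simp add: finite_permutations permutes_id)
  also have "\<dots> \<noteq> 0" by (simp add: act_factor_nonzero)
  finally show ?thesis by auto
qed

definition mon_enum :: "nat \<Rightarrow> nat \<Rightarrow> nat \<Rightarrow> mon" where
  "mon_enum n s = (SOME f. bij_betw f {0..<card (mons n s)} (mons n s))"

lemma mon_enum: "bij_betw (mon_enum n s) {0..<card (mons n s)} (mons n s)"
proof -
  have "finite (mons n s)" unfolding mons_def by (rule finite_monomials_mdeg)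
  then show ?thesis unfolding mon_enum_def by (rule someI_ex[OF ex_bij_betw_nat_finite])
qed

text \<open>The matrix is square, so a nonzero determinant gives injectivity through the kernel and
  surjectivity through the inverse.\<close>

lemma lefschetz_if_det:
  fixes L :: "mon \<Rightarrow> 'a::field"
  assumes det: "\<And>s. 2 * s \<le> e \<Longrightarrow>
    det (hankel (card (mons n s)) (mon_enum n s) (Poly_Mapping.single n (e - 2 * s)) L) \<noteq> 0"
  shows "lefschetz n e L"
  unfolding lefschetz_def
proof (intro allI impI conjI ballI)
  fix s assume s: "2 * s \<le> e"
  define k where "k = card (mons n s)"
  define ms where "ms = mon_enum n s"
  define c where "c = Poly_Mapping.single n (e - 2 * s)"
  have b: "bij_betw ms {0..<k} (mons n s)" unfolding ms_def k_def by (rule mon_enum)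
  have fin: "finite (mons n s)" unfolding mons_def by (rule finite_monomials_mdeg)
  let ?H = "hankel k ms c L"
  have dH: "det ?H \<noteq> 0" using det[OF s] by (simp add: k_def ms_def c_def)
  \<comment> \<open>Applied to the coefficient vector of \<open>f\<close>, the matrix lists the
    pairings of \<open>f\<close> with \<open>c\<close> times the basis monomials.\<close>
  have row: "(?H *\<^sub>v vec k (\<lambda>j. lookup f (ms j))) $ i = pairing L f (c + ms i)"
    if f: "f \<in> forms n (int s)" and i: "i < k" for f i
  proof -
    have "keys f \<subseteq> mons n s" using f by (auto simp: forms_def polys_def mons_def)
    then have "pairing L f (c + ms i) = (\<Sum>m\<in>mons n s. lookup f m * L (m + (c + ms i)))"
      by (rule pairing_superset[OF fin])
    also have "\<dots> = (\<Sum>j\<in>{0..<k}. lookup f (ms j) * L (ms j + (c + ms i)))"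
      by (rule sum.reindex_bij_betw[OF b, symmetric])
    finally show ?thesis using i
      by (simp add: hankel_def scalar_prod_def add_ac mult.commute)
  qed
  {
    fix f :: "'a mpoly" assume f: "f \<in> forms n (int s)"
      and z: "\<forall>v\<in>mons n s. pairing L f (Poly_Mapping.single n (e - 2 * s) + v) = 0"
    let ?v = "vec k (\<lambda>j. lookup f (ms j))"
    have "?H *\<^sub>v ?v = 0\<^sub>v k"
    proof (rule eq_vecI)
      fix i assume "i < dim_vec (0\<^sub>v k :: 'a vec)"
      then have i: "i < k" by simp
      then have "ms i \<in> mons n s" using bij_betw_apply[OF b, of i] by simp
      then show "(?H *\<^sub>v ?v) $ i = 0\<^sub>v k $ i" using row[OF f i] z i by (simp add: c_def)
    qed (simp add: hankel_def)
    then have v0: "?v = 0\<^sub>v k" using dH det_0_iff_vec_prod_zero_field[OF hankel_carrier, of k ms c L] vec_carrier[of k] by blast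
    show "f = 0"
    proof (rule poly_mapping_eqI)
      fix m
      show "lookup f m = lookup 0 m"
      proof (cases "m \<in> mons n s")
        case True
        then obtain j where "j < k" "m = ms j" using bij_betw_imp_surj_on[OF b] by (metis atLeastLessThan_iff imageE)
        then show ?thesis using arg_cong[OF v0, of "\<lambda>v. vec_index v j"] by simp
      next
        case False
        then have "m \<notin> keys f" using f by (auto simp: forms_def polys_def mons_def)
        then show ?thesis by (simp add: in_keys_iff)
      qed
    qed
  }
  fix r :: "mon \<Rightarrow> 'a"
  obtain B where B: "B \<in> carrier_mat k k" "?H * B = 1\<^sub>m k"
    using det_non_zero_imp_unit[OF hankel_carrier dH, of "()"] by (auto simp: Units_def ring_mat_def)
  define x where "x = B *\<^sub>v vec k (\<lambda>i. r (ms i))"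
  have xc: "x \<in> carrier_vec k" using B by (auto simp: x_def intro!: carrier_vecI)
  have Hx: "?H *\<^sub>v x = vec k (\<lambda>i. r (ms i))"
    unfolding x_def using assoc_mult_mat_vec[OF hankel_carrier B(1), of "vec k (\<lambda>i. r (ms i))" ms c L] B(2) by simp
  define f where "f = (\<Sum>j = 0..<k. Poly_Mapping.single (ms j) (x $ j))"
  have lf: "lookup f (ms j) = x $ j" if "j < k" for j
  proof -
    have "lookup f (ms j) = (\<Sum>i = 0..<k. if i = j then x $ i else 0)"
      unfolding f_def lookup_sum
    proof (rule sum.cong)
      fix i assume "i \<in> {0..<k}"
      then have "ms i = ms j \<longleftrightarrow> i = j" using inj_on_eq_iff[OF bij_betw_imp_inj_on[OF b], of i j] that by simp
      then show "lookup (Poly_Mapping.single (ms i) (x $ i)) (ms j) = (if i = j then x $ i else 0)"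
        by (auto simp: lookup_single when_def)
    qed simp
    then show ?thesis using that by simp
  qed
  have ff: "f \<in> forms n (int s)"
    unfolding f_def
  proof (intro forms_sum)
    fix j assume "j \<in> {0..<k}"
    then have "ms j \<in> mons n s" by (rule bij_betw_apply[OF b])
    then show "Poly_Mapping.single (ms j) (x $ j) \<in> forms n (int s)"
      by (auto simp: forms_def polys_def mons_def)
  qed
  have vx: "vec k (\<lambda>j. lookup f (ms j)) = x" using lf xc by (intro eq_vecI) auto
  have "pairing L f (c + v) = r v" if v: "v \<in> mons n s" for v
  proof -
    obtain i where i: "i < k" "v = ms i"
      using bij_betw_imp_surj_on[OF b] v by (metis atLeastLessThan_iff imageE)
    show ?thesis using row[OF ff i(1)] i unfolding vx Hx by simp
  qed
  then show "\<exists>f\<in>forms n (int s). \<forall>v\<in>mons n s. pairing L f (Poly_Mapping.single n (e - 2 * s) + v) = r v"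
    using ff by (auto simp: c_def)
qed

text \<open>One polynomial must serve all \<open>s <= e/2\<close> at once: the product of the
  determinants, nonzero because the polynomial ring has no zero divisors.\<close>

lemma generic_lefschetz:
  assumes n: "1 \<le> n"
  shows "generic_form n e (\<lambda>G :: 'a::field mpoly. lefschetz n e (scaled G))"
proof -
  let ?H = "\<lambda>s L. hankel (card (mons n s)) (mon_enum n s) (Poly_Mapping.single n (e - 2 * s)) L"
  define P :: "(mon \<Rightarrow>\<^sub>0 nat) \<Rightarrow>\<^sub>0 'a" where "P = (\<Prod>s\<in>{..e div 2}. det (?H s gen_var))"
  have me: "mon_enum n s i \<in> monomials n" "mdeg (mon_enum n s i) = s" if "i < card (mons n s)" for i s
    using bij_betw_apply[OF mon_enum[of n s], of i] that by (simp_all add: mons_def)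
  have "det (?H s (gen_var :: mon \<Rightarrow> (mon \<Rightarrow>\<^sub>0 nat) \<Rightarrow>\<^sub>0 'a)) \<noteq> 0" for s
    by (rule det_hankel_gen_var_nonzero[OF bij_betw_imp_inj_on[OF mon_enum] me(1)])
  then have P0: "P \<noteq> 0" by (simp add: P_def)
  have "P \<in> polys_in {u \<in> monomials n. mdeg u = e}"
    unfolding P_def
  proof (intro polys_in_prod polys_in_det[OF hankel_carrier])
    fix s i j assume "s \<in> {..e div 2}" "i < card (mons n s)" "j < card (mons n s)"
    then show "?H s gen_var $$ (i, j) \<in> polys_in {u \<in> monomials n. mdeg u = e}"
      using me[of i s] me[of j s] n
      by (auto simp: hankel_def polys_in_def gen_var_def act_factor_nonzero monomials_single)
  qed
  moreover have "lefschetz n e (scaled G)" if "poly_value (lookup G) P \<noteq> 0" for G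
  proof (rule lefschetz_if_det)
    fix s assume "2 * s \<le> e"
    then have "s \<in> {..e div 2}" by simp
    then have "poly_value (lookup G) (det (?H s gen_var)) \<noteq> 0"
      using that unfolding P_def poly_value_prod by simp
    moreover have "map_mat (poly_value (lookup G)) (?H s gen_var) = ?H s (scaled G)"
      by (intro eq_matI) (auto simp: hankel_def poly_value_gen_var)
    ultimately show "det (?H s (scaled G)) \<noteq> 0"
      using comm_ring_hom.hom_det[OF poly_value_hom, of "lookup G" "?H s gen_var"] by simp
  qed
  ultimately show ?thesis
    unfolding generic_form_def polys_in_def using P0 by (intro exI[of _ P]) auto
qed

section \<open>The initial ideal\<close>

text \<open>\<open>c = 2\<close> gives the initial ideal and \<open>c = 1\<close> the powers of the
  maximal ideal, so the results on weights cover both sides of the comparison of Betti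
  numbers.\<close>

definition last_wt :: "nat \<Rightarrow> nat \<Rightarrow> nat \<Rightarrow> nat" where
  "last_wt n c i = (if i < n then c else 1)"

definition rest :: "nat \<Rightarrow> mon \<Rightarrow> mon" where
  "rest n m = m - Poly_Mapping.single n (lookup m n)"

lemma lookup_rest: "lookup (rest n m) i = (if i = n then 0 else lookup m i)"
  by (simp add: rest_def lookup_minus lookup_single when_def)

lemma rest_split: "m = rest n m + Poly_Mapping.single n (lookup m n)"
  by (rule poly_mapping_eqI) (simp add: lookup_add lookup_rest lookup_single when_def)

lemma mdeg_rest: "mdeg m = mdeg (rest n m) + lookup m n"
  using arg_cong[OF rest_split[of m n], of mdeg] by simp

lemma rest_monomials: "m \<in> monomials n \<Longrightarrow> rest n m \<in> monomials (n - 1)"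
  unfolding monomials_def
proof
  assume "m \<in> {m. keys m \<subseteq> {1..n}}"
  moreover have "i \<in> keys m \<and> i \<noteq> n" if "i \<in> keys (rest n m)" for i
    using that by (simp add: in_keys_iff lookup_rest split: if_splits)
  ultimately have "i \<in> {1..n} - {n}" if "i \<in> keys (rest n m)" for i
    using that by blast
  then show "keys (rest n m) \<subseteq> {1..n - 1}" by force
qed

lemma monomials_mono: "m \<in> monomials i \<Longrightarrow> i \<le> n \<Longrightarrow> m \<in> monomials n"
  by (auto simp: monomials_def subset_iff)

lemma lookup_last_pred: "1 \<le> n \<Longrightarrow> r \<in> monomials (n - 1) \<Longrightarrow> lookup r n = 0"
  by (rule monomials_lookup_0) auto

lemma rest_add_single: "1 \<le> n \<Longrightarrow> r \<in> monomials (n - 1) \<Longrightarrow> rest n (r + Poly_Mapping.single n k) = r"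
  using lookup_last_pred[of n r]
  by (intro poly_mapping_eqI) (auto simp: lookup_rest lookup_add lookup_single when_def)

lemma wt_last_wt:
  assumes "1 \<le> n"
  shows "wt n (last_wt n c) m = c * (\<Sum>i\<in>{1..n - 1}. lookup m i) + lookup m n"
proof -
  have "{1..n} = insert n {1..n - 1}" using assms by auto
  then have "wt n (last_wt n c) m = last_wt n c n * lookup m n + (\<Sum>i\<in>{1..n - 1}. last_wt n c i * lookup m i)"
    unfolding wt_def using assms by simp
  also have "(\<Sum>i\<in>{1..n - 1}. last_wt n c i * lookup m i) = c * (\<Sum>i\<in>{1..n - 1}. lookup m i)"
    unfolding sum_distrib_left using assms by (intro sum.cong) (auto simp: last_wt_def)
  finally show ?thesis using last_wt_def[of n c n] by simp
qed

lemma mdeg_rest_sum: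
  assumes "m \<in> monomials n"
  shows "mdeg (rest n m) = (\<Sum>i\<in>{1..n - 1}. lookup m i)"
  unfolding mdeg_sum_monomial[OF rest_monomials[OF assms]]
  by (intro sum.cong) (auto simp: lookup_rest)

lemma wt_last_wt_rest:
  "1 \<le> n \<Longrightarrow> m \<in> monomials n \<Longrightarrow> wt n (last_wt n c) m = c * mdeg (rest n m) + lookup m n"
  by (simp add: wt_last_wt mdeg_rest_sum)

lemma last_wt_pos: "1 \<le> c \<Longrightarrow> 1 \<le> last_wt n c i"
  by (simp add: last_wt_def)

lemma last_wt_anti: "1 \<le> c \<Longrightarrow> i \<le> j \<Longrightarrow> last_wt n c j \<le> last_wt n c i"
  by (simp add: last_wt_def)

lemma gens_eqI:
  assumes U: "mon_closed n U" and sub: "M \<subseteq> U"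
    and min: "\<And>u v. u + v \<in> M \<Longrightarrow> v \<noteq> 0 \<Longrightarrow> u \<notin> U"
    and gen: "\<And>g. g \<in> gens n U \<Longrightarrow> g \<in> M"
  shows "gens n U = M"
proof (intro equalityI subsetI)
  fix m assume m: "m \<in> M"
  have "u = m" if u: "u \<in> U" "lookup u \<le> lookup m" for u
  proof -
    obtain v where "m = u + v" using u(2) by (auto simp: mon_le_iff)
    then show ?thesis using min[of u v] m u(1) by (cases "v = 0") auto
  qed
  then show "m \<in> gens n U" using m sub by (auto simp: gens_def)
qed (rule gen)

definition J_mons :: "nat \<Rightarrow> nat \<Rightarrow> mon set" where
  "J_mons n e = wideal n (last_wt n 2) (e + 1)"

text \<open>Without \<open>x_n\<close> the weight is even, so the least degree with weight at least
  \<open>e + 1\<close> is \<open>e div 2 + 1\<close>. With \<open>x_n\<close>, which has weight 1,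
  minimality forces the weight to be exactly \<open>e + 1\<close>.\<close>

definition J_gens :: "nat \<Rightarrow> nat \<Rightarrow> mon set" where
  "J_gens n e = {g \<in> monomials n. (lookup g n = 0 \<and> mdeg g = e div 2 + 1) \<or>
     (1 \<le> lookup g n \<and> 2 * mdeg (rest n g) + lookup g n = e + 1)}"

lemma J_mons_iff: "1 \<le> n \<Longrightarrow> m \<in> J_mons n e \<longleftrightarrow> m \<in> monomials n \<and> e < 2 * mdeg (rest n m) + lookup m n"
  by (auto simp: J_mons_def wideal_def wt_last_wt_rest)

lemma J_mons_iff': "1 \<le> n \<Longrightarrow> m \<in> J_mons n e \<longleftrightarrow> m \<in> monomials n \<and> e + lookup m n < 2 * mdeg m"
  using mdeg_rest[of m n] by (auto simp: J_mons_iff)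

lemma rest_add: "rest n (u + v) = rest n u + rest n v"
  by (rule poly_mapping_eqI) (simp add: lookup_rest lookup_add)

lemma gens_J_mons:
  assumes n: "1 \<le> n"
  shows "gens n (J_mons n e) = J_gens n e"
proof (rule gens_eqI)
  show "mon_closed n (J_mons n e)" unfolding J_mons_def by (rule wideal_closed)
  show "J_gens n e \<subseteq> J_mons n e"
  proof
    fix g assume "g \<in> J_gens n e"
    then show "g \<in> J_mons n e" using mdeg_rest[of g n] by (auto simp: J_gens_def J_mons_iff[OF n])
  qed
  show "u \<notin> J_mons n e" if uv: "u + v \<in> J_gens n e" "v \<noteq> 0" for u v
  proof -
    have "0 < mdeg (rest n v) + lookup v n"
      using uv(2) mdeg_rest[of v n] mdeg_eq_0_iff[of v] by (simp del: mdeg_eq_0_iff)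
    then show ?thesis using uv(1) mdeg_rest[of "u + v" n]
      by (auto simp: J_gens_def J_mons_iff[OF n] rest_add lookup_add simp del: mdeg_eq_0_iff)
  qed
  fix g assume g: "g \<in> gens n (J_mons n e)"
  then have gJ: "g \<in> monomials n" "e < 2 * mdeg (rest n g) + lookup g n"
    by (auto simp: gens_def J_mons_iff[OF n])
  have lt: "wt n (last_wt n 2) g < e + 1 + last_wt n 2 i" if "i \<in> keys g" for i
    using g that unfolding J_mons_def
    by (intro gens_wideal_lt last_wt_pos last_wt_anti) auto
  note w = wt_last_wt_rest[OF n gJ(1), of 2]
  show "g \<in> J_gens n e"
  proof (cases "lookup g n = 0")
    case True
    then have "g \<noteq> 0" using gJ(2) by (auto simp: rest_def)
    then obtain i where i: "i \<in> keys g" using nonzero_keys by blast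
    then have "i \<noteq> n" using True by (auto simp: in_keys_iff)
    moreover have "i \<in> {1..n}" using i gJ(1) unfolding monomials_def by blast
    ultimately have "i < n" by simp
    then have "2 * mdeg (rest n g) < e + 3" using lt[OF i] w True by (simp add: last_wt_def)
    then show ?thesis using gJ True mdeg_rest[of g n] by (simp add: J_gens_def)
  next
    case False
    then have "n \<in> keys g" by (simp add: in_keys_iff)
    from lt[OF this] show ?thesis using False gJ w by (simp add: J_gens_def last_wt_def)
  qed
qed

lemma power_mons:
  assumes n: "1 \<le> n"
  shows "{m \<in> monomials n. t \<le> mdeg m} = wideal n (last_wt n 1) t"
proof -
  have "wt n (last_wt n 1) m = mdeg m" if "m \<in> monomials n" for m
    using wt_last_wt_rest[OF n that, of 1] mdeg_rest[of m n] by simp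
  then show ?thesis by (auto simp: wideal_def)
qed

lemma gens_power_mons: "gens n {m \<in> monomials n. t \<le> mdeg m} = {m \<in> monomials n. mdeg m = t}"
proof (rule gens_eqI)
  show "u \<notin> {m \<in> monomials n. t \<le> mdeg m}" if "u + v \<in> {m \<in> monomials n. mdeg m = t}" "v \<noteq> 0" for u v
    using that mdeg_eq_0_iff[of v] by (auto simp del: mdeg_eq_0_iff)
  fix g assume g: "g \<in> gens n {m \<in> monomials n. t \<le> mdeg m}"
  show "g \<in> {m \<in> monomials n. mdeg m = t}"
  proof (rule ccontr)
    assume "\<not> ?thesis"
    then have lt: "t < mdeg g" using g by (auto simp: gens_def)
    then have "g \<noteq> 0" by auto
    then obtain i where i: "i \<in> keys g" using nonzero_keys by blast
    define u where "u = g - Poly_Mapping.single i 1"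
    have s: "g = u + Poly_Mapping.single i 1" using mon_split[OF i] by (simp add: u_def)
    then have "mdeg g = mdeg u + 1" "lookup u \<le> lookup g" by (simp, metis mon_le_iff)
    moreover have "u \<in> monomials n" using g s by (auto simp: gens_def)
    ultimately have "u = g" using g lt by (simp add: gens_def)
    then show False using \<open>mdeg g = mdeg u + 1\<close> by simp
  qed
qed (auto simp: mon_closed_def)

lemma keys_add_single: "keys (r + Poly_Mapping.single n k :: mon) = keys r \<union> (if k = 0 then {} else {n})"
  by (simp add: keys_add_nat)

text \<open>Generators on both sides are determined by their part \<open>r\<close> outside
  \<open>x_n\<close>, an arbitrary monomial in \<open>n - 1\<close> variables of degree at most
  \<open>e div 2 + 1\<close>. If \<open>r\<close> has exactly this degree, \<open>x_n\<close> is
  absent; otherwise its exponent completes the weight to \<open>e + 1\<close> on one side and the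
  degree to \<open>e div 2 + 1\<close> on the other.\<close>

lemma J_gens_bij:
  assumes n: "1 \<le> n"
  shows "bij_betw (\<lambda>g. rest n g + Poly_Mapping.single n (e div 2 + 1 - mdeg (rest n g)))
    (J_gens n e) {m \<in> monomials n. mdeg m = e div 2 + 1}" (is "bij_betw ?h _ _")
proof (rule bij_betw_byWitness)
  let ?d = "e div 2"
  let ?k = "\<lambda>g. if mdeg (rest n g) = ?d + 1 then 0 else e + 1 - 2 * mdeg (rest n g)"
  define h' where "h' g = rest n g + Poly_Mapping.single n (?k g)" for g
  have rm: "rest n g \<in> monomials (n - 1)" "rest n g \<in> monomials n" if "g \<in> monomials n" for g
    using rest_monomials[OF that] monomials_mono by auto
  note rs = rest_add_single[OF n rm(1)]
  show "\<forall>g\<in>J_gens n e. h' (?h g) = g"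
  proof
    fix g assume g: "g \<in> J_gens n e"
    then have gm: "g \<in> monomials n" by (simp add: J_gens_def)
    have "?k (?h g) = lookup g n" using g mdeg_rest[of g n] unfolding rs[OF gm] by (auto simp: J_gens_def)
    then show "h' (?h g) = g" unfolding h'_def rs[OF gm] using rest_split[of g n] by simp
  qed
  show "\<forall>g\<in>{m \<in> monomials n. mdeg m = ?d + 1}. ?h (h' g) = g"
  proof
    fix g assume g: "g \<in> {m \<in> monomials n. mdeg m = ?d + 1}"
    then have gm: "g \<in> monomials n" by simp
    have "mdeg g = ?d + 1" using g by simp
    then have "?d + 1 - mdeg (rest n g) = lookup g n" using mdeg_rest[of g n] by linarith
    then show "?h (h' g) = g" unfolding h'_def rs[OF gm] using rest_split[of g n] by simp
  qed
  show "?h ` J_gens n e \<subseteq> {m \<in> monomials n. mdeg m = ?d + 1}"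
  proof
    fix m assume "m \<in> ?h ` J_gens n e"
    then obtain g where g: "g \<in> J_gens n e" "m = ?h g" by blast
    then have gm: "g \<in> monomials n" by (simp add: J_gens_def)
    have "mdeg (rest n g) \<le> ?d + 1" using g(1) mdeg_rest[of g n] by (auto simp: J_gens_def)
    then show "m \<in> {m \<in> monomials n. mdeg m = ?d + 1}"
      using rm[OF gm] n by (simp add: g(2) monomials_single)
  qed
  show "h' ` {m \<in> monomials n. mdeg m = ?d + 1} \<subseteq> J_gens n e"
  proof
    fix m assume "m \<in> h' ` {m \<in> monomials n. mdeg m = ?d + 1}"
    then obtain g where g: "g \<in> monomials n" "mdeg g = ?d + 1" "m = h' g" by blast
    have "lookup m n = ?k g" using lookup_last_pred[OF n rm(1)[OF g(1)]] by (simp add: g(3) h'_def lookup_add)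
    moreover have "rest n m = rest n g" unfolding g(3) h'_def by (rule rs[OF g(1)])
    moreover have "mdeg (rest n g) \<le> ?d + 1" using g(2) mdeg_rest[of g n] by simp
    moreover have "m \<in> monomials n" using rm[OF g(1)] n by (simp add: g(3) h'_def monomials_single)
    ultimately show "m \<in> J_gens n e"
      using mdeg_rest[of m n] by (auto simp: J_gens_def split: if_splits)
  qed
qed

text \<open>The two exponents of \<open>x_n\<close> vanish for the same \<open>r\<close>, so
  corresponding generators have the same last variable and contribute equally to total Betti
  numbers.\<close>

lemma top_var_J_gens_bij:
  assumes n: "1 \<le> n" and g: "g \<in> J_gens n e"
  shows "top_var (rest n g + Poly_Mapping.single n (e div 2 + 1 - mdeg (rest n g))) = top_var g"
proof -
  have "e div 2 + 1 - mdeg (rest n g) = 0 \<longleftrightarrow> lookup g n = 0"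
    using g mdeg_rest[of g n] by (auto simp: J_gens_def)
  then have "keys (rest n g + Poly_Mapping.single n (e div 2 + 1 - mdeg (rest n g)))
      = keys (rest n g + Poly_Mapping.single n (lookup g n))"
    unfolding keys_add_single by simp
  then show ?thesis unfolding top_var_def rest_split[of g n, symmetric] by simp
qed

section \<open>Counting generators by last variable and degree\<close>

lemma top_var_eq_iff: "g \<noteq> 0 \<Longrightarrow> top_var g = i \<longleftrightarrow> i \<in> keys g \<and> (\<forall>j\<in>keys g. j \<le> i)"
  unfolding top_var_def using nonzero_keys[of g] by (subst eq_commute, subst Max_eq_iff) auto

lemma J_gens_nonzero: "g \<in> J_gens n e \<Longrightarrow> g \<noteq> 0"
  by (auto simp: J_gens_def)

text \<open>These generators avoid \<open>x_n\<close>, so they have degree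
  \<open>e div 2 + 1\<close>; dividing by \<open>x_i\<close> leaves an arbitrary monomial of degree
  \<open>e div 2\<close> in \<open>x_1, ..., x_i\<close>.\<close>

lemma card_J_gens_inner:
  assumes i: "i \<in> {1..<n}"
  shows "card {g \<in> J_gens n e. mdeg g = e div 2 + 1 \<and> top_var g = i} = card {m \<in> monomials i. mdeg m = e div 2}"
    and "q > e div 2 + 1 \<Longrightarrow> {g \<in> J_gens n e. mdeg g = q \<and> top_var g = i} = {}"
proof -
  have n0: "lookup g n = 0" if g: "g \<in> J_gens n e" "top_var g = i" for g
  proof -
    have "n \<notin> keys g" using top_var_eq_iff[OF J_gens_nonzero[OF g(1)], of i] g(2) i by auto
    then show ?thesis by (simp add: in_keys_iff)
  qed
  show "{g \<in> J_gens n e. mdeg g = q \<and> top_var g = i} = {}" if q: "q > e div 2 + 1"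
  proof (rule equals0I)
    fix g assume g: "g \<in> {g \<in> J_gens n e. mdeg g = q \<and> top_var g = i}"
    then have "lookup g n = 0" by (intro n0) auto
    then show False using g q by (simp add: J_gens_def)
  qed
  let ?x = "Poly_Mapping.single i (1::nat)"
  have "{g \<in> J_gens n e. mdeg g = e div 2 + 1 \<and> top_var g = i} = (+) ?x ` {m \<in> monomials i. mdeg m = e div 2}"
  proof (intro equalityI subsetI)
    fix g assume g: "g \<in> {g \<in> J_gens n e. mdeg g = e div 2 + 1 \<and> top_var g = i}"
    then have k: "i \<in> keys g" "\<forall>j\<in>keys g. j \<le> i"
      using top_var_eq_iff[OF J_gens_nonzero, of g n e i] by auto
    have "g \<in> monomials i" using g k(2) by (auto simp: J_gens_def monomials_def subset_iff)
    define v where "v = g - ?x"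
    have s: "g = ?x + v" using mon_split[OF k(1)] by (simp add: v_def add.commute)
    have "v \<in> monomials i" using \<open>g \<in> monomials i\<close> unfolding s by simp
    moreover have "mdeg v = e div 2" using g arg_cong[OF s, of mdeg] by simp
    ultimately show "g \<in> (+) ?x ` {m \<in> monomials i. mdeg m = e div 2}" using s by blast
  next
    fix g assume "g \<in> (+) ?x ` {m \<in> monomials i. mdeg m = e div 2}"
    then obtain m where m: "g = ?x + m" "m \<in> monomials i" "mdeg m = e div 2" by blast
    have gi: "g \<in> monomials i" using m i by (simp add: monomials_single)
    have "i \<in> keys g" using m(1) by (simp add: in_keys_iff lookup_add)
    moreover then have "g \<noteq> 0" by auto
    ultimately have "top_var g = i" using gi by (subst top_var_eq_iff) (auto simp: monomials_def)
    moreover have "lookup g n = 0" using monomials_lookup_0[OF gi, of n] i by simp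
    moreover have "g \<in> monomials n" using monomials_mono[OF gi] i by simp
    ultimately show "g \<in> {g \<in> J_gens n e. mdeg g = e div 2 + 1 \<and> top_var g = i}"
      using m by (simp add: J_gens_def)
  qed
  then show "card {g \<in> J_gens n e. mdeg g = e div 2 + 1 \<and> top_var g = i} = card {m \<in> monomials i. mdeg m = e div 2}"
    by (simp add: card_image)
qed

lemma J_gens_last:
  assumes n: "1 \<le> n"
  shows "{g \<in> J_gens n e. mdeg g = q \<and> top_var g = n} =
    {g \<in> monomials n. 1 \<le> lookup g n \<and> mdeg g = q \<and> 2 * q = e + 1 + lookup g n}" (is "?A = ?B")
proof (intro equalityI subsetI)
  fix g assume g: "g \<in> ?A"
  then have "n \<in> keys g" using top_var_eq_iff[OF J_gens_nonzero, of g n e n] by auto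
  then show "g \<in> ?B" using g mdeg_rest[of g n] by (auto simp: J_gens_def in_keys_iff)
next
  fix g assume g: "g \<in> ?B"
  then have "n \<in> keys g" by (simp add: in_keys_iff)
  moreover then have "g \<noteq> 0" by auto
  ultimately have "top_var g = n" using g by (subst top_var_eq_iff) (auto simp: monomials_def)
  then show "g \<in> ?A" using g mdeg_rest[of g n] by (auto simp: J_gens_def)
qed

text \<open>Degree \<open>q\<close> and weight \<open>e + 1\<close> fix the exponent of
  \<open>x_n\<close> as \<open>2q - e - 1\<close> and the degree of the rest as
  \<open>e + 1 - q\<close>. The hypothesis on \<open>q\<close> makes that exponent positive; it
  covers all \<open>q > e div 2 + 1\<close> and, for even \<open>e\<close>, also
  \<open>q = e div 2 + 1\<close>.\<close>

lemma card_J_gens_last: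
  assumes n: "1 \<le> n" and q: "e + 1 < 2 * q"
  shows "card {g \<in> J_gens n e. mdeg g = q \<and> top_var g = n} =
    card {m \<in> monomials (n - 1). int (mdeg m) = int e + 1 - int q}"
proof -
  let ?k = "2 * q - e - 1"
  let ?f = "\<lambda>r. r + Poly_Mapping.single n ?k" and ?R = "{m \<in> monomials (n - 1). int (mdeg m) = int e + 1 - int q}"
  have "{g \<in> J_gens n e. mdeg g = q \<and> top_var g = n} = ?f ` ?R"
    unfolding J_gens_last[OF n]
  proof (intro equalityI subsetI)
    fix g assume g: "g \<in> {g \<in> monomials n. 1 \<le> lookup g n \<and> mdeg g = q \<and> 2 * q = e + 1 + lookup g n}"
    have k: "lookup g n = ?k" using g by simp
    show "g \<in> ?f ` ?R"
    proof
      show "g = ?f (rest n g)" using rest_split[of g n] unfolding k .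
      show "rest n g \<in> ?R" using g rest_monomials[of g n] mdeg_rest[of g n] by auto
    qed
  next
    fix g assume "g \<in> ?f ` ?R"
    then obtain r where r: "g = ?f r" "r \<in> monomials (n - 1)" "int (mdeg r) = int e + 1 - int q" by blast
    have "g \<in> monomials n" using r(2) n monomials_mono[of r "n - 1" n] by (simp add: r(1) monomials_single)
    moreover have "lookup g n = ?k" using lookup_last_pred[OF n r(2)] by (simp add: r(1) lookup_add)
    moreover have "mdeg g = q" using r q by simp
    ultimately show "g \<in> {g \<in> monomials n. 1 \<le> lookup g n \<and> mdeg g = q \<and> 2 * q = e + 1 + lookup g n}"
      using q by simp
  qed
  moreover have "inj_on ?f ?R" by (auto simp: inj_on_def)
  ultimately show ?thesis by (simp add: card_image)
qed

section \<open>Structure and Betti numbers of the initial ideal\<close>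

lemma monomial_ideal_mspan:
  assumes "mon_closed n U"
  shows "mspan U = (Idl\<^bsub>poly_ring n\<^esub> (X ` U) :: 'a::field mpoly set)" "monomial_ideal n (mspan U :: 'a mpoly set)"
proof -
  have U: "U \<subseteq> monomials n" using assms by (simp add: mon_closed_def)
  show "mspan U = (Idl\<^bsub>poly_ring n\<^esub> (X ` U) :: 'a mpoly set)"
    using genideal_X[OF U] upset_of_closed[OF assms] by metis
  then show "monomial_ideal n (mspan U :: 'a mpoly set)" using U by (auto simp: monomial_ideal_def)
qed

lemma J_mons_closed: "mon_closed n (J_mons n e)"
  unfolding J_mons_def by (rule wideal_closed)

text \<open>In a fixed degree, membership is an upper bound on the exponent of \<open>x_n\<close>,
  and a larger monomial does not have a larger exponent there.\<close>

lemma reverse_lexicographic_J: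
  assumes n: "1 \<le> n"
  shows "reverse_lexicographic n (mspan (J_mons n e) :: 'a::field mpoly set)"
  unfolding reverse_lexicographic_def
proof (intro conjI allI)
  show "monomial_ideal n (mspan (J_mons n e) :: 'a mpoly set)" by (rule monomial_ideal_mspan[OF J_mons_closed])
  fix t
  let ?M = "{m \<in> J_mons n e. mdeg m = t}"
  show "\<exists>M\<subseteq>{m \<in> monomials n. mdeg m = t}. (\<forall>v\<in>M. \<forall>u\<in>monomials n. mdeg u = t \<and> drl_less v u \<longrightarrow> u \<in> M) \<and>
      mspan (J_mons n e) \<inter> forms n (int t) = {f :: 'a mpoly. keys f \<subseteq> M}"
  proof (intro exI[of _ ?M] conjI ballI impI)
    show "?M \<subseteq> {m \<in> monomials n. mdeg m = t}" by (auto simp: J_mons_iff'[OF n])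
    fix v u assume v: "v \<in> ?M" and u: "u \<in> monomials n" "mdeg u = t \<and> drl_less v u"
    then have "lookup u n \<le> lookup v n" by (intro drl_less_last_var) (auto simp: J_mons_iff'[OF n])
    then show "u \<in> ?M" using v u by (auto simp: J_mons_iff'[OF n])
  next
    show "mspan (J_mons n e) \<inter> forms n (int t) = {f :: 'a mpoly. keys f \<subseteq> ?M}"
      by (auto simp: mspan_def forms_def polys_def J_mons_iff'[OF n] subset_iff)
  qed
qed

text \<open>The exchange keeps the degree, and it cannot raise the exponent of \<open>x_n\<close>
  because \<open>j < i <= n\<close>.\<close>

lemma strongly_stable_J:
  assumes n: "1 \<le> n"
  shows "strongly_stable n (mspan (J_mons n e) :: 'a::field mpoly set)"
  unfolding strongly_stable_def
proof (intro conjI ballI impI)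
  show "monomial_ideal n (mspan (J_mons n e) :: 'a mpoly set)" by (rule monomial_ideal_mspan[OF J_mons_closed])
  fix m i j assume m: "m \<in> monomials n" "(X m :: 'a mpoly) \<in> mspan (J_mons n e)" and i: "i \<in> keys m" and j: "j \<in> {1..<i}"
  define u where "u = m - Poly_Mapping.single i 1"
  have s: "m = u + Poly_Mapping.single i 1" using mon_split[OF i] by (simp add: u_def)
  have "i \<in> {1..n}" using i m(1) unfolding monomials_def by blast
  then have j': "j \<in> {1..n}" "j \<noteq> n" using j by auto
  have "e + lookup m n < 2 * mdeg m" using m(2) by (simp add: J_mons_iff'[OF n])
  moreover have "mdeg m = mdeg u + 1" using arg_cong[OF s, of mdeg] by simp
  moreover have "lookup u n \<le> lookup m n" by (simp add: u_def lookup_minus)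
  moreover have "lookup (u + Poly_Mapping.single j 1) n = lookup u n" using j' by (simp add: lookup_add lookup_single)
  moreover have "u \<in> monomials n" using m(1) s by simp
  ultimately have "u + Poly_Mapping.single j 1 \<in> J_mons n e"
    using j' by (simp add: J_mons_iff'[OF n] monomials_single)
  then show "X (m - Poly_Mapping.single i 1 + Poly_Mapping.single j 1) \<in> (mspan (J_mons n e) :: 'a mpoly set)"
    by (simp add: u_def)
qed

lemma generated_in_degrees_J:
  assumes n: "1 \<le> n"
  shows "generated_in_degrees n (mspan (J_mons n e) :: 'a::field mpoly set) {e div 2 + 1..e + 1}"
proof -
  let ?J = "mspan (J_mons n e) :: 'a mpoly set"
  let ?S = "\<Union>q\<in>{e div 2 + 1..e + 1}. ?J \<inter> forms n (int q)"
  interpret cring "poly_ring n :: 'a mpoly ring" by (rule poly_ring_cring)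
  have gm: "J_gens n e \<subseteq> monomials n" by (auto simp: J_gens_def)
  have JJ: "?J = Idl\<^bsub>poly_ring n\<^esub> (X ` J_gens n e)"
    using genideal_X[OF gm, where 'a='a] upset_gens[OF J_mons_closed, of n e] gens_J_mons[OF n, of e] by simp
  have sub: "X ` J_gens n e \<subseteq> ?S"
  proof
    fix f :: "'a mpoly" assume "f \<in> X ` J_gens n e"
    then obtain g where g: "f = X g" "g \<in> J_gens n e" by blast
    \<comment> \<open>If \<open>x_n\<close> divides \<open>g\<close> with exponent k, then
      \<open>2 * mdeg g = e + 1 + k\<close> with \<open>1 <= k <= mdeg g\<close>, which gives both
      bounds.\<close>
    have "mdeg g \<in> {e div 2 + 1..e + 1}" using g(2) mdeg_rest[of g n] lookup_le_mdeg[of g n] by (auto simp: J_gens_def)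
    moreover have "g \<in> J_mons n e" using g(2) gens_J_mons[OF n, of e] by (auto simp: gens_def)
    moreover have "f \<in> forms n (int (mdeg g))" using g gm forms_X by blast
    ultimately show "f \<in> ?S" using g(1) by auto
  qed
  have S: "?S \<subseteq> polys n" by (auto simp: forms_def)
  have "?J = Idl\<^bsub>poly_ring n\<^esub> ?S"
  proof
    show "Idl\<^bsub>poly_ring n\<^esub> ?S \<subseteq> ?J"
      by (intro genideal_minimal mspan_ideal J_mons_closed) auto
    have "X ` J_gens n e \<subseteq> Idl\<^bsub>poly_ring n\<^esub> ?S"
      using sub genideal_self[of ?S] S by (simp only: poly_ring_simps) blast
    moreover have "ideal (Idl\<^bsub>poly_ring n\<^esub> ?S) (poly_ring n)" using S by (intro genideal_ideal) simp
    ultimately show "?J \<subseteq> Idl\<^bsub>poly_ring n\<^esub> ?S" unfolding JJ by (intro genideal_minimal)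
  qed
  then show ?thesis by (simp add: generated_in_degrees_def)
qed

text \<open>Both sides are sums over minimal generators of a term depending only on the last
  variable, so the bijection between the generators reindexes one into the other.\<close>

lemma total_betti_J:
  assumes n: "1 \<le> n"
  shows "total_betti n (mspan (J_mons n e) :: 'a::field mpoly set) p =
    total_betti n (ideal_power n (max_ideal n :: 'a mpoly set) (e div 2 + 1)) p"
proof (cases p)
  case 0
  have "total_betti n (mspan (wideal n (last_wt n 2) (e + 1)) :: 'a mpoly set) 0 = 1"
    by (rule total_betti_wideal_0[OF last_wt_pos last_wt_anti]) auto
  moreover have "total_betti n (mspan (wideal n (last_wt n 1) (e div 2 + 1)) :: 'a mpoly set) 0 = 1"
    by (rule total_betti_wideal_0[OF last_wt_pos last_wt_anti]) auto
  ultimately show ?thesis using 0 unfolding ideal_power_max_ideal power_mons[OF n] J_mons_def by simp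
next
  case (Suc r)
  let ?h = "\<lambda>g. rest n g + Poly_Mapping.single n (e div 2 + 1 - mdeg (rest n g))"
  have "total_betti n (mspan (wideal n (last_wt n 2) (e + 1)) :: 'a mpoly set) (Suc r) =
      (\<Sum>g\<in>gens n (wideal n (last_wt n 2) (e + 1)). (top_var g - 1) choose r)"
    by (rule total_betti_wideal_Suc[OF last_wt_pos last_wt_anti]) auto
  then have J: "total_betti n (mspan (J_mons n e) :: 'a mpoly set) (Suc r) = (\<Sum>g\<in>J_gens n e. (top_var g - 1) choose r)"
    using gens_J_mons[OF n, of e] by (simp add: J_mons_def)
  have "total_betti n (mspan (wideal n (last_wt n 1) (e div 2 + 1)) :: 'a mpoly set) (Suc r) =
      (\<Sum>g\<in>gens n (wideal n (last_wt n 1) (e div 2 + 1)). (top_var g - 1) choose r)"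
    by (rule total_betti_wideal_Suc[OF last_wt_pos last_wt_anti]) auto
  then have "total_betti n (ideal_power n (max_ideal n :: 'a mpoly set) (e div 2 + 1)) (Suc r) =
      (\<Sum>g\<in>{m \<in> monomials n. mdeg m = e div 2 + 1}. (top_var g - 1) choose r)"
    unfolding ideal_power_max_ideal power_mons[OF n, symmetric] gens_power_mons .
  also have "\<dots> = (\<Sum>g\<in>J_gens n e. (top_var (?h g) - 1) choose r)"
    by (rule sum.reindex_bij_betw[OF J_gens_bij[OF n], symmetric])
  also have "\<dots> = (\<Sum>g\<in>J_gens n e. (top_var g - 1) choose r)"
    using top_var_J_gens_bij[OF n] by (intro sum.cong) simp_all
  finally show ?thesis using J Suc by simp
qed

lemma num_gens_J:
  assumes n: "1 \<le> n"
  shows "num_gens n (mspan (J_mons n e) :: 'a::field mpoly set) i q = card {g \<in> J_gens n e. mdeg g = q \<and> top_var g = i}"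
proof -
  have "num_gens n (mspan (wideal n (last_wt n 2) (e + 1)) :: 'a mpoly set) i q =
      card {g \<in> gens n (wideal n (last_wt n 2) (e + 1)). mdeg g = q \<and> top_var g = i}"
    by (rule num_gens_wideal[OF last_wt_pos last_wt_anti]) auto
  then show ?thesis using gens_J_mons[OF n, of e] by (simp add: J_mons_def)
qed

lemma betti_J:
  assumes "1 \<le> n" "p \<ge> 1"
  shows "betti n (mspan (J_mons n e) :: 'a::field mpoly set) p (p + q - 1) =
    (\<Sum>i = 1..n. num_gens n (mspan (J_mons n e) :: 'a mpoly set) i q * ((i - 1) choose (p - 1)))"
  unfolding J_mons_def by (rule betti_wideal_num_gens[OF last_wt_pos last_wt_anti]) (use assms in auto)

lemma initial_ideal_Ann:
  assumes n: "1 \<le> n" and G: "G \<in> forms n (int e)" and lef: "lefschetz n e (scaled (G :: 'a::field mpoly))"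
  shows "initial_ideal n (Ann n G) = mspan (J_mons n e)"
proof -
  have L: "u \<in> monomials n \<and> mdeg u = e" if "scaled G u \<noteq> 0" for u
  proof -
    have "u \<in> keys G" using that by (simp add: scaled_def in_keys_iff)
    then show ?thesis using G by (auto simp: forms_def polys_def)
  qed
  have "{lead_mon f | f. f \<in> Ann n G \<and> f \<noteq> 0} = {m \<in> monomials n. e + lookup m n < 2 * mdeg m}"
    unfolding Ann_eq_pairing[OF G] by (rule lead_mon_annihilator[OF n L lef])
  also have "\<dots> = J_mons n e" by (auto simp: J_mons_iff'[OF n])
  finally have "{lead_mon f | f. f \<in> Ann n G \<and> f \<noteq> 0} = J_mons n e" .
  moreover have "{X (lead_mon f) :: 'a mpoly | f. f \<in> Ann n G \<and> f \<noteq> 0} = X ` {lead_mon f | f. f \<in> Ann n G \<and> f \<noteq> 0}"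
    by blast
  ultimately show ?thesis
    unfolding initial_ideal_def monomial_ideal_mspan(1)[OF J_mons_closed] by simp
qed

lemma generic_form_mono:
  "generic_form n e Q \<Longrightarrow> (\<And>G. G \<in> forms n (int e) \<Longrightarrow> Q G \<Longrightarrow> Q' G) \<Longrightarrow> generic_form n e Q'"
  unfolding generic_form_def by blast

theorem mainTheorem5:
  fixes n e d :: nat
  assumes "n \<ge> 1" and "e \<ge> 1" and "d = e div 2"
  shows "generic_form n e (\<lambda>G :: 'a::field mpoly.
    let J = initial_ideal n (Ann n G); a = num_gens n J in
      reverse_lexicographic n J \<and>
      strongly_stable n J \<and>
      generated_in_degrees n J {d + 1..e + 1} \<and>
      (\<forall>m\<in>monomials n. mdeg m = d + 1 \<and> n \<notin> keys m \<longrightarrow> X m \<in> J) \<and>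
      (\<forall>p. total_betti n J p =
             total_betti n (ideal_power n (max_ideal n :: 'a mpoly set) (d + 1)) p) \<and>
      (\<forall>p\<ge>1. \<forall>q. betti n J p (p + q - 1) =
             (\<Sum>i = 1..n. a i q * ((i - 1) choose (p - 1)))) \<and>
      (\<forall>i\<in>{1..<n}. a i (d + 1) = dim_k (forms i (int d) :: 'a mpoly set) \<and>
             a i (d + 1) = (d + i - 1) choose d) \<and>
      (\<forall>i\<in>{1..<n}. \<forall>q>d + 1. a i q = 0) \<and>
      (\<forall>q>d + 1. a n q = dim_k (forms (n - 1) (int e + 1 - int q) :: 'a mpoly set) \<and>
             a n q = binom (int e - int q + int n - 1) (int n - 2)) \<and>
      (e = 2 * d + 1 \<longrightarrow> a n (d + 1) = 0) \<and>
      (e = 2 * d \<longrightarrow> a n (d + 1) = dim_k (forms (n - 1) (int d) :: 'a mpoly set) \<and>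
             a n (d + 1) = (d + n - 2) choose d) \<and>
      (\<forall>p\<ge>1. \<forall>q>d + 1. betti n J p (p + q - 1) =
             binom (int e - int q + int n - 1) (int n - 2) * ((n - 1) choose (p - 1))) \<and>
      (\<forall>p\<ge>1. betti n J p (p + d) =
             (if odd e
              then (\<Sum>i = 1..n - 1. ((d + i - 1) choose d) * ((i - 1) choose (p - 1)))
              else ((d + n - 2) choose d) * ((n - 1) choose (p - 1)) +
                   (\<Sum>i = 1..n - 1. ((d + i - 1) choose d) * ((i - 1) choose (p - 1))))))"
proof (rule generic_form_mono[OF generic_lefschetz[OF assms(1)]], goal_cases)
  case G: (1 G)
  note n = assms(1) and d = assms(3)
  define J :: "'a mpoly set" where "J = mspan (J_mons n e)"
  define a where "a = num_gens n J"
  have I: "initial_ideal n (Ann n G) = J" unfolding J_def by (rule initial_ideal_Ann[OF n G])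
  have a: "a i q = card {g \<in> J_gens n e. mdeg g = q \<and> top_var g = i}" for i q
    unfolding a_def J_def by (rule num_gens_J[OF n])
  have betti: "betti n J p (p + q - 1) = (\<Sum>i = 1..n. a i q * ((i - 1) choose (p - 1)))" if "p \<ge> 1" for p q
    unfolding a_def J_def by (rule betti_J[OF n that])
  have inner: "a i (d + 1) = dim_k (forms i (int d) :: 'a mpoly set)" "a i (d + 1) = (d + i - 1) choose d"
    if "i \<in> {1..<n}" for i
    using that card_J_gens_inner(1)[OF that, of e] by (simp_all add: a d dim_k_forms card_monomials_mdeg')
  have inner0: "a i q = 0" if "i \<in> {1..<n}" "q > d + 1" for i q
    unfolding a card_J_gens_inner(2)[OF that(1) that(2)[unfolded d]] by simp
  have last: "a n q = dim_k (forms (n - 1) (int e + 1 - int q) :: 'a mpoly set)" if "e + 1 < 2 * q" for q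
    using card_J_gens_last[OF n that] by (simp add: a dim_k_forms)
  have last': "a n q = binom (int e - int q + int n - 1) (int n - 2)" if "q > d + 1" for q
  proof -
    have eq: "int e + 1 - int q + int (n - 1) - 1 = int e - int q + int n - 1" "int (n - 1) - 1 = int n - 2"
      using n by (simp_all add: of_nat_diff)
    have "e + 1 < 2 * q" using that d by simp
    from last[OF this] show ?thesis unfolding dim_k_forms card_monomials_eq_binom eq .
  qed
  have odd: "a n (d + 1) = 0" if "e = 2 * d + 1"
  proof -
    \<comment> \<open>For odd \<open>e\<close> the exponent of \<open>x_n\<close> would be
      \<open>2 (d + 1) - e - 1 = 0\<close>.\<close>
    have "{g \<in> monomials n. 1 \<le> lookup g n \<and> mdeg g = d + 1 \<and> 2 * (d + 1) = e + 1 + lookup g n} = {}"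
      using that by auto
    then show ?thesis by (simp only: a J_gens_last[OF n] card.empty)
  qed
  have even: "a n (d + 1) = dim_k (forms (n - 1) (int d) :: 'a mpoly set)" if "e = 2 * d"
    using last[of "d + 1"] that by simp
  have even': "a n (d + 1) = (d + n - 2) choose d" if "e = 2 * d"
  \<comment> \<open>For \<open>n = 1\<close> the natural number \<open>d + n - 2\<close> is
    \<open>d - 1\<close>. Since \<open>e >= 1\<close> is even, \<open>d >= 1\<close>, so the
    binomial coefficient is 0, as is the number of monomials of degree \<open>d\<close> in no
    variables.\<close>
  proof (cases "n = 1")
    case True
    then show ?thesis using even[OF that] assms(2) that by (simp add: dim_k_forms card_monomials_no_vars)
  next
    case False
    then show ?thesis using even[OF that] n card_monomials_mdeg'[of "n - 1" d]
      by (simp add: dim_k_forms numeral_2_eq_2)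
  qed
  have split: "(\<Sum>i = 1..n. f i) = f n + (\<Sum>i = 1..n - 1. f i)" for f :: "nat \<Rightarrow> nat"
  proof -
    have "{1..n} = insert n {1..n - 1}" using n by auto
    then show ?thesis using n by simp
  qed
  have "betti n J p (p + q - 1) = binom (int e - int q + int n - 1) (int n - 2) * ((n - 1) choose (p - 1))"
    if "p \<ge> 1" "q > d + 1" for p q
  proof -
    \<comment> \<open>Beyond degree \<open>d + 1\<close> every generator has last variable
      \<open>x_n\<close>, so only the term for \<open>i = n\<close> remains.\<close>
    have "(\<Sum>i = 1..n - 1. a i q * ((i - 1) choose (p - 1))) = 0"
      using inner0[OF _ that(2)] by (intro sum.neutral) auto
    then show ?thesis unfolding betti[OF that(1)] split last'[OF that(2)] by simp
  qed
  moreover have "betti n J p (p + d) =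
             (if odd e
              then (\<Sum>i = 1..n - 1. ((d + i - 1) choose d) * ((i - 1) choose (p - 1)))
              else ((d + n - 2) choose d) * ((n - 1) choose (p - 1)) +
                   (\<Sum>i = 1..n - 1. ((d + i - 1) choose d) * ((i - 1) choose (p - 1))))"
    if "p \<ge> 1" for p
  proof -
    have "betti n J p (p + d) = a n (d + 1) * ((n - 1) choose (p - 1)) + (\<Sum>i = 1..n - 1. a i (d + 1) * ((i - 1) choose (p - 1)))"
      using betti[OF that, of "d + 1"] unfolding split by simp
    also have "(\<Sum>i = 1..n - 1. a i (d + 1) * ((i - 1) choose (p - 1))) = (\<Sum>i = 1..n - 1. ((d + i - 1) choose d) * ((i - 1) choose (p - 1)))"
      using inner(2) by (intro sum.cong) auto
    finally have b: "betti n J p (p + d) = a n (d + 1) * ((n - 1) choose (p - 1)) + (\<Sum>i = 1..n - 1. ((d + i - 1) choose d) * ((i - 1) choose (p - 1)))" .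
    show ?thesis
    proof (cases "odd e")
      case True
      then have "a n (d + 1) = 0" using d by (intro odd) simp
      then show ?thesis using True unfolding b by simp
    next
      case False
      then have "a n (d + 1) = (d + n - 2) choose d" using d by (intro even') simp
      then show ?thesis using False unfolding b by simp
    qed
  qed
  moreover have "X m \<in> J" if "m \<in> monomials n" "mdeg m = d + 1 \<and> n \<notin> keys m" for m
    using that d by (auto simp: J_def J_mons_iff'[OF n] in_keys_iff)
  moreover have "a n q = dim_k (forms (n - 1) (int e + 1 - int q) :: 'a mpoly set)" if "q > d + 1" for q
    using last[of q] that d by simp
  moreover have "reverse_lexicographic n J" "strongly_stable n J" "generated_in_degrees n J {d + 1..e + 1}"
    unfolding J_def d by (rule reverse_lexicographic_J[OF n] strongly_stable_J[OF n] generated_in_degrees_J[OF n])+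
  moreover have "total_betti n J p = total_betti n (ideal_power n (max_ideal n :: 'a mpoly set) (d + 1)) p" for p
    unfolding J_def d by (rule total_betti_J[OF n])
  ultimately show ?case
    unfolding I Let_def a_def[symmetric] using betti inner inner0 last' odd even even'
    by (intro conjI ballI allI impI) auto
qed

end
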